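(* There is no commutative Schur ring over $S_6$ of dimension $76$.
   Context: For a finite group $G$ and $X\subseteq G$ write $\overline X=\sum_{x\in X}x\in\mathbb CG$ and $X^{-1}=\{x^{-1}:x\in X\}$. A Schur ring (S-ring) over $G$ is a subring of $\mathbb CG$ constructed from a partition $G=\Gamma_1\cup\dots\cup\Gamma_m$ with $\Gamma_1=\{id\}$ such that (1) for each $i$ there is $j$ with $\Gamma_i^{-1}=\Gamma_j$; (2) for all $i,j$, $\overline{\Gamma_i}\,\overline{\Gamma_j}=\sum_k\lambda_{ijk}\overline{\Gamma_k}$ with $\lambda_{ijk}\in\mathbb Z^{\ge0}$. S-rings are regarded as $\mathbb C$-subalgebras of $\mathbb CG$ (the $\mathbb C$-span of the $\overline{\Gamma_i}$), so the dimension of the S-ring is $m$. (The number $76$ is the sum of the degrees of the irreducible complex characters of $S_6$.) *)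

theory Defs
  imports
    Complex_Main
    "HOL-Algebra.Subrings"
    "HOL-Algebra.Sym_Groups"
    "HOL-Library.Disjoint_Sets"
    "HOL-Library.Function_Algebras"
begin

text \<open>Elements of the complex group algebra of \<open>G\<close> are coefficient functions
  \<^typ>\<open>'a \<Rightarrow> complex\<close> that vanish outside \<open>carrier G\<close>. Addition is the pointwise addition
  of functions; multiplication is not the pointwise one.\<close>

definition cscale :: "complex \<Rightarrow> ('a \<Rightarrow> complex) \<Rightarrow> 'a \<Rightarrow> complex"
  where "cscale c f = (\<lambda>x. c * f x)"

global_interpretation cfun: vector_space "cscale :: complex \<Rightarrow> ('a \<Rightarrow> complex) \<Rightarrow> 'a \<Rightarrow> complex"
  defines cspan = cfun.span and cdim = cfun.dim
  by unfold_locales (auto simp: cscale_def fun_eq_iff algebra_simps)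

definition basis_elem :: "'a \<Rightarrow> 'a \<Rightarrow> complex"
  where "basis_elem x = (\<lambda>y. if y = x then 1 else 0)"

text \<open>Multiplication is the bilinear extension of the multiplication of \<open>G\<close>.\<close>

definition group_algebra :: "('a, 'b) monoid_scheme \<Rightarrow> ('a \<Rightarrow> complex) ring"
  where "group_algebra G =
    \<lparr> carrier = {f. \<forall>x. x \<notin> carrier G \<longrightarrow> f x = 0},
      monoid.mult = (\<lambda>f g. \<Sum>x\<in>carrier G. \<Sum>y\<in>carrier G. cscale (f x * g y) (basis_elem (x \<otimes>\<^bsub>G\<^esub> y))),
      one = basis_elem \<one>\<^bsub>G\<^esub>,
      zero = 0,
      add = (+) \<rparr>"

definition set_sum :: "'a set \<Rightarrow> 'a \<Rightarrow> complex"
  where "set_sum X = (\<Sum>x\<in>X. basis_elem x)"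

definition schur_partition :: "('a, 'b) monoid_scheme \<Rightarrow> 'a set set \<Rightarrow> bool"
  where "schur_partition G P \<longleftrightarrow>
    partition_on (carrier G) P \<and>
    {\<one>\<^bsub>G\<^esub>} \<in> P \<and>
    (\<forall>X\<in>P. set_inv\<^bsub>G\<^esub> X \<in> P) \<and>
    (\<forall>X\<in>P. \<forall>Y\<in>P. \<exists>l :: 'a set \<Rightarrow> nat.
      set_sum X \<otimes>\<^bsub>group_algebra G\<^esub> set_sum Y = (\<Sum>Z\<in>P. cscale (of_nat (l Z)) (set_sum Z)))"

definition schur_ring :: "('a, 'b) monoid_scheme \<Rightarrow> ('a \<Rightarrow> complex) set \<Rightarrow> bool"
  where "schur_ring G A \<longleftrightarrow> group G \<and> finite (carrier G) \<and>
    (\<exists>P. schur_partition G P \<and> A = cspan (set_sum ` P))"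

lemma sum_fun_apply: "(\<Sum>i\<in>I. f i) x = (\<Sum>i\<in>I. f i x :: complex)"
  by (induction I rule: infinite_finite_induct) auto

lemma group_algebra_mult_apply:
  "(f \<otimes>\<^bsub>group_algebra G\<^esub> g) u =
    (\<Sum>x\<in>carrier G. \<Sum>y\<in>carrier G. if x \<otimes>\<^bsub>G\<^esub> y = u then f x * g y else 0)"
  by (simp add: group_algebra_def sum_fun_apply cscale_def basis_elem_def if_distrib cong: if_cong)
     (intro sum.cong refl, auto)

lemma group_algebra_ring:
  assumes "group G" "finite (carrier G)"
  shows "ring (group_algebra G)"
proof -
  interpret G: group G by fact
  note fin = assms(2)
  show ?thesis
  proof (rule ringI)
    show "abelian_group (group_algebra G)"
    proof (rule abelian_groupI)
      fix f assume "f \<in> carrier (group_algebra G)"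
      then show "\<exists>g\<in>carrier (group_algebra G). g \<oplus>\<^bsub>group_algebra G\<^esub> f = \<zero>\<^bsub>group_algebra G\<^esub>"
        by (intro bexI[of _ "- f"]) (auto simp: group_algebra_def)
    qed (auto simp: group_algebra_def add_ac)
    show "monoid (group_algebra G)"
    proof
      fix f g assume "f \<in> carrier (group_algebra G)" "g \<in> carrier (group_algebra G)"
      have "(f \<otimes>\<^bsub>group_algebra G\<^esub> g) u = 0" if "u \<notin> carrier G" for u
        unfolding group_algebra_mult_apply using that by (intro sum.neutral ballI) auto
      then show "f \<otimes>\<^bsub>group_algebra G\<^esub> g \<in> carrier (group_algebra G)"
        by (simp add: group_algebra_def)
    next
      show "\<one>\<^bsub>group_algebra G\<^esub> \<in> carrier (group_algebra G)"
        by (auto simp: group_algebra_def basis_elem_def)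
    next
      fix f assume f: "f \<in> carrier (group_algebra G)"
      show "\<one>\<^bsub>group_algebra G\<^esub> \<otimes>\<^bsub>group_algebra G\<^esub> f = f"
      proof
        fix u
        have "(\<one>\<^bsub>group_algebra G\<^esub> \<otimes>\<^bsub>group_algebra G\<^esub> f) u
          = (\<Sum>x\<in>carrier G. if x = \<one>\<^bsub>G\<^esub> then (\<Sum>y\<in>carrier G. if y = u then f y else 0) else 0)"
          unfolding group_algebra_mult_apply
          by (intro sum.cong refl) (auto simp: group_algebra_def basis_elem_def intro!: sum.cong sum.neutral)
        then show "(\<one>\<^bsub>group_algebra G\<^esub> \<otimes>\<^bsub>group_algebra G\<^esub> f) u = f u"
          using f fin by (simp add: sum.delta group_algebra_def)
      qed
      show "f \<otimes>\<^bsub>group_algebra G\<^esub> \<one>\<^bsub>group_algebra G\<^esub> = f"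
      proof
        fix u
        have "(f \<otimes>\<^bsub>group_algebra G\<^esub> \<one>\<^bsub>group_algebra G\<^esub>) u
          = (\<Sum>x\<in>carrier G. \<Sum>y\<in>carrier G. if y = \<one>\<^bsub>G\<^esub> then (if x = u then f x else 0) else 0)"
          unfolding group_algebra_mult_apply
          by (intro sum.cong refl) (auto simp: group_algebra_def basis_elem_def)
        then show "(f \<otimes>\<^bsub>group_algebra G\<^esub> \<one>\<^bsub>group_algebra G\<^esub>) u = f u"
          using f fin by (simp add: sum.delta group_algebra_def)
      qed
    next
      fix f g h :: "'a \<Rightarrow> complex"
      let ?C = "carrier G"
      let ?T = "\<lambda>u. \<Sum>x\<in>?C. \<Sum>y\<in>?C. \<Sum>z\<in>?C. if x \<otimes>\<^bsub>G\<^esub> y \<otimes>\<^bsub>G\<^esub> z = u then f x * g y * h z else 0"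
      have L: "((f \<otimes>\<^bsub>group_algebra G\<^esub> g) \<otimes>\<^bsub>group_algebra G\<^esub> h) u = ?T u" for u
      proof -
        have "((f \<otimes>\<^bsub>group_algebra G\<^esub> g) \<otimes>\<^bsub>group_algebra G\<^esub> h) u =
          (\<Sum>v\<in>?C. \<Sum>z\<in>?C. \<Sum>x\<in>?C. \<Sum>y\<in>?C.
             if v = x \<otimes>\<^bsub>G\<^esub> y then (if v \<otimes>\<^bsub>G\<^esub> z = u then f x * g y * h z else 0) else 0)"
          unfolding group_algebra_mult_apply
          by (intro sum.cong refl) (auto simp: sum_distrib_right intro!: sum.cong sum.neutral)
        also have "\<dots> = (\<Sum>x\<in>?C. \<Sum>y\<in>?C. \<Sum>z\<in>?C. \<Sum>v\<in>?C.
             if v = x \<otimes>\<^bsub>G\<^esub> y then (if v \<otimes>\<^bsub>G\<^esub> z = u then f x * g y * h z else 0) else 0)"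
          by (subst sum.swap, subst (2) sum.swap, subst (3) sum.swap,
              subst (1) sum.swap, subst (2) sum.swap, rule refl)
        also have "\<dots> = ?T u"
          using fin by (intro sum.cong refl) (simp add: sum.delta)
        finally show ?thesis .
      qed
      have R: "(f \<otimes>\<^bsub>group_algebra G\<^esub> (g \<otimes>\<^bsub>group_algebra G\<^esub> h)) u = ?T u" for u
      proof -
        have "(f \<otimes>\<^bsub>group_algebra G\<^esub> (g \<otimes>\<^bsub>group_algebra G\<^esub> h)) u =
          (\<Sum>x\<in>?C. \<Sum>v\<in>?C. \<Sum>y\<in>?C. \<Sum>z\<in>?C.
             if v = y \<otimes>\<^bsub>G\<^esub> z then (if x \<otimes>\<^bsub>G\<^esub> v = u then f x * g y * h z else 0) else 0)"
          unfolding group_algebra_mult_apply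
          by (intro sum.cong refl) (auto simp: sum_distrib_left mult.assoc intro!: sum.cong sum.neutral)
        also have "\<dots> = (\<Sum>x\<in>?C. \<Sum>y\<in>?C. \<Sum>z\<in>?C. \<Sum>v\<in>?C.
             if v = y \<otimes>\<^bsub>G\<^esub> z then (if x \<otimes>\<^bsub>G\<^esub> v = u then f x * g y * h z else 0) else 0)"
          by (subst (2) sum.swap, subst (3) sum.swap, rule refl)
        also have "\<dots> = ?T u"
          using fin by (intro sum.cong refl) (simp add: sum.delta G.m_assoc)
        finally show ?thesis .
      qed
      show "f \<otimes>\<^bsub>group_algebra G\<^esub> g \<otimes>\<^bsub>group_algebra G\<^esub> h =
            f \<otimes>\<^bsub>group_algebra G\<^esub> (g \<otimes>\<^bsub>group_algebra G\<^esub> h)"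
        using L R by (simp add: fun_eq_iff)
    qed
  next
    fix f g h
    show "(f \<oplus>\<^bsub>group_algebra G\<^esub> g) \<otimes>\<^bsub>group_algebra G\<^esub> h =
      f \<otimes>\<^bsub>group_algebra G\<^esub> h \<oplus>\<^bsub>group_algebra G\<^esub> g \<otimes>\<^bsub>group_algebra G\<^esub> h"
      by (simp add: group_algebra_def fun_eq_iff sum_fun_apply cscale_def
          algebra_simps sum.distrib)
    show "h \<otimes>\<^bsub>group_algebra G\<^esub> (f \<oplus>\<^bsub>group_algebra G\<^esub> g) =
      h \<otimes>\<^bsub>group_algebra G\<^esub> f \<oplus>\<^bsub>group_algebra G\<^esub> h \<otimes>\<^bsub>group_algebra G\<^esub> g"
      by (simp add: group_algebra_def fun_eq_iff sum_fun_apply cscale_def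
          algebra_simps sum.distrib)
  qed
qed

lemma schur_ring_subring:
  assumes "schur_ring G A"
  shows "subring A (group_algebra G)"
proof -
  from assms obtain P where G: "group G" and fin: "finite (carrier G)"
    and P: "schur_partition G P" and A: "A = cspan (set_sum ` P)"
    by (auto simp: schur_ring_def)
  interpret R: ring "group_algebra G" using G fin by (rule group_algebra_ring)
  have sub: "\<Union>P = carrier G" using P by (simp add: schur_partition_def partition_on_def)
  have bilin: "cscale c f \<otimes>\<^bsub>group_algebra G\<^esub> g = cscale c (f \<otimes>\<^bsub>group_algebra G\<^esub> g)"
      "f \<otimes>\<^bsub>group_algebra G\<^esub> cscale c g = cscale c (f \<otimes>\<^bsub>group_algebra G\<^esub> g)"
      "(f + f') \<otimes>\<^bsub>group_algebra G\<^esub> g = f \<otimes>\<^bsub>group_algebra G\<^esub> g + f' \<otimes>\<^bsub>group_algebra G\<^esub> g"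
      "f \<otimes>\<^bsub>group_algebra G\<^esub> (g + g') = f \<otimes>\<^bsub>group_algebra G\<^esub> g + f \<otimes>\<^bsub>group_algebra G\<^esub> g'"
      "0 \<otimes>\<^bsub>group_algebra G\<^esub> g = 0" "f \<otimes>\<^bsub>group_algebra G\<^esub> 0 = 0" for c f f' g g'
    by (simp_all add: group_algebra_def fun_eq_iff sum_fun_apply cscale_def
          algebra_simps sum.distrib sum_distrib_left)
  have gen: "set_sum X \<otimes>\<^bsub>group_algebra G\<^esub> set_sum Y \<in> A" if XY: "X \<in> P" "Y \<in> P" for X Y
  proof -
    from P XY obtain l :: "'a set \<Rightarrow> nat" where
      "set_sum X \<otimes>\<^bsub>group_algebra G\<^esub> set_sum Y = (\<Sum>Z\<in>P. cscale (of_nat (l Z)) (set_sum Z))"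
      unfolding schur_partition_def by blast
    then show ?thesis unfolding A
      by (simp add: cfun.span_sum cfun.span_scale cfun.span_base)
  qed
  have gen2: "f \<otimes>\<^bsub>group_algebra G\<^esub> set_sum Y \<in> A" if f: "f \<in> A" and Y: "Y \<in> P" for f Y
    using f[unfolded A]
  proof (induction rule: cfun.span_induct_alt)
    case base
    show ?case unfolding bilin A by (rule cfun.span_zero)
  next
    case (step c x y)
    then obtain X where "X \<in> P" "x = set_sum X" by blast
    then show ?case using gen[OF _ Y] step unfolding bilin A
      by (intro cfun.span_add[OF cfun.span_scale]) simp_all
  qed
  have gen3: "f \<otimes>\<^bsub>group_algebra G\<^esub> g \<in> A" if f: "f \<in> A" and g: "g \<in> A" for f g
    using g[unfolded A]
  proof (induction rule: cfun.span_induct_alt)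
    case base
    show ?case unfolding bilin A by (rule cfun.span_zero)
  next
    case (step c x y)
    then obtain X where "X \<in> P" "x = set_sum X" by blast
    then show ?case using gen2[OF f] step unfolding bilin A
      by (intro cfun.span_add[OF cfun.span_scale]) simp_all
  qed
  show ?thesis
  proof (rule R.subringI)
    show AC: "A \<subseteq> carrier (group_algebra G)"
      unfolding A
    proof (rule cfun.span_minimal)
      show "set_sum ` P \<subseteq> carrier (group_algebra G)"
        using sub[symmetric] by (auto simp: group_algebra_def set_sum_def sum_fun_apply basis_elem_def
            intro!: sum.neutral)
      show "cfun.subspace (carrier (group_algebra G))"
        by (auto simp: cfun.subspace_def group_algebra_def cscale_def)
    qed
    have "set_sum {\<one>\<^bsub>G\<^esub>} \<in> A"
      using P by (auto simp: A schur_partition_def intro!: cfun.span_base)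
    then show "\<one>\<^bsub>group_algebra G\<^esub> \<in> A" by (simp add: set_sum_def group_algebra_def)
    show "\<ominus>\<^bsub>group_algebra G\<^esub> h \<in> A" if h: "h \<in> A" for h
    proof -
      have mh: "- h \<in> A" using h unfolding A by (rule cfun.span_neg)
      have "- h \<oplus>\<^bsub>group_algebra G\<^esub> h = \<zero>\<^bsub>group_algebra G\<^esub>" by (simp add: group_algebra_def)
      then have "\<ominus>\<^bsub>group_algebra G\<^esub> h = - h" using R.minus_equality h mh AC by blast
      with mh show ?thesis by simp
    qed
  qed (use gen3 in \<open>auto simp: A group_algebra_def intro: cfun.span_add\<close>)
qed

lemma cdim_schur_ring:
  assumes "finite (carrier G)" "schur_partition G P"
  shows "cdim (cspan (set_sum ` P)) = card P"
proof -
  have part: "\<Union>P = carrier G" "disjoint P" "{} \<notin> P"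
    using assms by (auto simp: schur_partition_def partition_on_def)
  have finP: "finite P" using part(1) assms(1) by (metis finite_UnionD)
  have finX: "finite X" if "X \<in> P" for X
    using that part(1) assms(1) by (metis Union_upper finite_subset)
  have app: "set_sum X x = (if x \<in> X then 1 else 0)" if "X \<in> P" for X x
    using finX[OF that] by (simp add: set_sum_def sum_fun_apply basis_elem_def)
  have eq: "Y = X" if "X \<in> P" "Y \<in> P" "x \<in> X" "x \<in> Y" for X Y x
    using that part(2) by (auto simp: disjoint_def)
  have inj: "inj_on (set_sum :: 'a set \<Rightarrow> 'a \<Rightarrow> complex) P"
    by (rule inj_onI) (auto simp: app fun_eq_iff set_eq_iff split: if_splits)
  have "cfun.independent (set_sum ` P)"
    unfolding cfun.independent_explicit_module
  proof (intro allI impI)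
    fix t :: "('a \<Rightarrow> complex) set" and u w
    assume t: "finite t" "t \<subseteq> set_sum ` P" and z: "(\<Sum>v\<in>t. cscale (u v) v) = 0" and w: "w \<in> t"
    then obtain X where wX: "w = set_sum X" and X: "set_sum X \<in> t" "X \<in> P" by auto
    obtain x where x: "x \<in> X" using X part(3) by (metis all_not_in_conv)
    have "0 = (\<Sum>v\<in>t. u v * v x)" using fun_cong[OF z, of x] by (simp add: sum_fun_apply cscale_def)
    also have "\<dots> = (\<Sum>v\<in>t. if v = set_sum X then u v else 0)"
    proof (intro sum.cong refl)
      fix v assume "v \<in> t"
      then obtain Y where Y: "Y \<in> P" "v = set_sum Y" using t by auto
      show "u v * v x = (if v = set_sum X then u v else 0)"
        using Y X x eq[of X Y x] app[of X x] app[of Y x] by (cases "x \<in> Y") auto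
    qed
    also have "\<dots> = u (set_sum X)" using t X by simp
    finally show "u w = 0" by (simp add: wX)
  qed
  then show ?thesis
    by (simp add: cfun.dim_eq_card_independent card_image[OF inj])
qed

end

theory Submission
  imports
    Defs
    "HOL-Combinatorics.Perm"
    "HOL-Computational_Algebra.Fundamental_Theorem_Algebra"
    "HOL-Computational_Algebra.Primes"
begin

text \<open>
  Let \<open>A\<close> be a commutative Schur ring over \<open>S\<^sub>6\<close>. It is a commutative subalgebra of the complex
  group algebra which is closed under the adjoint \<open>x \<mapsto> x\<^sup>*\<close>, so in every unitary representation it acts by
  commuting normal operators.

  The number 76 is the number of solutions of \<open>t * t = 1\<close> in \<open>S\<^sub>6\<close>. The permutations act on the
  space spanned by these solutions by conjugation with suitable signs, and the group algebra acts
  faithfully on this involution model (\<open>inv_space_faithful\<close>). Diagonalizing there shows that a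
  commuting star-closed family spans at most 76 dimensions (\<open>commuting_family_dependent\<close>). If \<open>A\<close>
  attains this bound, it is therefore maximal: each self-adjoint element that commutes with \<open>A\<close> lies in \<open>A\<close>,
  which means that it is constant on the blocks of the partition (\<open>block_const_of_commuting\<close>).

  Maximality produces many functions that are constant on the blocks. Let \<open>Eig\<close> be the set of common
  eigenvectors of \<open>A\<close> with coordinate sum zero in the natural representation on \<open>\<complex>\<^sup>6\<close>. The matrix
  coefficient of each \<open>v \<in> Eig\<close> commutes with \<open>A\<close>, so it is constant on the blocks. Pointwise products of
  such functions are again constant on the blocks, hence again in \<open>A\<close>; computing their action on
  \<open>\<complex>\<^sup>6\<close> shows that two members of \<open>Eig\<close> are orthogonal or proportional
  (\<open>Eig_orthogonal_or_parallel\<close>) and that the pointwise product of two members, shifted to coordinate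
  sum zero, is 0 or again a member (\<open>Eig_centered_product\<close>).

  These closure properties leave four possibilities. Up to scaling, \<open>Eig\<close> contains a
  vector whose values on a set \<open>N\<close> of 3, 4 or 5 points are roots of unity and which vanishes elsewhere, along with
  the shifted indicator of \<open>N\<close>; or it contains vectors on all six points with values in the square and in the cube
  roots of unity (\<open>nonflat_eigenvector\<close>, \<open>supported_on_part\<close>, \<open>flat_root_system\<close>, \<open>not_all_flat\<close>).

  In each case the matrix coefficients determine how many points a permutation moves in a prescribed
  way, for example the number of \<open>p\<close> with \<open>u (g p) = z * u p\<close>, so these numbers are constant on the
  blocks (\<open>same_block_ratio\<close>). On the other hand, commutativity of \<open>A\<close> allows every product \<open>x * y\<close> to be written as
  \<open>y' * x'\<close> with \<open>x'\<close> in the block of \<open>x\<close> and \<open>y'\<close> in the block of \<open>y\<close>. For suitable \<open>x\<close> and \<open>y\<close> no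
  \<open>x'\<close> and \<open>y'\<close> with the right numbers satisfy this equation, a contradiction.
\<close>

notation "apply" (infixl \<open>$\<close> 999)

section \<open>Commuting families of operators\<close>

definition ip :: "('i::finite \<Rightarrow> complex) \<Rightarrow> ('i \<Rightarrow> complex) \<Rightarrow> complex"
  where "ip u v = (\<Sum>i\<in>UNIV. cnj (u i) * v i)"

lemma ip_add_right: "ip u (v + w) = ip u v + ip u w"
  and ip_scale_right: "ip u (cscale c v) = c * ip u v"
  and ip_scale_left: "ip (cscale c v) u = cnj c * ip v u"
  and ip_diff_right: "ip u (v - w) = ip u v - ip u w"
  and ip_zero_right [simp]: "ip u 0 = 0"
  and ip_zero_left [simp]: "ip 0 u = 0"
  by (simp_all add: ip_def cscale_def algebra_simps sum.distrib sum_distrib_left sum_subtractf)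

lemma ip_sum_right: "ip u (\<Sum>k\<in>K. f k) = (\<Sum>k\<in>K. ip u (f k))"
  unfolding ip_def sum_fun_apply sum_distrib_left by (rule sum.swap)

lemma cnj_ip: "cnj (ip u v) = ip v u"
  by (simp add: ip_def mult.commute)

lemma ip_eq_0_commute: "ip u v = 0 \<longleftrightarrow> ip v u = 0"
  by (metis cnj_ip complex_cnj_zero)

lemma ip_self: "ip u u = of_real (\<Sum>i\<in>UNIV. (cmod (u i))\<^sup>2)"
proof -
  have "cnj (u i) * u i = of_real ((cmod (u i))\<^sup>2)" for i
    by (simp add: complex_norm_square mult.commute flip: of_real_power)
  then show ?thesis by (simp add: ip_def)
qed

lemma ip_self_eq_0 [simp]: "ip u u = 0 \<longleftrightarrow> u = 0"
proof -
  have "ip u u = 0 \<longleftrightarrow> (\<forall>i. (cmod (u i))\<^sup>2 = 0)"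
    unfolding ip_self of_real_eq_0_iff by (subst sum_nonneg_eq_0_iff) auto
  then show ?thesis by (auto simp: fun_eq_iff)
qed

lemma sum_cscale_apply: "(\<Sum>k\<in>K. cscale (c k) (f k)) i = (\<Sum>k\<in>K. c k * f k i)"
  by (simp add: sum_fun_apply cscale_def)

text \<open>The vectors are indexed by a set \<open>K\<close>, so that the count also applies when some of them
  coincide.\<close>

lemma exists_linear_relation:
  fixes f :: "'k \<Rightarrow> 'a \<Rightarrow> complex"
  assumes "finite K" "finite T" "card T < card K" "f ` K \<subseteq> cspan T"
  shows "\<exists>c. (\<exists>k\<in>K. c k \<noteq> 0) \<and> (\<Sum>k\<in>K. cscale (c k) (f k)) = 0"
proof (cases "inj_on f K")
  case False
  then obtain i j where ij: "i \<in> K" "j \<in> K" "i \<noteq> j" "f i = f j" by (auto simp: inj_on_def)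
  let ?c = "\<lambda>k. if k = i then 1 else if k = j then -1 else 0 :: complex"
  have "(\<Sum>k\<in>K. ?c k * f k x) = 0" for x
  proof -
    have "(\<Sum>k\<in>K. ?c k * f k x) = (\<Sum>k\<in>{i, j}. ?c k * f k x)"
      using assms(1) ij by (intro sum.mono_neutral_right) auto
    then show ?thesis using ij by simp
  qed
  then have "(\<Sum>k\<in>K. cscale (?c k) (f k)) = 0"
    by (simp add: fun_eq_iff sum_cscale_apply)
  moreover have "\<exists>k\<in>K. ?c k \<noteq> 0" using ij(1) by (intro bexI[of _ i]) auto
  ultimately show ?thesis by (intro exI[of _ ?c] conjI)
next
  case True
  have "\<not> cfun.independent (f ` K)"
    using cfun.independent_span_bound[OF assms(2) _ assms(4)] assms(3) card_image[OF True] by auto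
  then obtain u v where u: "v \<in> f ` K" "u v \<noteq> 0" "(\<Sum>v\<in>f ` K. cscale (u v) v) = 0"
    using cfun.dependent_finite[of "f ` K"] assms(1) by auto
  show ?thesis
    using u by (intro exI[of _ "u \<circ> f"]) (auto simp: sum.reindex[OF True] o_def)
qed

definition clinear_op :: "(('i \<Rightarrow> complex) \<Rightarrow> 'i \<Rightarrow> complex) \<Rightarrow> bool"
  where "clinear_op L \<longleftrightarrow> (\<forall>u v. L (u + v) = L u + L v) \<and> (\<forall>c u. L (cscale c u) = cscale c (L u))"

lemma clinear_opD:
  assumes "clinear_op L"
  shows "L (u + v) = L u + L v" "L (cscale c u) = cscale c (L u)" "L 0 = 0" "L (u - v) = L u - L v"
    "L (\<Sum>k\<in>K. f k) = (\<Sum>k\<in>K. L (f k))"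
proof -
  show *: "L (u + v) = L u + L v" and **: "L (cscale c u) = cscale c (L u)" for u v c
    using assms by (auto simp: clinear_op_def)
  show z: "L 0 = 0" using **[of 0 0] by (simp add: cscale_def fun_eq_iff zero_fun_def)
  show "L (u - v) = L u - L v" using *[of "u - v" v] by (simp add: algebra_simps)
  show "L (\<Sum>k\<in>K. f k) = (\<Sum>k\<in>K. L (f k))"
    by (induction K rule: infinite_finite_induct) (simp_all only: sum.infinite sum.empty sum.insert * z simp_thms)
qed

lemma span_basis_elem: "cspan (range (basis_elem :: 'i::finite \<Rightarrow> _)) = UNIV"
proof -
  have "u \<in> cspan (range (basis_elem :: 'i \<Rightarrow> _))" for u
  proof -
    have "u = (\<Sum>i\<in>UNIV. cscale (u i) (basis_elem i))"
      by (simp add: fun_eq_iff sum_cscale_apply basis_elem_def if_distrib cong: if_cong)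
    also have "\<dots> \<in> cspan (range basis_elem)"
      by (intro cfun.span_sum cfun.span_scale cfun.span_base) auto
    finally show ?thesis .
  qed
  then show ?thesis by blast
qed

text \<open>Write \<open>p = (X - r) * q\<close>. Either \<open>L u - r u = 0\<close>, and \<open>u\<close> is an eigenvector, or this vector is
  nonzero and annihilated by \<open>q (L)\<close>, where \<open>q\<close> has smaller degree.\<close>

lemma eigenvector_of_poly_relation:
  fixes p :: "complex poly"
  assumes L: "clinear_op L" and S: "cfun.subspace S" "\<And>u. u \<in> S \<Longrightarrow> L u \<in> S"
    and "p \<noteq> 0" "u \<in> S" "u \<noteq> 0" "(\<Sum>k\<le>degree p. cscale (coeff p k) ((L ^^ k) u)) = 0"
  shows "\<exists>v\<in>S. v \<noteq> 0 \<and> (\<exists>c. L v = cscale c v)"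
  using assms(4-)
proof (induction "degree p" arbitrary: p u)
  case 0
  then have "cscale (coeff p 0) u = 0" "coeff p 0 \<noteq> 0" by (auto simp: leading_coeff_0_iff)
       (metis leading_coeff_0_iff)
  then show ?case using \<open>u \<noteq> 0\<close> by (simp add: cscale_def fun_eq_iff)
next
  case (Suc n)
  then obtain r where "poly p r = 0"
    using fundamental_theorem_of_algebra[of p] by (auto simp: constant_degree)
  then obtain q where q: "p = [:-r, 1:] * q" by (auto simp: poly_eq_0_iff_dvd dvd_def)
  have q0: "q \<noteq> 0" using Suc.prems q by auto
  have dq: "degree p = Suc (degree q)"
    using q0 by (simp add: q del: mult_pCons_left) (subst degree_mult_eq, auto)
  define w where "w = L u - cscale r u"
  have wS: "w \<in> S" using S Suc.prems by (simp add: w_def cfun.subspace_diff cfun.subspace_scale)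
  have Lk: "clinear_op (L ^^ k)" for k
    by (induction k) (use L in \<open>auto simp: clinear_op_def\<close>)
  have cp: "coeff p k = (if k = 0 then 0 else coeff q (k - 1)) - r * coeff q k" for k
    by (simp add: q coeff_pCons split: nat.split)
  have "(\<Sum>k\<le>degree q. cscale (coeff q k) ((L ^^ k) w)) = (\<Sum>k\<le>degree p. cscale (coeff p k) ((L ^^ k) u))"
  proof
    fix i
    have "(\<Sum>k\<le>degree p. coeff p k * (L ^^ k) u i) =
       (\<Sum>k\<le>Suc (degree q). (if k = 0 then 0 else coeff q (k - 1)) * (L ^^ k) u i) -
       (\<Sum>k\<le>Suc (degree q). r * coeff q k * (L ^^ k) u i)"
      by (simp add: cp dq algebra_simps sum_subtractf)
    also have "(\<Sum>k\<le>Suc (degree q). (if k = 0 then 0 else coeff q (k - 1)) * (L ^^ k) u i) =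
       (\<Sum>k\<le>degree q. coeff q k * (L ^^ Suc k) u i)"
      by (subst sum.atMost_Suc_shift) simp
    also have "(\<Sum>k\<le>Suc (degree q). r * coeff q k * (L ^^ k) u i) = (\<Sum>k\<le>degree q. r * coeff q k * (L ^^ k) u i)"
      by (simp add: coeff_eq_0)
    also have "(\<Sum>k\<le>degree q. coeff q k * (L ^^ Suc k) u i) - (\<Sum>k\<le>degree q. r * coeff q k * (L ^^ k) u i)
       = (\<Sum>k\<le>degree q. coeff q k * (L ^^ k) w i)"
      unfolding sum_subtractf[symmetric] w_def
      by (intro sum.cong refl) (simp add: clinear_opD[OF Lk] funpow_swap1, simp add: cscale_def algebra_simps)
    finally show "(\<Sum>k\<le>degree q. cscale (coeff q k) ((L ^^ k) w)) i =
       (\<Sum>k\<le>degree p. cscale (coeff p k) ((L ^^ k) u)) i"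
      by (simp add: sum_cscale_apply)
  qed
  then have "(\<Sum>k\<le>degree q. cscale (coeff q k) ((L ^^ k) w)) = 0" using Suc.prems by simp
  show ?case
  proof (cases "w = 0")
    case True
    then show ?thesis using Suc.prems by (auto simp: w_def)
  next
    case False
    then show ?thesis
      using Suc.hyps(1)[OF _ q0 wS False] Suc.hyps(2) dq \<open>(\<Sum>k\<le>degree q. _) = 0\<close> by simp
  qed
qed

text \<open>The vectors \<open>u\<close>, \<open>L u\<close>, \<open>L (L u)\<close>, \<open>\<dots>\<close> are linearly dependent, which gives a polynomial
  relation to which \<open>eigenvector_of_poly_relation\<close> applies.\<close>

lemma exists_eigenvector:
  fixes L :: "('i::finite \<Rightarrow> complex) \<Rightarrow> 'i \<Rightarrow> complex"
  assumes L: "clinear_op L" and S: "cfun.subspace S" "\<And>u. u \<in> S \<Longrightarrow> L u \<in> S"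
    and u: "u \<in> S" "u \<noteq> 0"
  shows "\<exists>v\<in>S. v \<noteq> 0 \<and> (\<exists>c. L v = cscale c v)"
proof -
  let ?n = "card (UNIV :: 'i set)"
  have "card (range (basis_elem :: 'i \<Rightarrow> _)) \<le> ?n" by (rule card_image_le) simp
  then have "\<exists>c. (\<exists>k\<in>{..?n}. c k \<noteq> 0) \<and> (\<Sum>k\<le>?n. cscale (c k) ((L ^^ k) u)) = 0"
    by (intro exists_linear_relation[where T = "range basis_elem"]) (auto simp: span_basis_elem)
  then obtain c where c: "\<exists>k\<le>?n. c k \<noteq> 0" "(\<Sum>k\<le>?n. cscale (c k) ((L ^^ k) u)) = 0" by auto
  define p where "p = (\<Sum>k\<le>?n. monom (c k) k)"
  have cp: "coeff p k = (if k \<le> ?n then c k else 0)" for k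
    by (simp add: p_def coeff_sum)
  have p0: "p \<noteq> 0" using c(1) cp by (metis coeff_0)
  have "degree p \<le> ?n" by (rule degree_le) (simp add: cp)
  have "(\<Sum>k\<le>degree p. cscale (coeff p k) ((L ^^ k) u)) = (\<Sum>k\<le>?n. cscale (coeff p k) ((L ^^ k) u))"
    using \<open>degree p \<le> ?n\<close> by (intro sum.mono_neutral_left) (auto simp: coeff_eq_0 cscale_def fun_eq_iff)
  also have "\<dots> = 0" using c(2) by (simp add: cp)
  finally have "(\<Sum>k\<le>degree p. cscale (coeff p k) ((L ^^ k) u)) = 0" .
  then show ?thesis
    by (intro eigenvector_of_poly_relation[where p = p and u = u] L S p0 u)
qed

text \<open>An eigenspace of \<open>L\<close> is invariant under all operators that commute with \<open>L\<close>, so the operators can be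
  treated one after the other.\<close>

lemma exists_common_eigenvector:
  fixes F :: "(('i::finite \<Rightarrow> complex) \<Rightarrow> 'i \<Rightarrow> complex) set"
  assumes "finite F" "\<And>L. L \<in> F \<Longrightarrow> clinear_op L"
    and "\<And>L M u. L \<in> F \<Longrightarrow> M \<in> F \<Longrightarrow> L (M u) = M (L u)"
    and "cfun.subspace S" "\<And>L u. L \<in> F \<Longrightarrow> u \<in> S \<Longrightarrow> L u \<in> S" "u \<in> S" "u \<noteq> 0"
  shows "\<exists>v\<in>S. v \<noteq> 0 \<and> (\<forall>L\<in>F. \<exists>c. L v = cscale c v)"
  using assms
proof (induction arbitrary: S u rule: finite_induct)
  case empty
  then show ?case by blast
next
  case (insert L F)
  have L: "clinear_op L" by (rule insert.prems(1)) simp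
  have "\<exists>v\<in>S. v \<noteq> 0 \<and> (\<exists>c. L v = cscale c v)"
    by (rule exists_eigenvector[OF L insert.prems(3) _ insert.prems(5,6)]) (simp add: insert.prems(4))
  then obtain v c where v: "v \<in> S" "v \<noteq> 0" "L v = cscale c v" by blast
  define S' where "S' = {w \<in> S. L w = cscale c w}"
  have "\<exists>v\<in>S'. v \<noteq> 0 \<and> (\<forall>L\<in>F. \<exists>c. L v = cscale c v)"
  proof (rule insert.IH)
    show "cfun.subspace S'"
    proof (rule cfun.subspaceI)
      show "0 \<in> S'" by (simp add: S'_def cfun.subspace_0[OF insert.prems(3)] clinear_opD(3)[OF L])
      show "x + y \<in> S'" if "x \<in> S'" "y \<in> S'" for x y
        using that by (simp add: S'_def cfun.subspace_add[OF insert.prems(3)] clinear_opD(1)[OF L] cfun.scale_right_distrib)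
      show "cscale d x \<in> S'" if "x \<in> S'" for d x
        using that by (simp add: S'_def cfun.subspace_scale[OF insert.prems(3)] clinear_opD(2)[OF L])
    qed
    show "M w \<in> S'" if "M \<in> F" "w \<in> S'" for M w
    proof -
      have M: "M \<in> insert L F" "w \<in> S" "L w = cscale c w" using that by (simp_all add: S'_def)
      have "L (M w) = M (L w)" by (rule insert.prems(2)[OF insertI1 M(1)])
      also have "\<dots> = cscale c (M w)"
        unfolding M(3) by (rule clinear_opD(2)[OF insert.prems(1)[OF M(1)]])
      finally show ?thesis using insert.prems(4)[OF M(1,2)] by (simp add: S'_def)
    qed
    show "v \<in> S'" using v by (simp add: S'_def)
    show "v \<noteq> 0" by (fact v(2))
    show "clinear_op M" if "M \<in> F" for M by (rule insert.prems(1)) (simp add: that)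
    show "M (N w) = N (M w)" if "M \<in> F" "N \<in> F" for M N w
      by (rule insert.prems(2)) (simp_all add: that)
  qed
  then obtain w where w: "w \<in> S'" "w \<noteq> 0" "\<forall>M\<in>F. \<exists>c. M w = cscale c w" by (elim bexE conjE)
  have "w \<in> S" "L w = cscale c w" using w(1) by (simp_all add: S'_def)
  with w(2,3) show ?case by (intro bexI[of _ w] conjI) auto
qed

lemma orthogonal_independent:
  fixes B :: "('i::finite \<Rightarrow> complex) set"
  assumes "0 \<notin> B" "\<And>u v. u \<in> B \<Longrightarrow> v \<in> B \<Longrightarrow> u \<noteq> v \<Longrightarrow> ip u v = 0"
  shows "cfun.independent B"
  unfolding cfun.independent_explicit_module
proof (intro allI impI)
  fix t u w
  assume t: "finite t" "t \<subseteq> B" "(\<Sum>v\<in>t. cscale (u v) v) = 0" "w \<in> t"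
  have "0 = ip w (\<Sum>v\<in>t. cscale (u v) v)" using t by simp
  also have "\<dots> = (\<Sum>v\<in>t. if v = w then u w * ip w w else 0)"
    unfolding ip_sum_right by (intro sum.cong refl) (use assms(2) t in \<open>auto simp: ip_scale_right\<close>)
  also have "\<dots> = u w * ip w w" using t by simp
  finally show "u w = 0" using t assms(1) by auto
qed

text \<open>A largest orthogonal set of common eigenvectors spans \<open>S\<close>: its orthogonal complement in \<open>S\<close> is
  invariant because the family is closed under adjoints, and a common eigenvector in the complement could be
  added to the set.\<close>

theorem simultaneous_diagonalization:
  fixes F :: "(('i::finite \<Rightarrow> complex) \<Rightarrow> 'i \<Rightarrow> complex) set"
  assumes fin: "finite F" and lin: "\<And>L. L \<in> F \<Longrightarrow> clinear_op L"
    and comm: "\<And>L M u. L \<in> F \<Longrightarrow> M \<in> F \<Longrightarrow> L (M u) = M (L u)"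
    and adj: "\<And>L. L \<in> F \<Longrightarrow> \<exists>M\<in>F. \<forall>u v. ip (L u) v = ip u (M v)"
    and S: "cfun.subspace S" and inv: "\<And>L u. L \<in> F \<Longrightarrow> u \<in> S \<Longrightarrow> L u \<in> S"
  shows "\<exists>B. finite B \<and> B \<subseteq> S \<and> cfun.independent B \<and> S \<subseteq> cspan B \<and>
    (\<forall>b\<in>B. \<forall>L\<in>F. \<exists>c. L b = cscale c b)"
proof -
  define good where "good B \<longleftrightarrow> B \<subseteq> S \<and> 0 \<notin> B \<and> (\<forall>u\<in>B. \<forall>v\<in>B. u \<noteq> v \<longrightarrow> ip u v = 0) \<and>
    (\<forall>b\<in>B. \<forall>L\<in>F. \<exists>c. L b = cscale c b)" for B
  have eig: "\<exists>c. L b = cscale c b" if "good B" "b \<in> B" "L \<in> F" for B b L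
  proof -
    have "\<forall>b\<in>B. \<forall>L\<in>F. \<exists>c. L b = cscale c b" using that(1) unfolding good_def by (elim conjE)
    from bspec[OF bspec[OF this that(2)] that(3)] show ?thesis .
  qed
  have ind: "cfun.independent B" if "good B" for B
    using that by (intro orthogonal_independent) (auto simp: good_def)
  have bound: "finite B \<and> card B \<le> card (UNIV :: 'i set)" if "good B" for B
  proof -
    have "finite B \<and> card B \<le> card (range (basis_elem :: 'i \<Rightarrow> _))"
      by (rule cfun.independent_span_bound) (use ind[OF that] in \<open>auto simp: span_basis_elem\<close>)
    then show ?thesis using card_image_le[of "UNIV :: 'i set" basis_elem] by auto
  qed
  have "good {}" by (simp add: good_def)
  then have "\<exists>B. good B \<and> (\<forall>C. good C \<longrightarrow> card C \<le> card B)"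
    by (rule ex_has_greatest_nat[where b = "Suc (card (UNIV :: 'i set))"]) (use bound in \<open>simp add: less_Suc_eq_le\<close>)
  then obtain B where B: "good B" "\<And>C. good C \<Longrightarrow> card C \<le> card B" by blast
  have "S \<subseteq> cspan B"
  proof
    fix u assume u: "u \<in> S"
    define w where "w = u - (\<Sum>b\<in>B. cscale (ip b u / ip b b) b)"
    have BS: "B \<subseteq> S" and finB: "finite B" using B(1) bound by (auto simp: good_def)
    have wS: "w \<in> S" unfolding w_def using u BS S
      by (intro cfun.subspace_diff cfun.subspace_sum cfun.subspace_scale) auto
    define S' where "S' = {v \<in> S. \<forall>b\<in>B. ip b v = 0}"
    have "ip b w = 0" if "b \<in> B" for b
    proof -
      have "(\<Sum>b'\<in>B. ip b (cscale (ip b' u / ip b' b') b')) = (\<Sum>b'\<in>B. if b' = b then ip b u else 0)"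
        using B(1) that by (intro sum.cong refl) (auto simp: good_def ip_scale_right)
      then show ?thesis using that finB by (simp add: w_def ip_diff_right ip_sum_right)
    qed
    then have wS': "w \<in> S'" using wS by (simp add: S'_def)
    have "w = 0"
    proof (rule ccontr)
      assume "w \<noteq> 0"
      have "\<exists>v\<in>S'. v \<noteq> 0 \<and> (\<forall>L\<in>F. \<exists>c. L v = cscale c v)"
      proof (rule exists_common_eigenvector[where F = F and S = S' and u = w])
        show "cfun.subspace S'"
          using S by (auto simp: S'_def cfun.subspace_def ip_add_right ip_scale_right)
        fix L v assume L: "L \<in> F" and v: "v \<in> S'"
        obtain M where M: "M \<in> F" "\<And>u v. ip (L u) v = ip u (M v)" using adj[OF L] by blast
        have "ip b (L v) = 0" if b: "b \<in> B" for b
        proof -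
          obtain c where c: "M b = cscale c b" using eig[OF B(1) b M(1)] by (rule exE)
          have "ip b (L v) = cnj (ip (L v) b)" by (simp add: cnj_ip)
          also have "\<dots> = cnj (c * ip v b)" by (simp add: M(2) c ip_scale_right)
          also have "\<dots> = 0" using v b by (simp add: S'_def ip_eq_0_commute[of v])
          finally show ?thesis .
        qed
        then show "L v \<in> S'" using v inv[OF L] by (simp add: S'_def)
      qed (use fin lin comm wS' \<open>w \<noteq> 0\<close> in simp_all)
      then obtain v where v: "v \<in> S'" "v \<noteq> 0" "\<forall>L\<in>F. \<exists>c. L v = cscale c v" by blast
      have "v \<notin> B" using v by (auto simp: S'_def)
      moreover have "good (insert v B)"
        using B(1) v by (auto simp: good_def S'_def ip_eq_0_commute[of v])
      ultimately show False using B(2)[of "insert v B"] finB by simp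
    qed
    then have "u = (\<Sum>b\<in>B. cscale (ip b u / ip b b) b)" by (simp add: w_def)
    also have "\<dots> \<in> cspan B" by (intro cfun.span_sum cfun.span_scale cfun.span_base)
    finally show "u \<in> cspan B" .
  qed
  then show ?thesis using B(1) bound[OF B(1)] ind[OF B(1)] eig[OF B(1)]
    by (intro exI[of _ B]) (auto simp: good_def)
qed

section \<open>Group algebras of permutation groups and signed actions\<close>

instance perm :: (finite) finite
proof
  have "inj (apply :: 'a perm \<Rightarrow> 'a \<Rightarrow> 'a)" by (auto simp: inj_def perm_eq_iff)
  then show "finite (UNIV :: 'a perm set)" by (rule finite_imageD[rotated]) simp
qed

lemma perm_mult_inverse [simp]:
  fixes g h :: "'a perm"
  shows "g * (inverse g * h) = h" "inverse g * (g * h) = h"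
  by (simp_all flip: mult.assoc)

lemma sum_perm_mult_left: "(\<Sum>g\<in>UNIV. f (h * g)) = (\<Sum>g\<in>UNIV. f g)" for h :: "'a::finite perm"
  by (rule sum.reindex_bij_witness[where i = "\<lambda>g. inverse h * g" and j = "\<lambda>g. h * g"]) auto

lemma sum_perm_mult_right: "(\<Sum>g\<in>UNIV. f (g * h)) = (\<Sum>g\<in>UNIV. f g)" for h :: "'a::finite perm"
  by (rule sum.reindex_bij_witness[where i = "\<lambda>g. g * inverse h" and j = "\<lambda>g. g * h"])
     (auto simp: mult.assoc)

lemma sum_perm_inverse: "(\<Sum>g\<in>UNIV. f (inverse g)) = (\<Sum>g\<in>(UNIV :: 'a::finite perm set). f g)"
  by (rule sum.reindex_bij_witness[where i = inverse and j = inverse]) auto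

definition conv :: "('a::finite perm \<Rightarrow> complex) \<Rightarrow> ('a perm \<Rightarrow> complex) \<Rightarrow> 'a perm \<Rightarrow> complex"
  where "conv x y g = (\<Sum>h\<in>UNIV. x h * y (inverse h * g))"

definition star :: "('a perm \<Rightarrow> complex) \<Rightarrow> 'a perm \<Rightarrow> complex"
  where "star x g = cnj (x (inverse g))"

lemma conv_alt: "conv x y g = (\<Sum>h\<in>UNIV. x (g * inverse h) * y h)"
proof -
  have "conv x y g = (\<Sum>h\<in>UNIV. x (g * h) * y (inverse h))"
    unfolding conv_def by (subst sum_perm_mult_left[where h = g, symmetric]) (simp add: mult.assoc)
  also have "\<dots> = (\<Sum>h\<in>UNIV. x (g * inverse h) * y h)"
    by (subst sum_perm_inverse[symmetric]) simp
  finally show ?thesis .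
qed

text \<open>A signed action is a monomial representation with signs as entries: \<open>g\<close> sends the basis vector with index \<open>i\<close>
  to \<open>sg g i\<close> times the one with index \<open>act g i\<close>. Both the natural representation of \<open>S\<^sub>6\<close> and the
  involution model have this form.\<close>

locale signed_action =
  fixes act :: "'a::finite perm \<Rightarrow> 'i::finite \<Rightarrow> 'i" and sg :: "'a perm \<Rightarrow> 'i \<Rightarrow> complex"
  assumes act_1: "act 1 i = i" and act_mult: "act (g * h) i = act g (act h i)"
    and sg_mult: "sg (g * h) i = sg g (act h i) * sg h i"
    and sg_cases: "sg g i = 1 \<or> sg g i = -1"
begin

definition rho :: "'a perm \<Rightarrow> ('i \<Rightarrow> complex) \<Rightarrow> 'i \<Rightarrow> complex"
  where "rho g u = (\<lambda>i. sg g (act (inverse g) i) * u (act (inverse g) i))"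

definition alg :: "('a perm \<Rightarrow> complex) \<Rightarrow> ('i \<Rightarrow> complex) \<Rightarrow> 'i \<Rightarrow> complex"
  where "alg x u = (\<Sum>g\<in>UNIV. cscale (x g) (rho g u))"

lemma act_inverse [simp]: "act g (act (inverse g) i) = i" "act (inverse g) (act g i) = i"
  by (simp_all add: act_1 flip: act_mult)

lemma sg_1: "sg 1 i = 1"
  using sg_mult[of 1 1 i] sg_cases[of 1 i] by (auto simp: act_1)

lemma cnj_sg [simp]: "cnj (sg g i) = sg g i"
  using sg_cases[of g i] by auto

lemma sg_inverse: "sg (inverse g) (act g i) = sg g i"
proof -
  have "sg (inverse g) (act g i) * sg g i = 1"
    using sg_mult[of "inverse g" g i] by (simp add: sg_1)
  then show ?thesis using sg_cases[of g i] sg_cases[of "inverse g" "act g i"] by auto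
qed

lemma clinear_rho: "clinear_op (rho g)"
  by (auto simp: clinear_op_def rho_def fun_eq_iff cscale_def algebra_simps)

lemma clinear_alg: "clinear_op (alg x)"
  unfolding clinear_op_def alg_def
  by (simp add: clinear_opD[OF clinear_rho] cfun.scale_right_distrib sum.distrib cfun.scale_sum_right mult.commute)

lemma rho_mult: "rho (g * h) u = rho g (rho h u)"
  by (simp add: rho_def fun_eq_iff act_mult sg_mult mult.assoc)

lemma ip_rho: "ip (rho g u) v = ip u (rho (inverse g) v)"
proof -
  have "ip (rho g u) v = (\<Sum>i\<in>UNIV. sg g i * cnj (u i) * v (act g i))"
    unfolding ip_def rho_def
    by (rule sum.reindex_bij_witness[where i = "act g" and j = "act (inverse g)"]) auto
  then show ?thesis by (simp add: ip_def rho_def sg_inverse mult_ac)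
qed

lemma alg_add: "alg (x + y) u = alg x u + alg y u"
  by (simp add: alg_def cfun.scale_left_distrib sum.distrib)

lemma alg_scale: "alg (cscale c x) u = cscale c (alg x u)"
  by (simp add: alg_def cscale_def[of c x] cfun.scale_sum_right)

lemma alg_zero: "alg 0 u = 0"
  by (simp add: alg_def)

lemma alg_sum: "alg (\<Sum>k\<in>K. f k) u = (\<Sum>k\<in>K. alg (f k) u)"
  by (induction K rule: infinite_finite_induct) (simp_all only: sum.infinite sum.empty sum.insert alg_zero alg_add simp_thms)

lemma alg_conv: "alg (conv x y) u = alg x (alg y u)"
proof
  fix i
  have "alg x (alg y u) i = (\<Sum>h\<in>UNIV. \<Sum>k\<in>UNIV. x h * (y k * rho (h * k) u i))"
    by (simp add: alg_def clinear_opD[OF clinear_rho] sum_cscale_apply rho_mult)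
       (simp add: sum_fun_apply cscale_def sum_distrib_left)
  also have "\<dots> = (\<Sum>h\<in>UNIV. \<Sum>g\<in>UNIV. x h * (y (inverse h * g) * rho g u i))"
  proof (rule sum.cong[OF refl])
    fix h
    show "(\<Sum>k\<in>UNIV. x h * (y k * rho (h * k) u i)) = (\<Sum>g\<in>UNIV. x h * (y (inverse h * g) * rho g u i))"
      by (subst sum_perm_mult_left[of _ h, symmetric]) simp
  qed
  also have "\<dots> = (\<Sum>g\<in>UNIV. \<Sum>h\<in>UNIV. x h * (y (inverse h * g) * rho g u i))"
    by (rule sum.swap)
  also have "\<dots> = alg (conv x y) u i"
    by (simp add: alg_def sum_cscale_apply conv_def sum_distrib_right mult.assoc)
  finally show "alg (conv x y) u i = alg x (alg y u) i" by simp
qed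

lemma ip_sum_left: "ip (\<Sum>k\<in>K. f k) v = (\<Sum>k\<in>K. ip (f k) v)"
  by (metis (mono_tags, lifting) cnj_ip cnj_sum ip_sum_right sum.cong)

lemma ip_alg: "ip (alg x u) v = ip u (alg (star x) v)"
proof -
  have "ip (alg x u) v = (\<Sum>g\<in>UNIV. cnj (x g) * ip u (rho (inverse g) v))"
    by (simp add: alg_def ip_sum_left ip_scale_left ip_rho)
  also have "\<dots> = (\<Sum>g\<in>UNIV. cnj (x (inverse g)) * ip u (rho g v))"
    by (subst sum_perm_inverse[symmetric]) simp
  finally show ?thesis by (simp add: alg_def star_def ip_sum_right ip_scale_right)
qed

text \<open>In a basis of common eigenvectors of \<open>S\<close>, with at most \<open>card T\<close> elements, each \<open>x \<in> F\<close> is described by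
  its eigenvalues. More than \<open>card T\<close> such eigenvalue vectors are dependent, and faithfulness turns the
  dependency between the operators into one between the elements of \<open>F\<close>.\<close>

theorem commuting_family_dependent:
  fixes F :: "('a perm \<Rightarrow> complex) set"
  assumes S: "cfun.subspace S" "\<And>g u. u \<in> S \<Longrightarrow> rho g u \<in> S" "finite T" "S \<subseteq> cspan T"
    and faithful: "\<And>x. (\<And>u. u \<in> S \<Longrightarrow> alg x u = 0) \<Longrightarrow> x = 0"
    and F: "finite F" "card T < card F" "\<And>x y. x \<in> F \<Longrightarrow> y \<in> F \<Longrightarrow> conv x y = conv y x"
      "\<And>x. x \<in> F \<Longrightarrow> star x \<in> F"
  shows "\<exists>c. (\<exists>x\<in>F. c x \<noteq> 0) \<and> (\<Sum>x\<in>F. cscale (c x) x) = 0"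
proof -
  have "\<exists>B. finite B \<and> B \<subseteq> S \<and> cfun.independent B \<and> S \<subseteq> cspan B \<and>
    (\<forall>b\<in>B. \<forall>L\<in>alg ` F. \<exists>c. L b = cscale c b)"
  proof (rule simultaneous_diagonalization)
    show "clinear_op L" if "L \<in> alg ` F" for L using that clinear_alg by auto
    show "L (M u) = M (L u)" if "L \<in> alg ` F" "M \<in> alg ` F" for L M u
      using that F(3) by (auto simp flip: alg_conv)
    show "\<exists>M\<in>alg ` F. \<forall>u v. ip (L u) v = ip u (M v)" if "L \<in> alg ` F" for L
      using that F(4) ip_alg by blast
    show "L u \<in> S" if "L \<in> alg ` F" "u \<in> S" for L u
      using that S(1,2) by (auto simp: alg_def intro!: cfun.subspace_sum cfun.subspace_scale)
  qed (use F S in auto)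
  then obtain B where B: "finite B" "B \<subseteq> S" "cfun.independent B" "S \<subseteq> cspan B"
    and eig: "\<forall>b\<in>B. \<forall>L\<in>alg ` F. \<exists>c. L b = cscale c b" by (elim exE conjE)
  have "card B \<le> card T"
    using cfun.independent_span_bound[OF S(3) B(3)] B(2) S(4) by auto
  have "\<exists>l. \<forall>x\<in>F. \<forall>b\<in>B. alg x b = cscale (l x b) b"
  proof -
    have "\<forall>x\<in>F. \<forall>b\<in>B. \<exists>c. alg x b = cscale c b" using eig by auto
    then show ?thesis by metis
  qed
  then obtain l where l: "\<And>x b. x \<in> F \<Longrightarrow> b \<in> B \<Longrightarrow> alg x b = cscale (l x b) b" by auto
  have "\<exists>c. (\<exists>x\<in>F. c x \<noteq> 0) \<and> (\<Sum>x\<in>F. cscale (c x) (\<Sum>b\<in>B. cscale (l x b) b)) = 0"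
  proof (rule exists_linear_relation)
    show "(\<lambda>x. \<Sum>b\<in>B. cscale (l x b) b) ` F \<subseteq> cspan B"
      by (intro image_subsetI cfun.span_sum cfun.span_scale cfun.span_base)
  qed (use \<open>card B \<le> card T\<close> F B in auto)
  then obtain c where c: "\<exists>x\<in>F. c x \<noteq> 0" "(\<Sum>x\<in>F. cscale (c x) (\<Sum>b\<in>B. cscale (l x b) b)) = 0" by blast
  have "(\<Sum>x\<in>F. cscale (c x) (\<Sum>b\<in>B. cscale (l x b) b)) = (\<Sum>b\<in>B. cscale (\<Sum>x\<in>F. c x * l x b) b)"
    by (simp add: cfun.scale_sum_right cfun.scale_sum_left sum.swap[of _ F])
  then have coef0: "(\<Sum>x\<in>F. c x * l x b) = 0" if "b \<in> B" for b
    using cfun.independentD[OF B(3,1) subset_refl, of "\<lambda>b. \<Sum>x\<in>F. c x * l x b" b] c(2) that by simp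
  have zero: "alg (\<Sum>x\<in>F. cscale (c x) x) b = 0" if "b \<in> B" for b
  proof -
    have "alg (\<Sum>x\<in>F. cscale (c x) x) b = (\<Sum>x\<in>F. cscale (c x * l x b) b)"
      unfolding alg_sum by (intro sum.cong refl) (simp add: alg_scale l that)
    also have "\<dots> = 0" using coef0[OF that] by (simp flip: cfun.scale_sum_left)
    finally show ?thesis .
  qed
  have "(\<Sum>x\<in>F. cscale (c x) x) = 0"
  proof (rule faithful)
    fix u assume "u \<in> S"
    then have "u \<in> cspan B" using B(4) by auto
    then show "alg (\<Sum>x\<in>F. cscale (c x) x) u = 0"
    proof (induction rule: cfun.span_induct_alt)
      case base
      then show ?case by (rule clinear_opD(3)[OF clinear_alg])
    next
      case (step a b w)
      then show ?case using zero[of b] by (simp only: clinear_opD[OF clinear_alg] cfun.scale_zero_right add_0)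
    qed
  qed
  with c(1) show ?thesis by (intro exI[of _ c] conjI)
qed

end

section \<open>Six points and their permutations\<close>

datatype pt = P1 | P2 | P3 | P4 | P5 | P6

definition pts :: "pt list"
  where "pts = [P1, P2, P3, P4, P5, P6]"

lemma UNIV_pt: "UNIV = {P1, P2, P3, P4, P5, P6}"
  using pt.exhaust by auto

lemma set_pts: "set pts = UNIV"
  by (simp add: pts_def UNIV_pt)

instance pt :: finite
  by standard (simp add: UNIV_pt)

lemma card_pt: "card (UNIV :: pt set) = 6"
  by (simp add: UNIV_pt)

lemma all_pt: "(\<forall>p. Q p) \<longleftrightarrow> Q P1 \<and> Q P2 \<and> Q P3 \<and> Q P4 \<and> Q P5 \<and> Q P6"
  by (metis pt.exhaust)

text \<open>The order of the points is given by lists of larger points, so that comparisons are decided by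
  rewriting.\<close>

primrec after :: "pt \<Rightarrow> pt list" where
  "after P1 = [P2, P3, P4, P5, P6]"
| "after P2 = [P3, P4, P5, P6]"
| "after P3 = [P4, P5, P6]"
| "after P4 = [P5, P6]"
| "after P5 = [P6]"
| "after P6 = []"

definition before :: "pt \<Rightarrow> pt \<Rightarrow> bool"
  where "before p q \<longleftrightarrow> List.member (after p) q"

lemma before_cases: "p = q \<or> before p q \<or> before q p"
  by (cases p; cases q) (simp_all add: before_def)

lemma before_asym: "before p q \<Longrightarrow> \<not> before q p"
  by (cases p; cases q) (simp_all add: before_def)

lemma before_irrefl [simp]: "\<not> before p p"
  by (cases p) (simp_all add: before_def)

lemma before_swap: "p \<noteq> q \<Longrightarrow> before q p \<longleftrightarrow> \<not> before p q"
  using before_cases before_asym by blast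

text \<open>Tables of values represent permutations in finite computations.\<close>

datatype table = Tab pt pt pt pt pt pt

primrec look :: "table \<Rightarrow> pt \<Rightarrow> pt" where
  "look (Tab a b c d e f) = (\<lambda>p. case p of P1 \<Rightarrow> a | P2 \<Rightarrow> b | P3 \<Rightarrow> c | P4 \<Rightarrow> d | P5 \<Rightarrow> e | P6 \<Rightarrow> f)"

definition tab :: "pt perm \<Rightarrow> table"
  where "tab g = Tab (g $ P1) (g $ P2) (g $ P3) (g $ P4) (g $ P5) (g $ P6)"

lemma look_tab [simp]: "look (tab g) p = g $ p"
  by (cases p) (simp_all add: tab_def)

lemma table_eqI: "(\<And>p. look s p = look t p) \<Longrightarrow> s = t"
proof -
  assume "\<And>p. look s p = look t p"
  from this[of P1] this[of P2] this[of P3] this[of P4] this[of P5] this[of P6]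
  show ?thesis by (cases s; cases t) simp
qed

lemma tab_inject: "tab g = tab h \<longleftrightarrow> g = h"
  by (metis look_tab perm_eqI)

lemma inj_tab: "inj tab"
  by (simp add: inj_def tab_inject)

lemma exists_perm_of_table:
  assumes "distinct [a, b, c, d, e, f]"
  shows "\<exists>g. tab g = Tab a b c d e f"
proof -
  from assms have "inj (look (Tab a b c d e f))"
    unfolding inj_def by (auto split: pt.splits simp: all_pt)
  then have "bij (look (Tab a b c d e f))"
    by (simp add: bij_def finite_UNIV_inj_surj)
  then have "apply (Perm.Perm (look (Tab a b c d e f))) = look (Tab a b c d e f)"
    by (subst Perm.Perm_inverse) auto
  then have "tab (Perm.Perm (look (Tab a b c d e f))) = Tab a b c d e f"
    by (intro table_eqI) simp
  then show ?thesis by blast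
qed

definition without :: "pt list \<Rightarrow> pt list"
  where "without xs = filter (\<lambda>p. \<not> List.member xs p) pts"

definition tabs :: "table list" where
  "tabs = [Tab a b c d e f. a \<leftarrow> pts, b \<leftarrow> without [a], c \<leftarrow> without [a, b],
    d \<leftarrow> without [a, b, c], e \<leftarrow> without [a, b, c, d], f \<leftarrow> without [a, b, c, d, e]]"

lemma length_tabs: "length tabs = 720"
  by code_simp

lemma set_without: "set (without xs) = - set xs"
  by (auto simp: without_def set_pts)

lemma tab_in_tabs: "tab g \<in> set tabs"
proof -
  have "\<exists>a. \<exists>b\<in>- {a}. \<exists>c\<in>- {a, b}. \<exists>d\<in>- {a, b, c}. \<exists>e\<in>- {a, b, c, d}. tab g \<in> Tab a b c d e ` (- {a, b, c, d, e})"
    by (intro exI[of _ "g $ P1"] bexI[of _ "g $ P2"] bexI[of _ "g $ P3"] bexI[of _ "g $ P4"]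
        bexI[of _ "g $ P5"] image_eqI[of _ _ "g $ P6"]) (simp_all add: tab_def apply_inj)
  then show ?thesis by (simp add: tabs_def set_without set_pts)
qed

lemma card_perm_pt: "card (UNIV :: pt perm set) = 720"
proof -
  have "bij_betw (apply :: pt perm \<Rightarrow> _) UNIV {p. p permutes UNIV}"
  proof (rule bij_betwI[where g = Perm.Perm])
    show "apply \<in> (UNIV :: pt perm set) \<rightarrow> {p. p permutes UNIV}"
      by (auto intro!: bij_imp_permutes simp flip: bij_betw_def)
    show "apply (Perm.Perm p) = p" if "p \<in> {p. p permutes UNIV}" for p :: "pt \<Rightarrow> pt"
      using that by (subst Perm.Perm_inverse) (auto simp: permutes_bij)
    show "Perm.Perm (apply g) = g" for g :: "pt perm"
      by (rule perm_eqI) (subst Perm.Perm_inverse, auto)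
  qed auto
  then have "card (UNIV :: pt perm set) = card {p :: pt \<Rightarrow> pt. p permutes UNIV}"
    by (rule bij_betw_same_card)
  then show ?thesis
    by (simp add: card_permutations[of UNIV 6] card_pt fact_numeral)
qed

text \<open>The list has 720 entries and contains the tables of all 720 permutations.\<close>

lemma set_tabs: "set tabs = range tab" and distinct_tabs: "distinct tabs"
proof -
  have c: "card (range tab) = 720" by (simp add: card_image[OF inj_tab] card_perm_pt)
  have sub: "range tab \<subseteq> set tabs" using tab_in_tabs by auto
  then have "720 \<le> card (set tabs)" using card_mono[of "set tabs" "range tab"] c by simp
  then have d: "card (set tabs) = 720" using card_length[of tabs] length_tabs by simp
  then show "distinct tabs" by (intro card_distinct) (simp add: length_tabs)
  show "set tabs = range tab" using card_subset_eq[OF _ sub] c d by simp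
qed

lemma sum_perm_tabs: "(\<Sum>g\<in>UNIV. f (tab g)) = sum_list (map f tabs)"
  by (simp add: sum_list_distinct_conv_sum_set[OF distinct_tabs] set_tabs sum.reindex[OF inj_tab] o_def)

section \<open>The involution model\<close>

text \<open>Does \<open>g\<close> preserve the order of \<open>p\<close> and \<open>q\<close>? The answer depends only on the set of the two points
  (\<open>order_sign_commute\<close>).\<close>

definition order_sign :: "pt perm \<Rightarrow> pt \<Rightarrow> pt \<Rightarrow> complex"
  where "order_sign g p q = (if before p q \<longleftrightarrow> before (g $ p) (g $ q) then 1 else -1)"

text \<open>The sign counts the 2-cycles of \<open>t\<close> whose two points change their order under \<open>g\<close>; each 2-cycle is
  represented by its smaller point. With these signs the conjugation action on the involutions is
  a Gelfand model of the symmetric group: each irreducible character occurs exactly once in it. The value 1 for other \<open>t\<close> is a default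
  under which the laws of a signed action hold for all \<open>t\<close>.\<close>

definition inv_sign :: "pt perm \<Rightarrow> pt perm \<Rightarrow> complex"
  where "inv_sign g t = (if t * t = 1 then \<Prod>p | before p (t $ p). order_sign g p (t $ p) else 1)"

lemma order_sign_commute: "p \<noteq> q \<Longrightarrow> order_sign g q p = order_sign g p q"
  using before_swap[of p q] before_swap[of "g $ p" "g $ q"]
  by (auto simp: order_sign_def apply_inj)

lemma order_sign_mult: "order_sign (g * h) p q = order_sign g (h $ p) (h $ q) * order_sign h p q"
  by (auto simp: order_sign_def apply_times)

lemma conj_involution: "(g * t * inverse g) * (g * t * inverse g) = 1 \<longleftrightarrow> t * t = (1 :: 'a perm)"
proof -
  have "(g * t * inverse g) * (g * t * inverse g) = g * (t * t) * inverse g"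
    by (simp add: mult.assoc)
  moreover have "g * s * inverse g = 1 \<longleftrightarrow> s = 1" for s :: "'a perm"
    by (metis mult.assoc mult.right_neutral perm.left_inverse perm.right_inverse perm_mult_inverse(2))
  ultimately show ?thesis by simp
qed

interpretation inv: signed_action "\<lambda>g t. g * t * inverse g" inv_sign
proof
  fix g h t :: "pt perm"
  show "1 * t * inverse 1 = t" by simp
  show "(g * h) * t * inverse (g * h) = g * (h * t * inverse h) * inverse g"
    by (simp add: mult.assoc)
  have "(\<forall>p\<in>A. f p = 1 \<or> f p = -1) \<Longrightarrow> prod f A = 1 \<or> prod f A = -1" if "finite A"
    for f :: "pt \<Rightarrow> complex" and A
    using that by (induction A rule: finite_induct) auto
  then show "inv_sign g t = 1 \<or> inv_sign g t = -1"
    by (simp add: inv_sign_def order_sign_def)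
  show "inv_sign (g * h) t = inv_sign g (h * t * inverse h) * inv_sign h t"
  proof (cases "t * t = 1")
    case False
    then show ?thesis by (simp only: inv_sign_def conj_involution if_False mult_1)
  next
    case True
    define s where "s = h * t * inverse h"
    have s: "s * s = 1" unfolding s_def conj_involution by (rule True)
    have tt: "t $ (t $ p) = p" for p by (simp only: apply_sequence True apply_one id_apply)
    have hi: "h $ (inverse h $ p) = p" "inverse h $ (h $ p) = p" for p
      by (simp_all only: apply_sequence perm.left_inverse perm.right_inverse apply_one id_apply)
    have hs: "s $ (h $ p) = h $ (t $ p)" for p by (simp only: s_def apply_times o_apply hi)
    have ss: "s $ (s $ p) = p" for p by (simp only: apply_sequence s apply_one id_apply)
    have sh: "inverse h $ (s $ p) = t $ (inverse h $ p)" for p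
      by (metis hi hs)
    \<comment> \<open>The permutation \<open>h\<close> carries the 2-cycles of \<open>t\<close> to those of \<open>s\<close>, but the image of the smaller point of a
      2-cycle may be the larger point of the image.\<close>
    have "(\<Prod>p | before p (t $ p). order_sign g (h $ p) (h $ (t $ p))) =
       (\<Prod>q | before q (s $ q). order_sign g q (s $ q))"
    proof (rule prod.reindex_bij_witness
        [where j = "\<lambda>p. if before (h $ p) (h $ (t $ p)) then h $ p else h $ (t $ p)"
           and i = "\<lambda>q. let p = inverse h $ q in if before p (t $ p) then p else t $ p"])
      fix p assume "p \<in> {p. before p (t $ p)}"
      then have p: "before p (t $ p)" "\<not> before (t $ p) p" "t $ p \<noteq> p"
        using before_asym[of p "t $ p"] by auto
      let ?q = "if before (h $ p) (h $ (t $ p)) then h $ p else h $ (t $ p)"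
      show "(let p = inverse h $ ?q in if before p (t $ p) then p else t $ p) = p"
        using p by (simp add: hi tt)
      show "?q \<in> {q. before q (s $ q)}"
        using p before_swap[of "h $ p" "h $ (t $ p)"] by (auto simp: hs tt apply_inj)
      show "order_sign g ?q (s $ ?q) = order_sign g (h $ p) (h $ (t $ p))"
        using p(3) by (auto simp: hs tt apply_inj intro!: order_sign_commute)
    next
      fix q assume "q \<in> {q. before q (s $ q)}"
      then have q: "before q (s $ q)" "\<not> before (s $ q) q" "s $ q \<noteq> q"
        using before_asym[of q "s $ q"] by auto
      let ?r = "inverse h $ q"
      have r: "h $ ?r = q" "h $ (t $ ?r) = s $ q" "t $ ?r \<noteq> ?r"
        using q(3) by (auto simp: hi) (metis hi hs)+
      show "(let p = ?r in if before p (t $ p) then p else t $ p) \<in> {p. before p (t $ p)}"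
        using r(3) before_swap[of ?r "t $ ?r"] by (auto simp: Let_def tt)
      show "(if before (h $ (let p = ?r in if before p (t $ p) then p else t $ p))
             (h $ (t $ (let p = ?r in if before p (t $ p) then p else t $ p)))
           then h $ (let p = ?r in if before p (t $ p) then p else t $ p)
           else h $ (t $ (let p = ?r in if before p (t $ p) then p else t $ p))) = q"
        using q r by (simp add: Let_def tt)
    qed
    then show ?thesis
      using True s by (simp add: inv_sign_def order_sign_mult prod.distrib flip: s_def)
  qed
qed

definition inv_space :: "(pt perm \<Rightarrow> complex) set"
  where "inv_space = {u. \<forall>t. t * t \<noteq> 1 \<longrightarrow> u t = 0}"

lemma subspace_inv_space: "cfun.subspace inv_space"
  by (auto simp: inv_space_def cfun.subspace_def cscale_def)

lemma rho_inv_space: "u \<in> inv_space \<Longrightarrow> inv.rho g u \<in> inv_space"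
  using conj_involution[of "inverse g"] by (simp add: inv_space_def inv.rho_def)

lemma inv_space_span: "inv_space \<subseteq> cspan (basis_elem ` {t. t * t = 1})"
proof
  fix u assume u: "u \<in> inv_space"
  have "u = (\<Sum>t | t * t = 1. cscale (u t) (basis_elem t))"
    using u by (auto simp: fun_eq_iff sum_cscale_apply basis_elem_def inv_space_def if_distrib cong: if_cong)
  also have "\<dots> \<in> cspan (basis_elem ` {t. t * t = 1})"
    by (intro cfun.span_sum cfun.span_scale cfun.span_base) auto
  finally show "u \<in> cspan (basis_elem ` {t. t * t = 1})" .
qed

section \<open>Faithfulness of the involution model\<close>

text \<open>Tests \<open>g * t = s * g\<close> point by point and stops at the first difference.\<close>

primrec agree :: "table \<Rightarrow> table \<Rightarrow> table \<Rightarrow> pt list \<Rightarrow> bool" where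
  "agree g t s [] = True"
| "agree g t s (p # ps) = (if look g (look t p) = look s (look g p) then agree g t s ps else False)"

lemma agree_iff: "agree g t s ps \<longleftrightarrow> (\<forall>p\<in>set ps. look g (look t p) = look s (look g p))"
  by (induction ps) auto

lemma agree_tab: "agree (tab g) (tab t) (tab s) pts \<longleftrightarrow> g * t = s * g"
  by (simp add: agree_iff set_pts perm_eq_iff apply_times)

definition flip_sign :: "table \<Rightarrow> table \<Rightarrow> pt \<Rightarrow> int \<Rightarrow> int"
  where "flip_sign g t p k =
    (if before p (look t p) then if before (look g p) (look g (look t p)) then k else - k else k)"

text \<open>The entry at row \<open>s\<close> and column \<open>t\<close> of the matrix of \<open>g\<close> in the involution model
  (\<open>of_int_coef\<close>).\<close>

definition coef :: "table \<Rightarrow> table \<Rightarrow> table \<Rightarrow> int"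
  where "coef g s t = (if agree g t s pts then fold (flip_sign g t) pts 1 else 0)"

text \<open>The commutant of the involution model has dimension 11, the number of conjugacy classes of \<open>S\<^sub>6\<close>. Each orbit on
  pairs of involutions that carries an equivariant matrix contributes one matrix entry to this list. The weights are the
  solution of the linear system which says that the weighted entries add up to 720 over the class
  of the identity and to 0 over each other class.\<close>

definition weights :: "(int \<times> table \<times> table) list" where "weights = [
  (1, Tab P1 P2 P3 P4 P5 P6, Tab P1 P2 P3 P4 P5 P6),
  (125, Tab P1 P2 P3 P4 P6 P5, Tab P1 P2 P3 P4 P6 P5),
  (100, Tab P1 P2 P3 P5 P4 P6, Tab P1 P2 P3 P4 P6 P5),
  (487, Tab P1 P2 P4 P3 P6 P5, Tab P1 P2 P4 P3 P6 P5),
  (112, Tab P1 P2 P5 P6 P3 P4, Tab P1 P2 P4 P3 P6 P5),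
  (-68, Tab P1 P3 P2 P4 P6 P5, Tab P1 P2 P4 P3 P6 P5),
  (-232, Tab P1 P3 P2 P5 P4 P6, Tab P1 P2 P4 P3 P6 P5),
  (-456, Tab P3 P5 P1 P4 P2 P6, Tab P1 P2 P4 P3 P6 P5),
  (107, Tab P2 P1 P4 P3 P6 P5, Tab P2 P1 P4 P3 P6 P5),
  (-12, Tab P2 P1 P5 P6 P3 P4, Tab P2 P1 P4 P3 P6 P5),
  (-104, Tab P3 P5 P1 P6 P2 P4, Tab P2 P1 P4 P3 P6 P5)]"

definition weighted_coef :: "table \<Rightarrow> int \<times> table \<times> table \<Rightarrow> int"
  where "weighted_coef g w = fst w * coef g (fst (snd w)) (snd (snd w))"

definition weight :: "table \<Rightarrow> int"
  where "weight g = sum_list (map (weighted_coef g) weights)"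

primrec cycle_from :: "nat \<Rightarrow> table \<Rightarrow> pt \<Rightarrow> pt \<Rightarrow> pt list" where
  "cycle_from 0 g p q = []"
| "cycle_from (Suc n) g p q = (if q = p then [] else q # cycle_from n g p (look g q))"

primrec insert_cycle :: "pt list \<Rightarrow> pt list list \<Rightarrow> pt list list" where
  "insert_cycle c [] = [c]"
| "insert_cycle c (d # ds) = (if length d \<le> length c then c # d # ds else d # insert_cycle c ds)"

definition add_cycle :: "table \<Rightarrow> pt \<Rightarrow> pt list list \<Rightarrow> pt list list"
  where "add_cycle g p cs = (if List.member (concat cs) p then cs
    else insert_cycle (p # cycle_from 5 g p (look g p)) cs)"

text \<open>The cycles are sorted by decreasing length. Reading them off one after the other gives a permutation \<open>s\<close> with
  \<open>g * s = s * r\<close>, where \<open>r\<close> is the member of \<open>class_reps\<close> with the cycle type of \<open>g\<close>.\<close>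

definition cycles :: "table \<Rightarrow> pt list list"
  where "cycles g = fold (add_cycle g) pts []"

primrec tab_of_list :: "pt list \<Rightarrow> table" where
  "tab_of_list [] = Tab P1 P1 P1 P1 P1 P1"
| "tab_of_list (a # xs) = (case xs of [b, c, d, e, f] \<Rightarrow> Tab a b c d e f | _ \<Rightarrow> Tab P1 P1 P1 P1 P1 P1)"

definition class_reps :: "table list" where "class_reps = [
  Tab P1 P2 P3 P4 P5 P6, Tab P2 P1 P3 P4 P5 P6, Tab P2 P3 P1 P4 P5 P6, Tab P2 P1 P4 P3 P5 P6,
  Tab P2 P3 P4 P1 P5 P6, Tab P2 P3 P1 P5 P4 P6, Tab P2 P3 P4 P5 P1 P6, Tab P2 P1 P4 P3 P6 P5,
  Tab P2 P3 P4 P1 P6 P5, Tab P2 P3 P1 P5 P6 P4, Tab P2 P3 P4 P5 P6 P1]"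

definition is_rep :: "table \<Rightarrow> table \<Rightarrow> table \<Rightarrow> bool"
  where "is_rep g s r = agree s r g pts"

primrec add_at :: "table \<Rightarrow> int \<Rightarrow> (table \<times> int) list \<Rightarrow> (table \<times> int) list" where
  "add_at r k [] = []"
| "add_at r k (x # xs) = (if fst x = r then (r, snd x + k) # xs else x # add_at r k xs)"

text \<open>The three tally functions add the weight of \<open>g\<close> to the account of its class. The conjugating
  permutation is checked on the way, and \<open>None\<close> reports a failure of the check.\<close>

definition tally_reps :: "table \<Rightarrow> (table \<times> int) list \<Rightarrow> table list \<Rightarrow> (table \<times> int) list option"
  where "tally_reps g acc rs = (case rs of [] \<Rightarrow> None | r # _ \<Rightarrow> Some (add_at r (weight g) acc))"

definition tally_cycles :: "table \<Rightarrow> (table \<times> int) list \<Rightarrow> pt list \<Rightarrow> (table \<times> int) list option"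
  where "tally_cycles g acc xs = (if distinct xs then if length xs = 6
    then tally_reps g acc (filter (is_rep g (tab_of_list xs)) class_reps) else None else None)"

primrec tally :: "table \<Rightarrow> (table \<times> int) list option \<Rightarrow> (table \<times> int) list option" where
  "tally g None = None"
| "tally g (Some acc) = tally_cycles g acc (concat (cycles g))"

definition with_value :: "int \<Rightarrow> table \<Rightarrow> table \<times> int"
  where "with_value k r = (r, k)"

text \<open>The linear system for the weights, verified class by class in one pass through the group.\<close>

lemma class_weights:
  "fold tally tabs (Some (map (with_value 0) class_reps)) =
    Some (with_value 720 (hd class_reps) # map (with_value 0) (tl class_reps))"
  by code_simp

definition involutive_at :: "table \<Rightarrow> pt \<Rightarrow> bool"
  where "involutive_at t p = (look t (look t p) = p)"

definition table_involution :: "table \<Rightarrow> bool"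
  where "table_involution t = list_all (involutive_at t) pts"

lemma length_involutions: "length (filter table_involution tabs) = 76"
  by code_simp

lemma of_int_fold_flip_sign:
  "of_int (fold (flip_sign (tab g) (tab t)) ps k) =
    (of_int k :: complex) * prod_list (map (\<lambda>p. if before p (t $ p) then order_sign g p (t $ p) else 1) ps)"
  by (induction ps arbitrary: k) (auto simp: flip_sign_def order_sign_def)

lemma inv_sign_fold:
  assumes "t * t = 1"
  shows "inv_sign g t = of_int (fold (flip_sign (tab g) (tab t)) pts 1)"
proof -
  have "distinct pts" by (simp add: pts_def)
  have "inv_sign g t = (\<Prod>p\<in>UNIV. if before p (t $ p) then order_sign g p (t $ p) else 1)"
    using assms by (simp add: inv_sign_def prod.inter_filter[symmetric])
  also have "\<dots> = prod_list (map (\<lambda>p. if before p (t $ p) then order_sign g p (t $ p) else 1) pts)"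
    by (rule prod.distinct_set_conv_list[OF \<open>distinct pts\<close>, unfolded set_pts])
  finally show ?thesis by (simp add: of_int_fold_flip_sign)
qed

lemma of_int_coef:
  assumes "t * t = 1"
  shows "of_int (coef (tab g) (tab s) (tab t)) = inv.rho g (basis_elem t) s"
proof -
  have "inverse g * s * inverse (inverse g) = t \<longleftrightarrow> g * t = s * g"
    by (metis mult.assoc perm_mult_inverse perm.inverse_inverse perm.left_inverse perm.right_inverse mult.right_neutral)
  then show ?thesis
    unfolding coef_def agree_tab inv.rho_def basis_elem_def
    by (auto simp flip: inv_sign_fold[OF assms])
qed

lemma tab_involution: "table_involution (tab t) \<longleftrightarrow> t * t = 1"
  by (simp add: table_involution_def involutive_at_def list_all_iff set_pts perm_eq_iff apply_times)

primrec entries :: "table \<Rightarrow> pt list" where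
  "entries (Tab a b c d e f) = [a, b, c, d, e, f]"

lemma distinct_entriesD: "distinct (entries T) \<Longrightarrow> \<exists>g. tab g = T"
  by (cases T) (use exists_perm_of_table in simp)

definition weight_ok :: "int \<times> table \<times> table \<Rightarrow> bool"
  where "weight_ok w = (distinct (entries (fst (snd w))) \<and> distinct (entries (snd (snd w))) \<and>
    table_involution (snd (snd w)))"

lemma weights_ok: "list_all weight_ok weights"
  by code_simp

lemma class_reps_ok: "list_all distinct (map entries class_reps)"
  by code_simp

text \<open>Moves a function on permutations to tables; the value at a table that belongs to no permutation
  is arbitrary.\<close>

definition on_table :: "(pt perm \<Rightarrow> complex) \<Rightarrow> table \<Rightarrow> complex"
  where "on_table z T = z (inv_into UNIV tab T)"

lemma on_table_tab [simp]: "on_table z (tab g) = z g"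
  by (simp add: on_table_def inv_into_f_f[OF inj_tab])

definition total :: "(pt perm \<Rightarrow> complex) \<Rightarrow> (table \<times> int) list \<Rightarrow> complex"
  where "total z acc = sum_list (map (\<lambda>(r, k). of_int k * on_table z r) acc)"

lemma total_add_at: "r \<in> fst ` set acc \<Longrightarrow> total z (add_at r k acc) = total z acc + of_int k * on_table z r"
  by (induction acc) (auto simp: total_def algebra_simps)

lemma fst_add_at: "map fst (add_at r k acc) = map fst acc"
  by (induction acc) auto

text \<open>A class function takes the same value at \<open>g\<close> and at the representative that the tally finds for
  \<open>g\<close>.\<close>

lemma total_tally:
  fixes z :: "pt perm \<Rightarrow> complex"
  assumes cf: "\<And>g s. z (s * g * inverse s) = z g"
    and acc: "map fst acc = class_reps" and t: "tally (tab g) (Some acc) = Some acc'"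
  shows "total z acc' = total z acc + of_int (weight (tab g)) * z g" "map fst acc' = class_reps"
proof -
  define xs where "xs = concat (cycles (tab g))"
  have xs: "distinct xs" "length xs = 6"
    and "tally_reps (tab g) acc (filter (is_rep (tab g) (tab_of_list xs)) class_reps) = Some acc'"
    using t by (auto simp: tally_cycles_def xs_def split: if_splits)
  then obtain r rs where rs: "filter (is_rep (tab g) (tab_of_list xs)) class_reps = r # rs"
    and acc': "acc' = add_at r (weight (tab g)) acc"
    by (auto simp: tally_reps_def split: list.splits)
  then have r: "r \<in> set class_reps" "is_rep (tab g) (tab_of_list xs) r"
    by (use arg_cong[OF rs, of set] in auto)
  have "\<exists>r'. tab r' = r"
    using class_reps_ok r(1) distinct_entriesD by (auto simp: list_all_iff)
  then obtain r' where r': "tab r' = r" ..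
  obtain a b c d e f where abc: "xs = [a, b, c, d, e, f]"
    using xs(2) by (auto simp: length_Suc_conv eval_nat_numeral)
  obtain s where s: "tab s = tab_of_list xs"
    using exists_perm_of_table[OF xs(1)[unfolded abc]] by (auto simp: abc)
  have "s * r' = g * s"
    using r(2) by (simp add: is_rep_def agree_tab flip: s r')
  then have "r' = inverse s * g * inverse (inverse s)"
    by (metis mult.assoc perm_mult_inverse(2) perm.inverse_inverse)
  then have zr: "on_table z r = z g"
    using cf[of "inverse s" g] by (simp flip: r')
  have "r \<in> fst ` set acc" using r(1) acc by (metis list.set_map)
  then show "total z acc' = total z acc + of_int (weight (tab g)) * z g" "map fst acc' = class_reps"
    by (simp_all add: acc' total_add_at zr fst_add_at acc)
qed

lemma fold_tally_None: "fold tally ts None = None"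
  by (induction ts) auto

lemma total_fold_tally:
  fixes z :: "pt perm \<Rightarrow> complex"
  assumes cf: "\<And>g s. z (s * g * inverse s) = z g"
  shows "map fst acc = class_reps \<Longrightarrow> set ts \<subseteq> range tab \<Longrightarrow> fold tally ts (Some acc) = Some acc' \<Longrightarrow>
    total z acc' = total z acc + sum_list (map (\<lambda>T. of_int (weight T) * on_table z T) ts)"
proof (induction ts arbitrary: acc)
  case (Cons T ts)
  then obtain g where g: "T = tab g" by auto
  obtain acc1 where acc1: "tally T (Some acc) = Some acc1"
    using Cons.prems(3) fold_tally_None by (cases "tally T (Some acc)") auto
  note step = total_tally[OF cf Cons.prems(1) acc1[unfolded g]]
  have "total z acc' = total z acc1 + sum_list (map (\<lambda>T. of_int (weight T) * on_table z T) ts)"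
    by (rule Cons.IH[OF step(2)]) (use Cons.prems acc1 in auto)
  then show ?case by (simp add: step(1) g algebra_simps)
qed simp

lemma class_function_weight:
  fixes z :: "pt perm \<Rightarrow> complex"
  assumes cf: "\<And>g s. z (s * g * inverse s) = z g"
  shows "(\<Sum>g\<in>UNIV. of_int (weight (tab g)) * z g) = 720 * z 1"
proof -
  have id: "hd class_reps = tab 1" by (simp add: class_reps_def tab_def)
  have zero: "total z (map (with_value 0) rs) = 0" for rs
    by (induction rs) (simp_all add: total_def with_value_def)
  have "(\<Sum>g\<in>UNIV. of_int (weight (tab g)) * z g) = sum_list (map (\<lambda>T. of_int (weight T) * on_table z T) tabs)"
    using sum_perm_tabs[of "\<lambda>T. of_int (weight T) * on_table z T"] by simp
  also have "\<dots> = total z (with_value 720 (hd class_reps) # map (with_value 0) (tl class_reps))"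
    using total_fold_tally[OF cf _ _ class_weights] zero set_tabs
    by (simp add: with_value_def o_def)
  also have "\<dots> = 720 * z 1"
    using zero[of "tl class_reps"] by (simp add: total_def id with_value_def)
  finally show ?thesis .
qed

text \<open>Each entry of the matrix of \<open>z\<close> in the involution model vanishes, hence so does the weighted
  sum of entries, which equals \<open>720 * z 1\<close> by the choice of the weights.\<close>

lemma class_function_zero:
  fixes z :: "pt perm \<Rightarrow> complex"
  assumes cf: "\<And>g s. z (s * g * inverse s) = z g"
    and kill: "\<And>u. u \<in> inv_space \<Longrightarrow> inv.alg z u = 0"
  shows "z 1 = 0"
proof -
  have coef0: "(\<Sum>g\<in>UNIV. of_int (weighted_coef (tab g) w) * z g) = 0" if w: "w \<in> set weights" for w
  proof -
    have "weight_ok w" using weights_ok w by (simp add: list_all_iff)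
    then obtain s t where st: "fst (snd w) = tab s" "snd (snd w) = tab t" "t * t = 1"
      unfolding weight_ok_def using distinct_entriesD by (metis tab_involution)
    have "(\<Sum>g\<in>UNIV. of_int (weighted_coef (tab g) w) * z g)
       = of_int (fst w) * (\<Sum>g\<in>UNIV. z g * inv.rho g (basis_elem t) s)"
      by (simp add: weighted_coef_def st of_int_coef sum_distrib_left mult_ac)
    also have "(\<Sum>g\<in>UNIV. z g * inv.rho g (basis_elem t) s) = inv.alg z (basis_elem t) s"
      by (simp add: inv.alg_def sum_cscale_apply)
    also have "basis_elem t \<in> inv_space" using st(3) by (auto simp: inv_space_def basis_elem_def)
    then have "inv.alg z (basis_elem t) s = 0" using kill by simp
    finally show ?thesis by simp
  qed
  have "720 * z 1 = (\<Sum>g\<in>UNIV. \<Sum>w\<leftarrow>weights. of_int (weighted_coef (tab g) w) * z g)"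
  proof -
    have "of_int (sum_list (map f ws)) * c = (\<Sum>w\<leftarrow>ws. of_int (f w) * c)"
      for f :: "int \<times> table \<times> table \<Rightarrow> int" and ws and c :: complex
      by (induction ws) (simp_all add: algebra_simps)
    then show ?thesis by (simp only: class_function_weight[OF cf, symmetric] weight_def)
  qed
  also have "\<dots> = (\<Sum>w\<leftarrow>weights. \<Sum>g\<in>UNIV. of_int (weighted_coef (tab g) w) * z g)"
  proof -
    have "(\<Sum>g\<in>UNIV. \<Sum>w\<leftarrow>ws. F g w) = (\<Sum>w\<leftarrow>ws. \<Sum>g\<in>UNIV. F g w)"
      for ws :: "(int \<times> table \<times> table) list" and F :: "pt perm \<Rightarrow> _ \<Rightarrow> complex"
      by (induction ws) (simp_all add: sum.distrib)
    then show ?thesis .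
  qed
  also have "\<dots> = 0" using coef0 by (simp cong: map_cong)
  finally show ?thesis by simp
qed

text \<open>The elements that act as zero form a two-sided ideal. Translate \<open>x\<close> by \<open>k\<close> and average over
  conjugation: the result is a class function in this ideal whose value at 1 is \<open>720 * x k\<close>.\<close>

lemma inv_space_faithful:
  assumes kill: "\<And>u. u \<in> inv_space \<Longrightarrow> inv.alg x u = 0"
  shows "x = 0"
proof
  fix k
  define z where "z g = (\<Sum>h\<in>UNIV. x (h * g * inverse h * k))" for g
  have "z 1 = 0"
  proof (rule class_function_zero)
    fix g s
    have "z (s * g * inverse s) = (\<Sum>h\<in>UNIV. x ((h * s) * g * inverse (h * s) * k))"
      by (simp add: z_def mult.assoc)
    also have "\<dots> = z g" unfolding z_def by (rule sum_perm_mult_right)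
    finally show "z (s * g * inverse s) = z g" .
  next
    fix u assume u: "u \<in> inv_space"
    have term0: "(\<Sum>g\<in>UNIV. cscale (x (h * g * inverse h * k)) (inv.rho g u)) = 0" for h
    proof -
      define w where "w = inv.rho (inverse k) (inv.rho h u)"
      have w: "inv.rho (inverse h * g * inverse k * h) u = inv.rho (inverse h) (inv.rho g w)" for g
        by (simp only: w_def inv.rho_mult)
      have "(\<Sum>g\<in>UNIV. cscale (x (h * g * inverse h * k)) (inv.rho g u)) =
         (\<Sum>g\<in>UNIV. cscale (x g) (inv.rho (inverse h * g * inverse k * h) u))"
        by (rule sum.reindex_bij_witness[where i = "\<lambda>g. inverse h * g * inverse k * h" and j = "\<lambda>g. h * g * inverse h * k"])
           (simp_all only: mult.assoc perm_mult_inverse perm.left_inverse perm.right_inverse mult.right_neutral UNIV_I)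
      also have "\<dots> = (\<Sum>g\<in>UNIV. inv.rho (inverse h) (cscale (x g) (inv.rho g w)))"
        by (simp only: w clinear_opD[OF inv.clinear_rho])
      also have "\<dots> = inv.rho (inverse h) (inv.alg x w)"
        by (simp only: inv.alg_def clinear_opD[OF inv.clinear_rho])
      also have "inv.alg x w = 0" unfolding w_def by (intro kill rho_inv_space u)
      finally show ?thesis by (simp only: clinear_opD[OF inv.clinear_rho])
    qed
    have "inv.alg z u = (\<Sum>g\<in>UNIV. \<Sum>h\<in>UNIV. cscale (x (h * g * inverse h * k)) (inv.rho g u))"
      by (simp only: inv.alg_def z_def cfun.scale_sum_left)
    also have "\<dots> = (\<Sum>h\<in>UNIV. \<Sum>g\<in>UNIV. cscale (x (h * g * inverse h * k)) (inv.rho g u))"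
      by (rule sum.swap)
    finally show "inv.alg z u = 0" using term0 by simp
  qed
  moreover have "z 1 = 720 * x k" by (simp add: z_def card_perm_pt)
  ultimately show "x k = 0 k" by simp
qed

lemma card_involutions: "card (basis_elem ` {t :: pt perm. t * t = 1}) \<le> 76"
proof -
  have "tab ` {t. t * t = 1} \<subseteq> set (filter table_involution tabs)"
    using tab_in_tabs by (auto simp: tab_involution)
  then have "card (tab ` {t. t * t = 1}) \<le> card (set (filter table_involution tabs))"
    by (intro card_mono) auto
  also have "\<dots> \<le> 76" using card_length[of "filter table_involution tabs"] length_involutions by simp
  finally have "card {t :: pt perm. t * t = 1} \<le> 76"
    by (simp add: card_image inj_on_subset[OF inj_tab])
  then show ?thesis using card_image_le[of "{t :: pt perm. t * t = 1}" basis_elem] by simp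
qed

section \<open>Commuting partitions into 76 blocks\<close>

definition ind :: "'a set \<Rightarrow> 'a \<Rightarrow> complex"
  where "ind X g = (if g \<in> X then 1 else 0)"

text \<open>What a commutative Schur ring of dimension 76 over \<open>S\<^sub>6\<close> provides: its basic sets are the
  blocks.\<close>

locale commuting_partition =
  fixes P :: "pt perm set set"
  assumes part: "partition_on UNIV P" and card_P: "card P = 76"
    and inverse_block: "X \<in> P \<Longrightarrow> inverse ` X \<in> P"
    and commute: "X \<in> P \<Longrightarrow> Y \<in> P \<Longrightarrow> conv (ind X) (ind Y) = conv (ind Y) (ind X)"
begin

definition block_const :: "(pt perm \<Rightarrow> complex) \<Rightarrow> bool"
  where "block_const F \<longleftrightarrow> (\<forall>X\<in>P. \<forall>g\<in>X. \<forall>h\<in>X. F g = F h)"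

lemma finite_P: "finite P"
  using card_P by (intro card_ge_0_finite) simp

lemma blocks_disjoint: "X \<in> P \<Longrightarrow> Y \<in> P \<Longrightarrow> g \<in> X \<Longrightarrow> g \<in> Y \<Longrightarrow> X = Y"
  using part by (auto simp: partition_on_def disjoint_def)

lemma block_nonempty: "X \<in> P \<Longrightarrow> \<exists>g. g \<in> X"
  using part unfolding partition_on_def by (metis ex_in_conv)

lemma ind_block: "X \<in> P \<Longrightarrow> g \<in> X \<Longrightarrow> Y \<in> P \<Longrightarrow> ind Y g = (if Y = X then 1 else 0)"
  using blocks_disjoint by (auto simp: ind_def)

lemma star_ind: "star (ind X) = ind (inverse ` X)"
  by (force simp: fun_eq_iff star_def ind_def)

text \<open>Otherwise \<open>E\<close> and the 76 block sums would be 77 linearly independent elements of a commuting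
  star-closed family, more than the involution model has dimensions.\<close>

lemma block_const_of_commuting:
  assumes E: "star E = E" and comm: "\<And>X. X \<in> P \<Longrightarrow> conv (ind X) E = conv E (ind X)"
  shows "block_const E"
proof (cases "E \<in> ind ` P")
  case True
  then show ?thesis by (auto simp: block_const_def ind_block)
next
  case False
  have inj: "inj_on ind P"
    by (auto simp: inj_on_def ind_def fun_eq_iff set_eq_iff split: if_splits)
  let ?F = "insert E (ind ` P)"
  have "\<exists>c. (\<exists>x\<in>?F. c x \<noteq> 0) \<and> (\<Sum>x\<in>?F. cscale (c x) x) = 0"
  proof (rule inv.commuting_family_dependent)
    show "cfun.subspace inv_space" by (rule subspace_inv_space)
    show "inv.rho g u \<in> inv_space" if "u \<in> inv_space" for g u using that by (rule rho_inv_space)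
    show "inv_space \<subseteq> cspan (basis_elem ` {t. t * t = 1})" by (rule inv_space_span)
    show "x = 0" if "\<And>u. u \<in> inv_space \<Longrightarrow> inv.alg x u = 0" for x using that by (rule inv_space_faithful)
    show "card (basis_elem ` {t :: pt perm. t * t = 1}) < card ?F"
      using card_involutions False finite_P by (simp add: card_image[OF inj] card_P)
    show "conv x y = conv y x" if "x \<in> ?F" "y \<in> ?F" for x y
      using that comm commute by auto
    show "star x \<in> ?F" if "x \<in> ?F" for x
      using that E inverse_block by (auto simp: star_ind)
  qed (use finite_P in auto)
  then obtain c where c: "\<exists>x\<in>?F. c x \<noteq> 0" "(\<Sum>x\<in>?F. cscale (c x) x) = 0" by blast
  have eq: "c E * E g + c (ind X) = 0" if "X \<in> P" "g \<in> X" for X g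
  proof -
    have "0 = (\<Sum>x\<in>?F. cscale (c x) x) g" by (simp add: c(2))
    also have "\<dots> = c E * E g + (\<Sum>Y\<in>P. c (ind Y) * ind Y g)"
      using False finite_P by (simp add: sum.reindex[OF inj]) (simp add: cscale_def sum_fun_apply)
    also have "(\<Sum>Y\<in>P. c (ind Y) * ind Y g) = (\<Sum>Y\<in>P. if Y = X then c (ind X) else 0)"
      using that by (intro sum.cong) (auto simp: ind_block)
    finally show ?thesis using that finite_P by simp
  qed
  have "c E \<noteq> 0"
  proof
    assume "c E = 0"
    then have "c (ind X) = 0" if "X \<in> P" for X using eq[OF that] block_nonempty[OF that] by auto
    then show False using c(1) \<open>c E = 0\<close> by auto
  qed
  then have "E g = - c (ind X) / c E" if "X \<in> P" "g \<in> X" for X g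
    using eq[OF that] by (simp add: field_simps add_eq_0_iff)
  then show ?thesis by (simp add: block_const_def)
qed

end

section \<open>Averaging over the symmetric group\<close>

interpretation point: signed_action "\<lambda>g (p :: pt). g $ p" "\<lambda>_ _. 1"
  by standard (auto simp: apply_times)

lemma apply_inverse_apply [simp]:
  "inverse g $ (g $ p) = p" "g $ (inverse g $ p) = p" for g :: "'a perm"
  by (simp_all only: apply_sequence perm.left_inverse perm.right_inverse apply_one id_apply)

lemma sum_apply: "(\<Sum>p\<in>UNIV. f (g $ p)) = (\<Sum>p\<in>UNIV. f p)" for f :: "'a \<Rightarrow> 'b::comm_monoid_add"
  by (rule sum.reindex_bij_witness[where i = "apply (inverse g)" and j = "apply g"]) auto

lemma exists_perm_moving:
  assumes "q \<noteq> p" "q' \<noteq> p" "q \<noteq> r" "q' \<noteq> r"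
  shows "\<exists>k :: 'a perm. k $ p = p \<and> k $ r = r \<and> k $ q = q'"
  using assms by (intro exI[of _ "Perm.swap q q'"]) auto

lemma sum_orbit_single: "(\<Sum>g\<in>UNIV. f (g $ p)) = 120 * (\<Sum>a\<in>UNIV. f a)" for f :: "pt \<Rightarrow> complex"
proof -
  have indep: "(\<Sum>g\<in>UNIV. f (g $ q)) = (\<Sum>g\<in>UNIV. f (g $ p))" for q
  proof -
    have "(\<Sum>g\<in>UNIV. f (g $ q)) = (\<Sum>g\<in>UNIV. f ((g * Perm.swap p q) $ p))"
      by (simp only: apply_times o_apply apply_swap_simp)
    also have "\<dots> = (\<Sum>g\<in>UNIV. f (g $ p))" by (rule sum_perm_mult_right)
    finally show ?thesis .
  qed
  have "6 * (\<Sum>g\<in>UNIV. f (g $ p)) = (\<Sum>q\<in>UNIV. \<Sum>g\<in>UNIV. f (g $ q))"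
  proof -
    have "(\<Sum>q\<in>UNIV. \<Sum>g\<in>UNIV. f (g $ q)) = (\<Sum>q\<in>(UNIV :: pt set). \<Sum>g\<in>UNIV. f (g $ p))"
      by (intro sum.cong refl indep)
    then show ?thesis by (simp add: card_pt)
  qed
  also have "\<dots> = (\<Sum>g\<in>UNIV. \<Sum>q\<in>UNIV. f (g $ q))" by (rule sum.swap)
  also have "\<dots> = 720 * (\<Sum>a\<in>UNIV. f a)" by (simp add: sum_apply card_perm_pt)
  finally show ?thesis by simp
qed

text \<open>The sum has the same value for all \<open>q \<noteq> p\<close>, and the sum over all \<open>q\<close> vanishes because
  \<open>h\<close> has sum zero; the value at \<open>q = p\<close> thus determines the others.\<close>

lemma sum_orbit_pair:
  fixes f h :: "pt \<Rightarrow> complex"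
  assumes h: "(\<Sum>a\<in>UNIV. h a) = 0"
  shows "(\<Sum>g\<in>UNIV. f (g $ p) * h (g $ q)) = (if p = q then 120 else -24) * (\<Sum>a\<in>UNIV. f a * h a)"
proof (cases "p = q")
  case True
  then show ?thesis using sum_orbit_single[of "\<lambda>a. f a * h a"] by simp
next
  case False
  let ?S = "\<lambda>q. \<Sum>g\<in>UNIV. f (g $ p) * h (g $ q)"
  have indep: "?S q' = ?S q" if q': "q' \<noteq> p" for q'
  proof -
    obtain k where k: "k $ p = p" "k $ q' = q" using exists_perm_moving[of q' p q p] q' False by auto
    have "?S q = (\<Sum>g\<in>UNIV. f ((g * k) $ p) * h ((g * k) $ q'))"
      by (simp only: apply_times o_apply k)
    also have "\<dots> = ?S q'" by (rule sum_perm_mult_right)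
    finally show ?thesis by (rule sym)
  qed
  have "(\<Sum>q'\<in>UNIV. ?S q') = (\<Sum>g\<in>UNIV. f (g $ p) * (\<Sum>q'\<in>UNIV. h (g $ q')))"
    by (subst sum.swap) (simp add: sum_distrib_left)
  also have "\<dots> = 0" by (simp add: sum_apply h)
  finally have "?S p + (\<Sum>q'\<in>UNIV - {p}. ?S q') = 0"
    by (simp add: sum.remove[of UNIV p])
  moreover have "(\<Sum>q'\<in>UNIV - {p}. ?S q') = (\<Sum>q'\<in>UNIV - {p}. ?S q)"
    by (intro sum.cong refl indep) auto
  ultimately have "?S p + 5 * ?S q = 0" by (simp add: card_pt card_Diff_singleton)
  moreover have "?S p = 120 * (\<Sum>a\<in>UNIV. f a * h a)"
    using sum_orbit_single[of "\<lambda>a. f a * h a"] by simp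
  ultimately have "5 * ?S q = 5 * (-24 * (\<Sum>a\<in>UNIV. f a * h a))" by (simp add: add_eq_0_iff)
  then have "?S q = -24 * (\<Sum>a\<in>UNIV. f a * h a)" by (subst (asm) mult_cancel_left) simp
  then show ?thesis using False by simp
qed

text \<open>As for pairs: the sum depends only on which of the points \<open>p\<close>, \<open>q\<close>, \<open>r\<close> coincide, and summing over one of them gives zero.
  The right-hand side interpolates the resulting values 120, -24 and 12 for one, two and three different
  points.\<close>

lemma sum_orbit_triple:
  fixes x y z :: "pt \<Rightarrow> complex"
  assumes sx: "(\<Sum>a\<in>UNIV. x a) = 0" and sy: "(\<Sum>a\<in>UNIV. y a) = 0" and sz: "(\<Sum>a\<in>UNIV. z a) = 0"
  shows "(\<Sum>g\<in>UNIV. x (g $ p) * y (g $ q) * z (g $ r)) =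
    (12 - 36 * ((if p = q then 1 else 0) + (if q = r then 1 else 0) + (if p = r then 1 else 0))
      + (if p = q \<and> q = r then 216 else 0)) * (\<Sum>a\<in>UNIV. x a * y a * z a)"
proof -
  let ?t = "\<Sum>a\<in>UNIV. x a * y a * z a"
  let ?S = "\<lambda>p q r. \<Sum>g\<in>UNIV. x (g $ p) * y (g $ q) * z (g $ r)"
  have ppq: "?S p p q = (if p = q then 120 else -24) * ?t" for p q
    using sum_orbit_pair[OF sz, of "\<lambda>a. x a * y a" p q] by simp
  have pqq: "?S p q q = (if p = q then 120 else -24) * ?t" for p q
    using sum_orbit_pair[OF sx, of "\<lambda>a. y a * z a" q p] by (simp add: mult_ac eq_commute)
  have pqp: "?S p q p = (if p = q then 120 else -24) * ?t" for p q
    using sum_orbit_pair[OF sy, of "\<lambda>a. x a * z a" p q] by (simp add: mult_ac)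
  show ?thesis
  proof (cases "p = q \<or> q = r \<or> p = r")
    case True
    then consider "p = q" | "q = r" | "p = r" by blast
    then show ?thesis
    proof cases
      case 1
      then show ?thesis using ppq[of q r] by (simp only: if_True if_False refl simp_thms) (cases "q = r"; simp)
    next
      case 2
      then show ?thesis using pqq[of p r] by (simp only: if_True if_False refl simp_thms) (cases "p = r"; simp)
    next
      case 3
      then show ?thesis using pqp[of r q] by (simp only: if_True if_False refl simp_thms) (cases "r = q"; simp)
    qed
  next
    case False
    have indep: "?S p q r' = ?S p q r" if r': "r' \<noteq> p" "r' \<noteq> q" for r'
    proof -
      obtain k where k: "k $ p = p" "k $ q = q" "k $ r' = r"
        using exists_perm_moving[of r' p r q] r' False by auto
      have "?S p q r = (\<Sum>g\<in>UNIV. x ((g * k) $ p) * y ((g * k) $ q) * z ((g * k) $ r'))"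
        by (simp only: apply_times o_apply k)
      also have "\<dots> = ?S p q r'" by (rule sum_perm_mult_right)
      finally show ?thesis by (rule sym)
    qed
    have "(\<Sum>r'\<in>UNIV. ?S p q r') = (\<Sum>g\<in>UNIV. x (g $ p) * y (g $ q) * (\<Sum>r'\<in>UNIV. z (g $ r')))"
      by (subst sum.swap) (simp add: sum_distrib_left)
    also have "\<dots> = 0" by (simp add: sum_apply sz)
    finally have "(\<Sum>r'\<in>UNIV. ?S p q r') = 0" .
    then have "?S p q p + (?S p q q + (\<Sum>r'\<in>UNIV - {p} - {q}. ?S p q r')) = 0"
    proof -
      have "(\<Sum>r'\<in>UNIV. ?S p q r') = ?S p q p + (\<Sum>r'\<in>UNIV - {p}. ?S p q r')"
        by (rule sum.remove) auto
      also have "(\<Sum>r'\<in>UNIV - {p}. ?S p q r') = ?S p q q + (\<Sum>r'\<in>UNIV - {p} - {q}. ?S p q r')"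
        by (rule sum.remove) (use False in auto)
      finally show ?thesis using \<open>(\<Sum>r'\<in>UNIV. ?S p q r') = 0\<close> by simp
    qed
    moreover have "(\<Sum>r'\<in>UNIV - {p} - {q}. ?S p q r') = (\<Sum>r'\<in>UNIV - {p} - {q}. ?S p q r)"
      by (intro sum.cong refl indep) auto
    moreover have "card (UNIV - {p} - {q}) = 4"
    proof -
      have "UNIV - {p} - {q} = UNIV - {p, q}" by auto
      then show ?thesis using False by (simp add: card_Diff_subset card_pt)
    qed
    moreover have "?S p q p = -24 * ?t" "?S p q q = -24 * ?t" 
      using pqp[of p q] pqq[of p q] False unfolding de_Morgan_disj by (simp_all only: if_False simp_thms)
    ultimately have "-24 * ?t + (-24 * ?t + 4 * ?S p q r) = 0" by (simp only: sum_constant of_nat_numeral)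
    moreover have "-24 * t + (-24 * t + 4 * s) = 0 \<Longrightarrow> s = 12 * t" for t s :: complex
      by (auto simp: complex_eq_iff)
    ultimately have "?S p q r = 12 * ?t" by blast
    then show ?thesis using False by simp
  qed
qed

lemma sum_product_triple:
  fixes a b c :: "pt \<Rightarrow> complex"
  shows "(\<Sum>p\<in>UNIV. a p) * (\<Sum>q\<in>UNIV. b q) * (\<Sum>r\<in>UNIV. c r) =
    (\<Sum>p\<in>UNIV. \<Sum>q\<in>UNIV. \<Sum>r\<in>UNIV. a p * b q * c r)"
proof -
  have "(\<Sum>p\<in>UNIV. a p) * (\<Sum>q\<in>UNIV. b q) * (\<Sum>r\<in>UNIV. c r) =
     (\<Sum>p\<in>UNIV. a p * (\<Sum>q\<in>UNIV. b q * (\<Sum>r\<in>UNIV. c r)))"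
    by (simp only: sum_distrib_right mult.assoc)
  then show ?thesis by (simp only: sum_distrib_left mult.assoc)
qed

lemma average_pair:
  fixes x y x' y' :: "pt \<Rightarrow> complex"
  assumes "(\<Sum>a\<in>UNIV. y a) = 0" and "(\<Sum>a\<in>UNIV. x' a) = 0"
  shows "(\<Sum>g\<in>UNIV. (\<Sum>p\<in>UNIV. x (g $ p) * x' p) * (\<Sum>p\<in>UNIV. y (g $ p) * y' p)) =
    144 * (\<Sum>a\<in>UNIV. x a * y a) * (\<Sum>a\<in>UNIV. x' a * y' a)"
proof -
  define t where "t = (\<Sum>a\<in>UNIV. x a * y a)"
  have "(\<Sum>g\<in>UNIV. (\<Sum>p\<in>UNIV. x (g $ p) * x' p) * (\<Sum>p\<in>UNIV. y (g $ p) * y' p)) =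
     (\<Sum>g\<in>UNIV. \<Sum>p\<in>UNIV. \<Sum>q\<in>UNIV. x (g $ p) * y (g $ q) * (x' p * y' q))"
    by (simp add: sum_product mult_ac)
  also have "\<dots> = (\<Sum>p\<in>UNIV. \<Sum>g\<in>UNIV. \<Sum>q\<in>UNIV. x (g $ p) * y (g $ q) * (x' p * y' q))"
    by (rule sum.swap)
  also have "\<dots> = (\<Sum>p\<in>UNIV. \<Sum>q\<in>UNIV. \<Sum>g\<in>UNIV. x (g $ p) * y (g $ q) * (x' p * y' q))"
    by (intro sum.cong refl sum.swap)
  also have "\<dots> = (\<Sum>p\<in>UNIV. \<Sum>q\<in>UNIV. ((if p = q then 144 else 0) - 24) * t * (x' p * y' q))"
    by (intro sum.cong refl) (simp add: sum_distrib_right[symmetric] sum_orbit_pair[OF assms(1)] t_def[symmetric])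
  also have "\<dots> = (\<Sum>p\<in>UNIV. \<Sum>q\<in>UNIV. (if p = q then 144 * t * (x' p * y' q) else 0)) -
      24 * t * (\<Sum>p\<in>UNIV. \<Sum>q\<in>UNIV. x' p * y' q)"
    unfolding sum_distrib_left sum_subtractf[symmetric]
    by (intro sum.cong refl) (simp add: algebra_simps)
  also have "(\<Sum>p\<in>UNIV. \<Sum>q\<in>UNIV. x' p * y' q) = 0"
    by (simp add: sum_product[symmetric] assms(2))
  also have "(\<Sum>p\<in>UNIV. \<Sum>q\<in>UNIV. (if p = q then 144 * t * (x' p * y' q) else 0)) - 24 * t * 0
      = 144 * t * (\<Sum>a\<in>UNIV. x' a * y' a)"
    by (simp add: sum_distrib_left mult.assoc)
  finally show ?thesis by (simp only: t_def)
qed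

text \<open>In \<open>sum_orbit_triple\<close> only the term for \<open>p = q = r\<close> survives multiplication with \<open>x' p * y' q * z' r\<close> and
  summation, because every other term leaves out one of the points, and \<open>x'\<close>, \<open>y'\<close>, \<open>z'\<close>
  have sum zero.\<close>

lemma average_triple:
  fixes x y z x' y' z' :: "pt \<Rightarrow> complex"
  assumes "(\<Sum>a\<in>UNIV. x a) = 0" "(\<Sum>a\<in>UNIV. y a) = 0" "(\<Sum>a\<in>UNIV. z a) = 0"
    and s: "(\<Sum>a\<in>UNIV. x' a) = 0" "(\<Sum>a\<in>UNIV. y' a) = 0" "(\<Sum>a\<in>UNIV. z' a) = 0"
  shows "(\<Sum>g\<in>UNIV. (\<Sum>p\<in>UNIV. x (g $ p) * x' p) * (\<Sum>p\<in>UNIV. y (g $ p) * y' p)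
      * (\<Sum>p\<in>UNIV. z (g $ p) * z' p)) =
    216 * (\<Sum>a\<in>UNIV. x a * y a * z a) * (\<Sum>a\<in>UNIV. x' a * y' a * z' a)"
proof -
  define t where "t = (\<Sum>a\<in>UNIV. x a * y a * z a)"
  let ?w = "\<lambda>p q r. x' p * y' q * z' r"
  have "(\<Sum>g\<in>UNIV. (\<Sum>p\<in>UNIV. x (g $ p) * x' p) * (\<Sum>p\<in>UNIV. y (g $ p) * y' p)
      * (\<Sum>p\<in>UNIV. z (g $ p) * z' p)) =
     (\<Sum>g\<in>UNIV. \<Sum>p\<in>UNIV. \<Sum>q\<in>UNIV. \<Sum>r\<in>UNIV. x (g $ p) * y (g $ q) * z (g $ r) * ?w p q r)"
    unfolding sum_product_triple by (intro sum.cong refl) (simp add: mult_ac)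
  also have "\<dots> = (\<Sum>p\<in>UNIV. \<Sum>g\<in>UNIV. \<Sum>q\<in>UNIV. \<Sum>r\<in>UNIV. x (g $ p) * y (g $ q) * z (g $ r) * ?w p q r)"
    by (rule sum.swap)
  also have "\<dots> = (\<Sum>p\<in>UNIV. \<Sum>q\<in>UNIV. \<Sum>g\<in>UNIV. \<Sum>r\<in>UNIV. x (g $ p) * y (g $ q) * z (g $ r) * ?w p q r)"
    by (intro sum.cong refl sum.swap)
  also have "\<dots> = (\<Sum>p\<in>UNIV. \<Sum>q\<in>UNIV. \<Sum>r\<in>UNIV. \<Sum>g\<in>UNIV. x (g $ p) * y (g $ q) * z (g $ r) * ?w p q r)"
    by (intro sum.cong refl sum.swap)
  also have "\<dots> = (\<Sum>p\<in>UNIV. \<Sum>q\<in>UNIV. \<Sum>r\<in>UNIV.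
     (12 - 36 * ((if p = q then 1 else 0) + (if q = r then 1 else 0) + (if p = r then 1 else 0))
      + (if p = q \<and> q = r then 216 else 0)) * t * ?w p q r)"
    by (intro sum.cong refl) (simp only: sum_distrib_right[symmetric] sum_orbit_triple[OF assms(1-3)] t_def)
  also have "\<dots> = t * (\<Sum>p\<in>UNIV. \<Sum>q\<in>UNIV. \<Sum>r\<in>UNIV.
     12 * ?w p q r - (36 * (if p = q then ?w p q r else 0) + 36 * (if q = r then ?w p q r else 0)
       + 36 * (if r = p then ?w p q r else 0)) + 216 * (if r = q then if p = q then ?w p q r else 0 else 0))"
    unfolding sum_distrib_left by (intro sum.cong refl) (auto simp: algebra_simps)
  also have "\<dots> = t * (12 * (\<Sum>p\<in>UNIV. \<Sum>q\<in>UNIV. \<Sum>r\<in>UNIV. ?w p q r)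
     - (36 * (\<Sum>p\<in>UNIV. \<Sum>q\<in>UNIV. \<Sum>r\<in>UNIV. if p = q then ?w p q r else 0)
        + 36 * (\<Sum>p\<in>UNIV. \<Sum>q\<in>UNIV. \<Sum>r\<in>UNIV. if q = r then ?w p q r else 0)
        + 36 * (\<Sum>p\<in>UNIV. \<Sum>q\<in>UNIV. \<Sum>r\<in>UNIV. if r = p then ?w p q r else 0))
     + 216 * (\<Sum>p\<in>UNIV. \<Sum>q\<in>UNIV. \<Sum>r\<in>UNIV. if r = q then if p = q then ?w p q r else 0 else 0))"
    by (simp only: sum.distrib sum_subtractf sum_distrib_left)
  also have "(\<Sum>p\<in>UNIV. \<Sum>q\<in>UNIV. \<Sum>r\<in>UNIV. ?w p q r) = 0"
    by (simp add: s sum_distrib_left[symmetric])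
  also have "(\<Sum>p\<in>UNIV. \<Sum>q\<in>UNIV. \<Sum>r\<in>UNIV. if p = q then ?w p q r else 0) = 0"
  proof -
    have "(\<Sum>r\<in>UNIV. if p = q then ?w p q r else 0) = 0" for p q
      by (cases "p = q") (simp_all add: s sum_distrib_left[symmetric])
    then show ?thesis by simp
  qed
  also have "(\<Sum>p\<in>UNIV. \<Sum>q\<in>UNIV. \<Sum>r\<in>UNIV. if q = r then ?w p q r else 0) = 0"
  proof -
    have "(\<Sum>p\<in>UNIV. \<Sum>q\<in>UNIV. \<Sum>r\<in>UNIV. if q = r then ?w p q r else 0) = (\<Sum>p\<in>UNIV. x' p * (\<Sum>q\<in>UNIV. y' q * z' q))"
      by (simp add: sum_distrib_left mult_ac)
    also have "\<dots> = 0" by (simp add: s sum_distrib_right[symmetric])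
    finally show ?thesis .
  qed
  also have "(\<Sum>p\<in>UNIV. \<Sum>q\<in>UNIV. \<Sum>r\<in>UNIV. if r = p then ?w p q r else 0) = 0"
  proof -
    have "(\<Sum>p\<in>UNIV. \<Sum>q\<in>UNIV. \<Sum>r\<in>UNIV. if r = p then ?w p q r else 0) = (\<Sum>p\<in>UNIV. x' p * z' p * (\<Sum>q\<in>UNIV. y' q))"
      by (simp add: sum_distrib_left mult_ac)
    also have "\<dots> = 0" by (simp add: s)
    finally show ?thesis .
  qed
  also have "(\<Sum>p\<in>UNIV. \<Sum>q\<in>UNIV. \<Sum>r\<in>UNIV. if r = q then if p = q then ?w p q r else 0 else 0)
     = (\<Sum>p\<in>UNIV. x' p * y' p * z' p)"
    by simp
  finally show ?thesis by (simp add: t_def mult_ac)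
qed

section \<open>The common eigenvectors in the six-dimensional representation\<close>

abbreviation vsum :: "(pt \<Rightarrow> complex) \<Rightarrow> complex"
  where "vsum v \<equiv> \<Sum>p\<in>UNIV. v p"

text \<open>The conjugate of the diagonal matrix coefficient of \<open>g\<close> at \<open>v\<close> in the natural representation.\<close>

definition mcoef :: "(pt \<Rightarrow> complex) \<Rightarrow> pt perm \<Rightarrow> complex"
  where "mcoef v g = (\<Sum>p\<in>UNIV. v (g $ p) * cnj (v p))"

lemma mcoef_ip: "mcoef v g = ip v (point.rho (inverse g) v)"
  by (simp add: mcoef_def ip_def point.rho_def mult.commute)

lemma vsum_rho: "vsum (point.rho g v) = vsum v"
  by (simp add: point.rho_def sum_apply)

lemma vsum_alg: "vsum v = 0 \<Longrightarrow> vsum (point.alg x v) = 0"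
  by (simp add: point.alg_def sum_cscale_apply sum.swap[of _ UNIV UNIV] sum_distrib_left[symmetric] vsum_rho)

lemma cscale_divide: "k \<noteq> 0 \<Longrightarrow> cscale k a = cscale m b \<Longrightarrow> a = cscale (m / k) b"
  by (auto simp: cscale_def fun_eq_iff field_simps)

lemma vsum_zero_ext:
  assumes "vsum a = 0" "vsum b = 0" "\<And>w. vsum w = 0 \<Longrightarrow> ip w a = ip w b"
  shows "a = b"
proof -
  have "ip (a - b) (a - b) = 0"
    using assms by (simp add: ip_diff_right sum_subtractf)
  then show ?thesis by simp
qed

context commuting_partition
begin

definition Eig :: "(pt \<Rightarrow> complex) set"
  where "Eig = {v. v \<noteq> 0 \<and> vsum v = 0 \<and> (\<forall>X\<in>P. \<exists>c. point.alg (ind X) v = cscale c v)}"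

lemma EigD: "v \<in> Eig \<Longrightarrow> v \<noteq> 0" "v \<in> Eig \<Longrightarrow> vsum v = 0"
  by (simp_all add: Eig_def)

lemma Eig_eigenvalue: "v \<in> Eig \<Longrightarrow> X \<in> P \<Longrightarrow> \<exists>c. point.alg (ind X) v = cscale c v"
  by (simp add: Eig_def)

lemma Eig_scale: "v \<in> Eig \<Longrightarrow> c \<noteq> 0 \<Longrightarrow> cscale c v \<in> Eig"
  unfolding Eig_def
  by (auto simp: clinear_opD(2)[OF point.clinear_alg] cfun.scale_left_commute[of _ c])
     (auto simp: cscale_def sum_distrib_left[symmetric] fun_eq_iff)

lemma Eig_cnj: "v \<in> Eig \<Longrightarrow> (\<lambda>p. cnj (v p)) \<in> Eig"
proof -
  assume v: "v \<in> Eig"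
  have "point.alg (ind X) (\<lambda>p. cnj (v p)) = (\<lambda>p. cnj (point.alg (ind X) v p))" for X
  proof -
    have "cnj (ind X g) = ind X g" for g :: "pt perm" by (simp add: ind_def)
    then show ?thesis by (simp add: fun_eq_iff point.alg_def sum_cscale_apply point.rho_def)
  qed
  moreover have "(\<lambda>p. cnj (cscale c v p)) = cscale (cnj c) (\<lambda>p. cnj (v p))" for c
    by (simp add: cscale_def)
  ultimately have "\<exists>c. point.alg (ind X) (\<lambda>p. cnj (v p)) = cscale c (\<lambda>p. cnj (v p))" if "X \<in> P" for X
    using Eig_eigenvalue[OF v that] by metis
  then show ?thesis using v
    by (auto simp: Eig_def fun_eq_iff simp flip: cnj_sum)
qed

lemma Eig_spanning:
  assumes "vsum t = 0" "t \<noteq> 0"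
  shows "\<exists>v\<in>Eig. ip v t \<noteq> 0"
proof -
  let ?S = "{v. vsum v = 0}"
  have "\<exists>B. finite B \<and> B \<subseteq> ?S \<and> cfun.independent B \<and> ?S \<subseteq> cspan B \<and>
    (\<forall>b\<in>B. \<forall>L\<in>(\<lambda>X. point.alg (ind X)) ` P. \<exists>c. L b = cscale c b)"
  proof (rule simultaneous_diagonalization)
    show "clinear_op L" if "L \<in> (\<lambda>X. point.alg (ind X)) ` P" for L
      using that point.clinear_alg by auto
    show "L (M u) = M (L u)" if "L \<in> (\<lambda>X. point.alg (ind X)) ` P" "M \<in> (\<lambda>X. point.alg (ind X)) ` P" for L M u
      using that commute by (auto simp flip: point.alg_conv)
    show "\<exists>M\<in>(\<lambda>X. point.alg (ind X)) ` P. \<forall>u v. ip (L u) v = ip u (M v)"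
      if "L \<in> (\<lambda>X. point.alg (ind X)) ` P" for L
      using that inverse_block by (auto simp: point.ip_alg star_ind)
    show "cfun.subspace ?S"
      by (auto simp: cfun.subspace_def cscale_def sum.distrib sum_distrib_left[symmetric])
    show "L u \<in> ?S" if "L \<in> (\<lambda>X. point.alg (ind X)) ` P" "u \<in> ?S" for L u
      using that vsum_alg by auto
  qed (use finite_P in auto)
  then obtain B where B: "B \<subseteq> ?S" "cfun.independent B" "?S \<subseteq> cspan B"
    and eig: "\<forall>b\<in>B. \<forall>L\<in>(\<lambda>X. point.alg (ind X)) ` P. \<exists>c. L b = cscale c b" by (elim exE conjE)
  have "B \<subseteq> Eig"
  proof
    fix b assume b: "b \<in> B"
    then have "b \<noteq> 0" using B(2) cfun.dependent_zero by auto
    then show "b \<in> Eig" using b B(1) eig by (auto simp: Eig_def)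
  qed
  show ?thesis
  proof (rule ccontr)
    assume "\<not> ?thesis"
    then have orth: "ip t b = 0" if "b \<in> B" for b
      using that \<open>B \<subseteq> Eig\<close> ip_eq_0_commute[of b t] by auto
    have "ip t u = 0" if "u \<in> cspan B" for u
      using that by (induction rule: cfun.span_induct_alt) (simp_all only: ip_add_right ip_scale_right orth ip_zero_right mult_zero_right add_0)
    then have "ip t t = 0" using assms(1) B(3) by blast
    then show False using assms(2) by simp
  qed
qed

lemma block_const_sum:
  assumes "block_const H"
  shows "\<exists>c. H = (\<Sum>X\<in>P. cscale (c X) (ind X))"
proof (intro exI ext)
  fix g
  define c where "c X = H (SOME g. g \<in> X)" for X
  have "g \<in> \<Union>P" using part by (simp add: partition_on_def)
  then obtain X where X: "X \<in> P" "g \<in> X" by blast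
  have "(SOME g. g \<in> X) \<in> X" using X(2) by (rule someI)
  then have "H g = c X" using assms X unfolding block_const_def c_def by blast
  moreover have "(\<Sum>Y\<in>P. cscale (c Y) (ind Y)) g = (\<Sum>Y\<in>P. if Y = X then c X else 0)"
    unfolding sum_cscale_apply using X by (intro sum.cong) (auto simp: ind_block)
  ultimately show "H g = (\<Sum>X\<in>P. cscale (H (SOME g. g \<in> X)) (ind X)) g"
    using X(1) finite_P by (simp add: c_def)
qed

lemma alg_block_const_eigen:
  assumes "block_const H" "v \<in> Eig"
  shows "\<exists>c. point.alg H v = cscale c v"
proof -
  obtain c where c: "H = (\<Sum>X\<in>P. cscale (c X) (ind X))" using block_const_sum[OF assms(1)] ..
  have "\<exists>d. \<forall>X\<in>P. point.alg (ind X) v = cscale (d X) v"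
    using Eig_eigenvalue[OF assms(2)] by metis
  then obtain d where "\<And>X. X \<in> P \<Longrightarrow> point.alg (ind X) v = cscale (d X) v" by blast
  then have "point.alg H v = (\<Sum>X\<in>P. cscale (c X * d X) v)"
    unfolding c point.alg_sum by (intro sum.cong refl) (simp add: point.alg_scale)
  then show ?thesis by (auto simp flip: cfun.scale_sum_left)
qed

lemma alg_block_const_commute:
  assumes "block_const H" "X \<in> P"
  shows "point.alg (ind X) (point.alg H v) = point.alg H (point.alg (ind X) v)"
proof -
  obtain c where c: "H = (\<Sum>X\<in>P. cscale (c X) (ind X))" using block_const_sum[OF assms(1)] ..
  have "point.alg (ind X) (point.alg (ind Y) v) = point.alg (ind Y) (point.alg (ind X) v)" if "Y \<in> P" for Y
    using commute[OF assms(2) that] by (simp flip: point.alg_conv)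
  then show ?thesis
    unfolding c point.alg_sum by (simp only: clinear_opD[OF point.clinear_alg] point.alg_scale cong: sum.cong)
qed

text \<open>Multiplying this function by the sum of a block, on the left or on the right, multiplies it by the
  eigenvalue of the block at \<open>v\<close>. So it commutes with all block sums.\<close>

lemma block_const_mcoef:
  assumes v: "v \<in> Eig"
  shows "block_const (mcoef v)"
proof (rule block_const_of_commuting)
  show "star (mcoef v) = mcoef v"
    by (simp add: fun_eq_iff star_def mcoef_ip cnj_ip point.ip_rho)
next
  fix X assume X: "X \<in> P"
  obtain l where l: "point.alg (ind X) v = cscale l v" using Eig_eigenvalue[OF v X] ..
  obtain m where m: "point.alg (star (ind X)) v = cscale m v"
    using Eig_eigenvalue[OF v inverse_block[OF X]] by (auto simp: star_ind)
  have "cnj l * ip v v = m * ip v v"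
    using point.ip_alg[of "ind X" v v] by (simp add: l m ip_scale_left ip_scale_right)
  then have lm: "cnj m = l" using EigD(1)[OF v] by auto
  have left: "conv (ind X) (mcoef v) g = l * mcoef v g" for g
  proof -
    have "conv (ind X) (mcoef v) g = ip v (point.rho (inverse g) (point.alg (ind X) v))"
      by (simp add: conv_def mcoef_ip point.alg_def clinear_opD[OF point.clinear_rho] ip_sum_right
          ip_scale_right point.rho_mult)
    then show ?thesis by (simp add: l clinear_opD[OF point.clinear_rho] ip_scale_right mcoef_ip)
  qed
  have right: "conv (mcoef v) (ind X) g = l * mcoef v g" for g
  proof -
    have "conv (mcoef v) (ind X) g = (\<Sum>h\<in>UNIV. ind X h * ip (point.rho (inverse h) v) (point.rho (inverse g) v))"
      by (simp add: conv_alt mcoef_ip point.rho_mult point.ip_rho mult.commute)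
    also have "\<dots> = (\<Sum>h\<in>UNIV. cnj (star (ind X) (inverse h)) * ip (point.rho (inverse h) v) (point.rho (inverse g) v))"
      by (simp add: star_def)
    also have "\<dots> = (\<Sum>h\<in>UNIV. cnj (star (ind X) h) * ip (point.rho h v) (point.rho (inverse g) v))"
      by (rule sum_perm_inverse)
    also have "\<dots> = ip (point.alg (star (ind X)) v) (point.rho (inverse g) v)"
      by (simp add: point.alg_def point.ip_sum_left ip_scale_left)
    finally show ?thesis by (simp add: m ip_scale_left lm mcoef_ip)
  qed
  show "conv (ind X) (mcoef v) = conv (mcoef v) (ind X)"
    by (simp add: fun_eq_iff left right)
qed

lemma ip_alg_point:
  "ip w (point.alg H u) = (\<Sum>g\<in>UNIV. H g * (\<Sum>p\<in>UNIV. cnj (w (g $ p)) * u p))"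
proof -
  have "ip w (point.rho g u) = (\<Sum>p\<in>UNIV. cnj (w (g $ p)) * u p)" for g
    using sum_apply[of "\<lambda>p. cnj (w p) * u (inverse g $ p)" g] by (simp add: ip_def point.rho_def)
  then show ?thesis by (simp add: point.alg_def ip_sum_right ip_scale_right)
qed

text \<open>The element \<open>mcoef v\<close> acts on vectors of sum zero as \<open>144\<close> times \<open>w \<mapsto> ip v w * v\<close>. Since \<open>w\<close> is an eigenvector of all
  functions that are constant on blocks, \<open>ip v w * v\<close> is a multiple of \<open>w\<close>.\<close>

lemma Eig_orthogonal_or_parallel:
  assumes v: "v \<in> Eig" and w: "w \<in> Eig" and "ip v w \<noteq> 0"
  shows "\<exists>c. c \<noteq> 0 \<and> w = cscale c v"
proof -
  obtain c where c: "point.alg (mcoef v) w = cscale c w"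
    using alg_block_const_eigen[OF block_const_mcoef[OF v] w] ..
  have "cscale c w = cscale (144 * ip v w) v"
  proof (rule vsum_zero_ext)
    show "vsum (cscale c w) = 0" "vsum (cscale (144 * ip v w) v) = 0"
      using EigD(2)[OF v] EigD(2)[OF w] by (simp_all add: cscale_def flip: sum_distrib_left)
    fix u assume u: "vsum u = 0"
    have "ip u (cscale c w) = 144 * (\<Sum>a\<in>UNIV. v a * cnj (u a)) * (\<Sum>a\<in>UNIV. cnj (v a) * w a)"
      unfolding c[symmetric] ip_alg_point mcoef_def
      by (rule average_pair) (use u EigD(2)[OF v] in \<open>simp_all flip: cnj_sum\<close>)
    then show "ip u (cscale c w) = ip u (cscale (144 * ip v w) v)"
      by (simp only: ip_scale_right) (simp add: ip_def mult_ac)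
  qed
  moreover from this have "c \<noteq> 0"
    using assms(3) EigD(1)[OF v] by (auto simp: cfun.scale_eq_0_iff)
  ultimately have "w = cscale (144 * ip v w / c) v"
    by (intro cscale_divide)
  then show ?thesis using assms(3) \<open>c \<noteq> 0\<close> by (intro exI[of _ "144 * ip v w / c"]) simp
qed

text \<open>The pointwise product of the coefficient functions of \<open>v\<close> and \<open>w\<close> is constant on blocks, and by
  \<open>average_triple\<close> it acts on vectors of sum zero as a multiple of \<open>u \<mapsto> ip y u * y\<close>. The block sums commute with this
  operator of rank one, so \<open>y\<close> is an eigenvector of each of them.\<close>

lemma Eig_centered_product:
  fixes v w :: "pt \<Rightarrow> complex"
  assumes v: "v \<in> Eig" and w: "w \<in> Eig"
  defines "y \<equiv> (\<lambda>p. v p * w p - vsum (\<lambda>p. v p * w p) / 6)"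
  assumes "y \<noteq> 0"
  shows "y \<in> Eig"
proof -
  define H where "H g = mcoef v g * mcoef w g" for g
  have H: "block_const H"
    using block_const_mcoef[OF v] block_const_mcoef[OF w] unfolding block_const_def H_def by metis
  have y0: "vsum y = 0" by (simp add: y_def sum_subtractf card_pt)
  have cy: "ip u (\<lambda>p. v p * w p) = ip u y" if "vsum u = 0" for u
  proof -
    define m where "m = vsum (\<lambda>p. v p * w p) / 6"
    have "ip u y = ip u (\<lambda>p. v p * w p) - (\<Sum>p\<in>UNIV. cnj (u p)) * m"
      unfolding ip_def y_def m_def[symmetric] sum_distrib_right sum_subtractf[symmetric]
      by (intro sum.cong refl) (simp add: algebra_simps)
    then show ?thesis using that by (simp flip: cnj_sum)
  qed
  have act: "point.alg H u = cscale (216 * ip y u) y" if u: "vsum u = 0" for u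
  proof (rule vsum_zero_ext)
    show "vsum (point.alg H u) = 0" using vsum_alg[OF u] .
    show "vsum (cscale (216 * ip y u) y) = 0" using y0 by (simp add: cscale_def flip: sum_distrib_left)
    fix t assume t: "vsum t = 0"
    have "ip t (point.alg H u) = 216 * (\<Sum>a\<in>UNIV. v a * w a * cnj (t a)) * (\<Sum>a\<in>UNIV. cnj (v a) * cnj (w a) * u a)"
      unfolding ip_alg_point mcoef_def H_def
      by (rule average_triple) (use t u EigD(2)[OF v] EigD(2)[OF w] in \<open>simp_all flip: cnj_sum\<close>)
    also have "(\<Sum>a\<in>UNIV. v a * w a * cnj (t a)) = ip t y"
      using cy[OF t] by (simp add: ip_def mult_ac)
    also have "(\<Sum>a\<in>UNIV. cnj (v a) * cnj (w a) * u a) = cnj (ip u (\<lambda>p. v p * w p))"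
      by (simp add: ip_def mult_ac)
    also have "\<dots> = ip y u" by (simp add: cy[OF u] cnj_ip)
    finally show "ip t (point.alg H u) = ip t (cscale (216 * ip y u) y)"
      by (simp only: ip_scale_right mult_ac)
  qed
  have "\<exists>c. point.alg (ind X) y = cscale c y" if X: "X \<in> P" for X
  proof -
    define k where "k = 216 * ip y y"
    have k: "k \<noteq> 0" using \<open>y \<noteq> 0\<close> by (simp add: k_def)
    have "cscale k (point.alg (ind X) y) = point.alg (ind X) (point.alg H y)"
      by (simp add: act[OF y0] k_def clinear_opD(2)[OF point.clinear_alg])
    also have "\<dots> = cscale (216 * ip y (point.alg (ind X) y)) y"
      by (simp add: alg_block_const_commute[OF H X] act[OF vsum_alg[OF y0]])
    finally have "point.alg (ind X) y = cscale (216 * ip y (point.alg (ind X) y) / k) y"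
      by (rule cscale_divide[OF k])
    then show ?thesis ..
  qed
  then show ?thesis using \<open>y \<noteq> 0\<close> y0 by (simp add: Eig_def)
qed

lemma block_const_fixed_points: "block_const (\<lambda>g. of_nat (card {p. g $ p = p}))"
proof -
  define F :: "pt perm \<Rightarrow> complex" where "F g = of_nat (card {p. g $ p = p})" for g
  have cf: "F (h * g) = F (g * h)" for g h
  proof -
    have "card {p. (h * g) $ p = p} = card {p. (g * h) $ p = p}"
      by (rule bij_betw_same_card[of "apply g"], rule bij_betwI[where g = "apply h"])
         (auto simp: apply_times)
    then show ?thesis by (simp add: F_def)
  qed
  have "block_const F"
  proof (rule block_const_of_commuting)
    have "{p. inverse g $ p = p} = {p. g $ p = p}" for g :: "pt perm"
      by (metis apply_inverse_apply)
    then show "star F = F" by (simp add: fun_eq_iff star_def F_def)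
    show "conv (ind X) F = conv F (ind X)" for X
    proof
      fix g
      show "conv (ind X) F g = conv F (ind X) g"
        by (subst conv_alt[of F], subst conv_def, intro sum.cong refl, subst cf, rule mult.commute)
    qed
  qed
  then show ?thesis unfolding F_def[abs_def] .
qed

text \<open>Compare the coefficients of \<open>x * y\<close> in the two products of the block sums.\<close>

lemma exchange:
  assumes "X \<in> P" "Y \<in> P" "x \<in> X" "y \<in> Y"
  shows "\<exists>x'\<in>X. \<exists>y'\<in>Y. x * y = y' * x'"
proof -
  have "conv (ind X) (ind Y) (x * y) = of_nat (card {h \<in> X. inverse h * (x * y) \<in> Y})"
    by (simp add: conv_def ind_def sum.inter_filter[symmetric] if_distrib[of "\<lambda>t. _ * t"] cong: if_cong)
       (simp add: sum.If_cases Int_def conj_commute)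
  moreover have "x \<in> {h \<in> X. inverse h * (x * y) \<in> Y}" using assms by simp
  then have "card {h \<in> X. inverse h * (x * y) \<in> Y} \<noteq> 0" by (intro card_gt_0_iff[THEN iffD2, THEN gr_implies_not0]) auto
  ultimately have "conv (ind X) (ind Y) (x * y) \<noteq> 0" by (simp only: of_nat_eq_0_iff not_False_eq_True)
  then have "conv (ind Y) (ind X) (x * y) \<noteq> 0"
    by (simp only: fun_cong[OF commute[OF assms(1,2)], symmetric] not_False_eq_True)
  then obtain h where "ind Y h * ind X (inverse h * (x * y)) \<noteq> 0"
    unfolding conv_def by (meson sum.not_neutral_contains_not_neutral)
  then have "h \<in> Y" "inverse h * (x * y) \<in> X" by (auto simp: ind_def split: if_splits)
  then show ?thesis by (intro bexI[of _ "inverse h * (x * y)"] bexI[of _ h]) simp_all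
qed

end

section \<open>Classification of the eigenvectors\<close>

text \<open>The indicator function of \<open>M\<close>, shifted to sum zero.\<close>

definition chi :: "pt set \<Rightarrow> pt \<Rightarrow> complex"
  where "chi M p = (if p \<in> M then 1 else 0) - of_nat (card M) / 6"

lemma sum_indicator_pt: "(\<Sum>p\<in>UNIV. if p \<in> M then c else 0) = of_nat (card M) * (c :: complex)" for M :: "pt set"
  by (simp add: sum.If_cases)

lemma card_proper_pt: "M \<noteq> {} \<Longrightarrow> M \<noteq> UNIV \<Longrightarrow> 0 < card M \<and> card M < 6" for M :: "pt set"
  using psubset_card_mono[of UNIV M] by (auto simp: card_pt card_gt_0_iff)

context commuting_partition
begin

lemma Eig_product:
  assumes "v \<in> Eig" "w \<in> Eig" "(\<Sum>p\<in>UNIV. v p * w p) = 0" "v p * w p \<noteq> 0"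
  shows "(\<lambda>p. v p * w p) \<in> Eig"
  using Eig_centered_product[OF assms(1,2)] assms(3,4) by (auto simp: fun_eq_iff)

lemma Eig_parallel:
  assumes "v \<in> Eig" "w \<in> Eig" "(\<Sum>p\<in>UNIV. cnj (v p) * w p) \<noteq> 0"
  shows "\<exists>c. c \<noteq> 0 \<and> (\<forall>p. w p = c * v p)"
  using Eig_orthogonal_or_parallel[OF assms(1,2)] assms(3) by (auto simp: ip_def cscale_def)

lemma Eig_parallel_cnj:
  assumes "v \<in> Eig" "w \<in> Eig" "(\<Sum>p\<in>UNIV. v p * w p) \<noteq> 0"
  shows "\<exists>c. c \<noteq> 0 \<and> (\<forall>p. w p = c * cnj (v p))"
  using Eig_parallel[OF Eig_cnj[OF assms(1)] assms(2)] assms(3) by simp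

lemma Eig_nonzero: "v \<in> Eig \<Longrightarrow> \<exists>p. v p \<noteq> 0"
  using EigD(1) by (auto simp: fun_eq_iff)

lemma chi_of_two_valued:
  assumes y: "y \<in> Eig" and M: "\<And>p. y p = (a - b) * (if p \<in> M then 1 else 0) + b"
  shows "chi M \<in> Eig" "M \<noteq> {}" "M \<noteq> UNIV" "\<And>p. y p = (a - b) * chi M p"
proof -
  have s: "(a - b) * of_nat (card M) + 6 * b = 0"
    using EigD(2)[OF y] by (simp add: M sum.distrib card_pt sum_indicator_pt flip: sum_distrib_left)
  have ab: "a \<noteq> b" using Eig_nonzero[OF y] s by (auto simp: M)
  have b: "b = - (a - b) * of_nat (card M) / 6" using s by (simp add: field_simps add_eq_0_iff)
  show ym: "y p = (a - b) * chi M p" for p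
    unfolding M chi_def by (subst (2) b) (simp add: field_simps)
  then have "chi M = cscale (1 / (a - b)) y" using ab by (simp add: cscale_def fun_eq_iff)
  then show "chi M \<in> Eig" using Eig_scale[OF y, of "1 / (a - b)"] ab by simp
  show "M \<noteq> {}" "M \<noteq> UNIV" using Eig_nonzero[OF y] s by (auto simp: M card_pt)
qed

text \<open>The squared modulus of \<open>v\<close>, shifted to sum zero, is a real member \<open>y\<close> of \<open>Eig\<close>. The shifted product of \<open>v\<close>
  and \<open>y\<close> is not orthogonal to \<open>v\<close>, hence proportional to it: \<open>v * y = c * v + m1\<close>. If \<open>m1 = 0\<close>,
  then \<open>y\<close> is constant on the support of \<open>v\<close> and off it. If \<open>m1 \<noteq> 0\<close>, then \<open>v\<close> is a multiple of \<open>y\<close>, and \<open>y\<close>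
  solves a quadratic equation. In both cases \<open>y\<close> takes two values.\<close>

lemma nonflat_eigenvector:
  assumes v: "v \<in> Eig" and nonflat: "\<not> (\<exists>r. \<forall>p. v p * cnj (v p) = r)"
  shows "\<exists>M. M \<noteq> {} \<and> M \<noteq> UNIV \<and> chi M \<in> Eig \<and>
    ((\<forall>p. v p \<noteq> 0 \<longleftrightarrow> p \<in> M) \<and> (\<exists>r. \<forall>p\<in>M. v p * cnj (v p) = r) \<or> (\<exists>c. \<forall>p. v p = c * chi M p))"
proof -
  define m where "m = (\<Sum>p\<in>UNIV. v p * cnj (v p)) / 6"
  define y where "y p = v p * cnj (v p) - m" for p
  have "y \<noteq> 0" using nonflat by (auto simp: y_def fun_eq_iff)
  then have y: "y \<in> Eig"
    using Eig_centered_product[OF v Eig_cnj[OF v]] by (simp add: y_def[abs_def] m_def)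
  have real: "cnj (y p) = y p" for p by (simp add: y_def m_def mult.commute)
  define m1 where "m1 = (\<Sum>p\<in>UNIV. v p * y p) / 6"
  define q where "q p = v p * y p - m1" for p
  have "(\<Sum>p\<in>UNIV. cnj (v p) * q p) = (\<Sum>p\<in>UNIV. (y p + m) * y p) - m1 * (\<Sum>p\<in>UNIV. cnj (v p))"
    unfolding sum_distrib_left sum_subtractf[symmetric]
    by (intro sum.cong refl) (simp add: q_def y_def algebra_simps)
  also have "\<dots> = (\<Sum>p\<in>UNIV. y p * y p) + m * vsum y"
    using EigD(2)[OF v] by (simp add: distrib_right sum.distrib sum_distrib_left flip: cnj_sum)
  also have "\<dots> = ip y y" using EigD(2)[OF y] by (simp add: ip_def real)
  finally have vq: "(\<Sum>p\<in>UNIV. cnj (v p) * q p) \<noteq> 0" using \<open>y \<noteq> 0\<close> by simp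
  then have "q \<noteq> 0" by auto
  then have "q \<in> Eig" using Eig_centered_product[OF v y] by (simp add: q_def[abs_def] m1_def)
  then obtain c where c: "c \<noteq> 0" "\<And>p. q p = c * v p" using Eig_parallel[OF v _ vq] by blast
  show ?thesis
  proof (cases "m1 = 0")
    case True
    define M where "M = {p. v p \<noteq> 0}"
    have yM: "y p = c" if "p \<in> M" for p
      using c(2)[of p] that True by (simp add: q_def M_def mult.commute)
    have ytwo: "y p = (c - - m) * (if p \<in> M then 1 else 0) + - m" for p
      using yM[of p] by (auto simp: M_def y_def)
    have "\<forall>p\<in>M. v p * cnj (v p) = c + m" using yM by (auto simp: y_def algebra_simps)
    then show ?thesis
      using chi_of_two_valued[OF y ytwo] by (intro exI[of _ M]) (auto simp: M_def)
  next
    case False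
    then have "(\<Sum>p\<in>UNIV. y p * v p) \<noteq> 0" by (simp add: m1_def mult.commute)
    then obtain d where d: "d \<noteq> 0" "\<And>p. v p = d * y p"
      using Eig_parallel_cnj[OF y v] by (auto simp: real)
    have "\<exists>p0 p1. y p0 \<noteq> y p1"
    proof (rule ccontr)
      assume "\<not> ?thesis"
      then have "\<And>p. y p = y P1" by blast
      then have "vsum y = (\<Sum>p\<in>(UNIV :: pt set). y P1)" by (intro sum.cong refl)
      then have "vsum y = 6 * y P1" by (simp add: card_pt)
      then show False using EigD(2)[OF y] \<open>\<And>p. y p = y P1\<close> Eig_nonzero[OF y] by auto
    qed
    then obtain p0 where p0: "\<exists>p1. y p0 \<noteq> y p1" by blast
    define M where "M = {p. y p = y p0}"
    have "y p = c - y p0" if "p \<notin> M" for p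
    proof -
      have eq: "d * (y p * y p) - m1 = c * (d * y p)" for p
        using c(2)[of p] d(2)[of p] by (simp add: q_def mult_ac)
      have "d * ((y p - y p0) * (y p + y p0 - c)) = 0"
        using eq[of p] eq[of p0] by (simp add: algebra_simps)
      then have "y p - y p0 = 0 \<or> y p + y p0 - c = 0" using d(1) by (simp only: mult_eq_0_iff simp_thms)
      then show ?thesis using that by (auto simp: M_def algebra_simps)
    qed
    then have two: "y p = (y p0 - (c - y p0)) * (if p \<in> M then 1 else 0) + (c - y p0)" for p
      by (auto simp: M_def)
    have "\<forall>p. v p = d * (y p0 - (c - y p0)) * chi M p"
    proof
      fix p
      show "v p = d * (y p0 - (c - y p0)) * chi M p"
        unfolding d(2)[of p] mult.assoc by (rule arg_cong[OF chi_of_two_valued(4)[OF y two]])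
    qed
    then show ?thesis using chi_of_two_valued(1-3)[OF y two] by (intro exI[of _ M]) auto
  qed
qed

lemma chi_nonzero: "M \<noteq> {} \<Longrightarrow> M \<noteq> UNIV \<Longrightarrow> chi M p \<noteq> 0"
proof -
  assume "M \<noteq> {}" "M \<noteq> UNIV"
  then have "card M \<noteq> 0" "card M \<noteq> 6" using card_proper_pt[of M] by auto
  then have "of_nat (card M) \<noteq> (of_nat 0 :: complex)" "of_nat (card M) \<noteq> (of_nat 6 :: complex)"
    by (simp_all only: of_nat_eq_iff not_False_eq_True)
  then show ?thesis by (auto simp: chi_def)
qed

text \<open>It suffices that \<open>v * chi M\<close> is a multiple of \<open>v\<close>, since \<open>chi M\<close> takes different values on the two parts. Suppose
  that \<open>w = v * chi M\<close> is orthogonal to \<open>v\<close>. Because \<open>chi M\<close> satisfies a quadratic equation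
  \<open>x\<^sup>2 = s * x + t\<close>, the member \<open>w * chi M\<close> of \<open>Eig\<close> equals \<open>s * w + t * v\<close>. It is not orthogonal to \<open>v\<close>,
  hence a multiple of \<open>v\<close>; and \<open>s \<noteq> 0\<close> since \<open>M\<close> does not have three points.\<close>

lemma supported_on_part:
  assumes x: "chi M \<in> Eig" and M: "M \<noteq> {}" "M \<noteq> UNIV" "card M \<noteq> 3"
    and v: "v \<in> Eig" and orth: "(\<Sum>p\<in>UNIV. v p * chi M p) = 0"
  shows "(\<forall>p\<in>M. v p = 0) \<or> (\<forall>p\<in>-M. v p = 0)"
proof -
  define a :: complex where "a = of_nat (card M) / 6"
  define s where "s = 1 - 2 * a"
  define t where "t = a * (1 - a)"
  have chi: "chi M p = (if p \<in> M then 1 else 0) - a" for p by (simp add: chi_def a_def)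
  have sq: "chi M p * chi M p = s * chi M p + t" for p
    by (simp add: chi s_def t_def algebra_simps)
  obtain p1 p2 where p12: "p1 \<in> M" "p2 \<notin> M" using M by blast
  have a01: "a \<noteq> 0" "1 - a \<noteq> 0"
    using chi_nonzero[OF M(1,2), of p1] chi_nonzero[OF M(1,2), of p2] p12 by (auto simp: chi)
  then have t: "t \<noteq> 0" by (simp add: t_def)
  have s: "s \<noteq> 0"
  proof
    assume "s = 0"
    then have "of_nat (card M) = (of_nat 3 :: complex)" by (simp add: s_def a_def)
    then show False using M(3) by (simp only: of_nat_eq_iff)
  qed
  obtain p0 where p0: "v p0 \<noteq> 0" using Eig_nonzero[OF v] by blast
  define w where "w p = v p * chi M p" for p
  have w: "w \<in> Eig"
    using Eig_product[OF v x orth, of p0] p0 chi_nonzero[OF M(1,2)] by (simp add: w_def[abs_def])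
  have "\<exists>k. \<forall>p. w p = k * v p"
  proof (cases "(\<Sum>p\<in>UNIV. cnj (v p) * w p) = 0")
    case False
    then show ?thesis using Eig_parallel[OF v w] by blast
  next
    case True
    have z: "w p * chi M p = s * w p + t * v p" for p
      using sq[of p] by (simp add: w_def mult.assoc) (simp add: algebra_simps)
    have "(\<Sum>p\<in>UNIV. w p * chi M p) = s * (\<Sum>p\<in>UNIV. v p * chi M p) + t * vsum v"
    proof -
      have "(\<Sum>p\<in>UNIV. w p * chi M p) = (\<Sum>p\<in>UNIV. s * w p + t * v p)" by (intro sum.cong refl z)
      then show ?thesis by (simp only: sum.distrib sum_distrib_left w_def)
    qed
    then have "(\<Sum>p\<in>UNIV. w p * chi M p) = 0" using orth EigD(2)[OF v] by simp
    then have zE: "(\<lambda>p. w p * chi M p) \<in> Eig"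
      using Eig_product[OF w x, of p0] p0 chi_nonzero[OF M(1,2)] by (simp add: w_def)
    have "(\<Sum>p\<in>UNIV. cnj (v p) * (w p * chi M p)) = s * (\<Sum>p\<in>UNIV. cnj (v p) * w p) + t * ip v v"
      by (simp add: z ip_def sum.distrib sum_distrib_left algebra_simps)
    then have "(\<Sum>p\<in>UNIV. cnj (v p) * (w p * chi M p)) \<noteq> 0"
      using True t EigD(1)[OF v] by simp
    then obtain k where "\<And>p. w p * chi M p = k * v p" using Eig_parallel[OF v zE] by blast
    then have "\<forall>p. w p = (k - t) / s * v p" using z s by (simp add: field_simps)
    then show ?thesis by blast
  qed
  then obtain k where "\<And>p. v p * chi M p = k * v p" by (auto simp: w_def)
  then have k: "v p = 0 \<or> chi M p = k" for p by (metis mult.commute mult_cancel_right)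
  show ?thesis
  proof (rule ccontr)
    assume "\<not> ?thesis"
    then obtain p q where "p \<in> M" "v p \<noteq> 0" "q \<notin> M" "v q \<noteq> 0" by blast
    then show False using k[of p] k[of q] by (auto simp: chi)
  qed
qed

section \<open>Systems of roots of unity\<close>

text \<open>On \<open>N\<close> the powers of \<open>u\<close> behave like the characters of a cyclic group of order \<open>d\<close>.\<close>

definition root_system :: "pt set \<Rightarrow> nat \<Rightarrow> (pt \<Rightarrow> complex) \<Rightarrow> bool"
  where "root_system N d u \<longleftrightarrow> 0 < d \<and> (\<forall>p\<in>-N. u p = 0) \<and> (\<forall>p\<in>N. u p ^ d = 1) \<and>
    (\<forall>k. 0 < k \<and> k < d \<longrightarrow> (\<lambda>p. u p ^ k) \<in> Eig)"

lemma root_system_power: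
  assumes "root_system N (d * e) u" "0 < e"
  shows "root_system N d (\<lambda>p. u p ^ e)"
  using assms unfolding root_system_def
  by (auto simp: power_mult[symmetric] mult.commute)

lemma geometric_sum_root:
  fixes z :: complex
  assumes "z ^ d = 1"
  shows "(\<Sum>k<d. z ^ k) = (if z = 1 then of_nat d else 0)"
  using assms by (simp add: sum_gp_strict)

lemma root_system_sum:
  assumes "root_system N d u" "0 < k" "k < d"
  shows "(\<Sum>p\<in>N. u p ^ k) = 0"
proof -
  have "(\<lambda>p. u p ^ k) \<in> Eig" using assms by (simp add: root_system_def)
  then have "(\<Sum>p\<in>UNIV. u p ^ k) = 0" by (rule EigD(2))
  moreover have "(\<Sum>p\<in>UNIV. u p ^ k) = (\<Sum>p\<in>N. u p ^ k)"
    using assms by (intro sum.mono_neutral_right) (auto simp: root_system_def)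
  ultimately show ?thesis by simp
qed

text \<open>Count with the geometric sum of \<open>u p / z\<close>, using that all power sums of \<open>u\<close> with exponent between 0 and \<open>d\<close>
  vanish.\<close>

lemma root_system_count:
  assumes u: "root_system N d u" and z: "z ^ d = 1"
  shows "d * card {p \<in> N. u p = z} = card N"
proof -
  have d: "0 < d" using u by (simp add: root_system_def)
  then have z0: "z \<noteq> 0" using z by (auto simp: power_0_left)
  have "(\<Sum>p\<in>N. \<Sum>k<d. (u p / z) ^ k) = (\<Sum>p\<in>N. if u p = z then of_nat d else 0)"
  proof (intro sum.cong refl)
    fix p assume "p \<in> N"
    then have "(u p / z) ^ d = 1" using u z by (simp add: root_system_def power_divide)
    then show "(\<Sum>k<d. (u p / z) ^ k) = (if u p = z then of_nat d else 0)"
      using geometric_sum_root[of "u p / z" d] z0 by simp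
  qed
  also have "\<dots> = of_nat (d * card {p \<in> N. u p = z})"
    by (simp add: sum.inter_filter[symmetric] mult.commute)
  finally have "of_nat (d * card {p \<in> N. u p = z}) = (\<Sum>p\<in>N. \<Sum>k<d. (u p / z) ^ k)" by simp
  also have "\<dots> = (\<Sum>k<d. (\<Sum>p\<in>N. u p ^ k) / z ^ k)"
    by (subst sum.swap) (simp add: power_divide sum_divide_distrib)
  also have "\<dots> = (\<Sum>k<d. if k = 0 then of_nat (card N) else 0)"
    by (intro sum.cong refl) (auto simp: root_system_sum[OF u])
  also have "\<dots> = of_nat (card N)" using d by simp
  finally show ?thesis by (simp only: of_nat_eq_iff)
qed

text \<open>Let \<open>d\<close> be the least positive exponent for which the power sum of \<open>u\<close> is nonzero. Some
  exponent up to \<open>card N\<close> has this property: otherwise the powers with exponents 0, \<open>\<dots>\<close>, \<open>card N\<close> would be orthogonal, too many for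
  functions on \<open>N\<close>. Below \<open>d\<close> all powers belong to \<open>Eig\<close>, and at \<open>d\<close> the vectors \<open>u\<close>
  and \<open>u ^ (d - 1)\<close> have a nonzero bilinear product, so \<open>u ^ (d - 1)\<close> is a multiple of the conjugate of \<open>u\<close>. The
  factor is 1 by the normalization at \<open>p0\<close>.\<close>

lemma flat_root_system:
  assumes u: "u \<in> Eig" and N: "\<And>p. p \<notin> N \<Longrightarrow> u p = 0" "\<And>p. p \<in> N \<Longrightarrow> u p * cnj (u p) = 1"
    and p0: "u p0 = 1"
  shows "\<exists>d>1. d dvd card N \<and> root_system N d u"
proof -
  have p0N: "p0 \<in> N" using N(1) p0 by force
  define S where "S k = (\<Sum>p\<in>N. u p ^ k)" for k
  have SU: "(\<Sum>p\<in>UNIV. u p ^ k) = S k" if "0 < k" for k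
    unfolding S_def using that N(1) by (intro sum.mono_neutral_right) auto
  have "\<exists>k. 0 < k \<and> k \<le> card N \<and> S k \<noteq> 0"
  proof (rule ccontr)
    assume "\<not> ?thesis"
    then have S0: "S k = 0" if "0 < k" "k \<le> card N" for k using that by blast
    define f where "f k p = (if p \<in> N then u p ^ k else 0)" for k p
    have "\<exists>c. (\<exists>k\<in>{..card N}. c k \<noteq> 0) \<and> (\<Sum>k\<le>card N. cscale (c k) (f k)) = 0"
    proof (rule exists_linear_relation)
      show "card (basis_elem ` N) < card {..card N}"
        using card_image_le[of N basis_elem] by (simp add: le_imp_less_Suc)
      have "f k = (\<Sum>p\<in>N. cscale (u p ^ k) (basis_elem p))" for k
        by (simp add: f_def fun_eq_iff sum_cscale_apply basis_elem_def if_distrib cong: if_cong)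
      moreover have "(\<Sum>p\<in>N. cscale (u p ^ k) (basis_elem p)) \<in> cspan (basis_elem ` N)" for k
        by (intro cfun.span_sum cfun.span_scale cfun.span_base imageI)
      ultimately have "f k \<in> cspan (basis_elem ` N)" for k by metis
      then show "f ` {..card N} \<subseteq> cspan (basis_elem ` N)" by blast
    qed auto
    then obtain c j where j: "j \<le> card N" "c j \<noteq> 0"
      and c: "(\<Sum>k\<le>card N. cscale (c k) (f k)) = 0" by auto
    have up: "cnj (u p) ^ i * u p ^ (i + k) = u p ^ k" if "p \<in> N" for p i k
    proof -
      have "cnj (u p) ^ i * u p ^ (i + k) = (u p * cnj (u p)) ^ i * u p ^ k"
        by (simp add: power_add power_mult_distrib mult_ac)
      then show ?thesis using N(2)[OF that] by simp
    qed
    have ipf: "ip (f i) (f k) = (if i = k then of_nat (card N) else 0)" if "i \<le> card N" "k \<le> card N" for i k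
    proof -
      have le: "ip (f i) (f (i + e)) = S e" for i e
      proof -
        have "ip (f i) (f (i + e)) = (\<Sum>p\<in>N. cnj (u p) ^ i * u p ^ (i + e))"
          unfolding ip_def f_def by (intro sum.mono_neutral_cong_right) auto
        then show ?thesis by (simp add: up S_def)
      qed
      have S00: "S 0 = of_nat (card N)" by (simp add: S_def)
      consider "i < k" | "i = k" | "k < i" by linarith
      then show ?thesis
      proof cases
        case 1
        then show ?thesis using le[of i "k - i"] S0[of "k - i"] that by simp
      next
        case 2
        then show ?thesis using le[of i 0] S00 by simp
      next
        case 3
        then have "ip (f k) (f i) = 0" using le[of k "i - k"] S0[of "i - k"] that by simp
        then show ?thesis using 3 ip_eq_0_commute[of "f k"] by simp
      qed
    qed
    have "0 = ip (f j) (\<Sum>k\<le>card N. cscale (c k) (f k))" by (simp only: c ip_zero_right)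
    also have "\<dots> = (\<Sum>k\<le>card N. if k = j then c j * of_nat (card N) else 0)"
      unfolding ip_sum_right by (intro sum.cong refl) (auto simp: ip_scale_right ipf j(1))
    also have "\<dots> = c j * of_nat (card N)" using j(1) by simp
    finally show False using j(2) p0N by auto
  qed
  then obtain k0 where k0: "0 < k0 \<and> S k0 \<noteq> 0" "k0 \<le> card N" by blast
  define d where "d = (LEAST k. 0 < k \<and> S k \<noteq> 0)"
  have "0 < d \<and> S d \<noteq> 0"
    unfolding d_def by (rule LeastI[where P = "\<lambda>k. 0 < k \<and> S k \<noteq> 0", OF k0(1)])
  then have d: "0 < d" "S d \<noteq> 0" by simp_all
  have least: "S k = 0" if "0 < k" "k < d" for k
    using not_less_Least[of k "\<lambda>k. 0 < k \<and> S k \<noteq> 0"] that unfolding d_def by blast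
  have "S 1 = 0" using SU[of 1] EigD(2)[OF u] by simp
  then have d1: "1 < d" using d by (metis One_nat_def Suc_lessI)
  have pow: "0 < k \<Longrightarrow> k < d \<Longrightarrow> (\<lambda>p. u p ^ k) \<in> Eig" for k
  proof (induction k)
    case (Suc k)
    show ?case
    proof (cases "k = 0")
      case False
      then have "(\<lambda>p. u p ^ k) \<in> Eig" using Suc by simp
      moreover have "(\<Sum>p\<in>UNIV. u p * u p ^ k) = 0" using SU[of "Suc k"] least[of "Suc k"] Suc.prems by simp
      ultimately show ?thesis using Eig_product[OF u, of _ p0] p0 by simp
    qed (use u in simp)
  qed simp
  have "(\<Sum>p\<in>UNIV. u p * u p ^ (d - 1)) \<noteq> 0"
    using d SU[of d] by (simp add: power_eq_if)
  then obtain c where c: "\<And>p. u p ^ (d - 1) = c * cnj (u p)"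
    using Eig_parallel_cnj[OF u pow[of "d - 1"]] d1 by auto
  have "c = 1" using c[of p0] p0 by simp
  have "u p ^ d = 1" if "p \<in> N" for p
    using c[of p] \<open>c = 1\<close> N(2)[OF that] d(1) by (simp add: power_eq_if mult.commute)
  then have rs: "root_system N d u" using d(1) N(1) pow by (simp add: root_system_def)
  have "d * card {p \<in> N. u p = 1} = card N" by (rule root_system_count[OF rs]) simp
  then have "d dvd card N" by (metis dvd_triv_left)
  then show ?thesis using d1 rs by blast
qed

lemma flat_root_system_scaled:
  assumes v: "v \<in> Eig" and N: "\<And>p. v p \<noteq> 0 \<longleftrightarrow> p \<in> N" "\<And>p. p \<in> N \<Longrightarrow> v p * cnj (v p) = r"
    and p0: "p0 \<in> N"
  shows "\<exists>d>1. d dvd card N \<and> root_system N d (\<lambda>p. v p / v p0)"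
proof (rule flat_root_system)
  have v0: "v p0 \<noteq> 0" using N(1) p0 by simp
  show "(\<lambda>p. v p / v p0) \<in> Eig"
    using Eig_scale[OF v, of "1 / v p0"] v0 by (simp add: cscale_def)
  show "v p / v p0 = 0" if "p \<notin> N" for p using N(1) that by auto
  show "v p / v p0 * cnj (v p / v p0) = 1" if "p \<in> N" for p
    using N(2)[OF that] N(2)[OF p0] v0 by (metis (no_types, lifting) complex_cnj_divide complex_cnj_zero_iff
        divide_self_if mult_eq_0_iff times_divide_times_eq)
  show "v p0 / v p0 = 1" using v0 by simp
qed

lemma exists_separating:
  assumes "p \<noteq> q"
  shows "\<exists>v\<in>Eig. v p \<noteq> v q"
proof -
  define t :: "pt \<Rightarrow> complex" where "t r = (if r = p then 1 else 0) - (if r = q then 1 else 0)" for r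
  have "vsum t = 0" by (simp add: t_def sum_subtractf)
  moreover have "t p \<noteq> 0" using assms by (simp add: t_def)
  ultimately obtain v where v: "v \<in> Eig" "ip v t \<noteq> 0" using Eig_spanning[of t] by (auto simp: fun_eq_iff)
  have "ip v t = cnj (v p) - cnj (v q)"
  proof -
    have "cnj (v r) * t r = (if r = p then cnj (v p) else 0) - (if r = q then cnj (v q) else 0)" for r
      by (simp add: t_def)
    then show ?thesis by (simp add: ip_def sum_subtractf)
  qed
  then show ?thesis using v by auto
qed

text \<open>A member of \<open>Eig\<close> that separates two points of \<open>N\<close> is not a multiple of \<open>chi M\<close>, so it is supported
  on \<open>N\<close>. It has constant modulus on \<open>N\<close>: it is not flat on all six points, and the two-valued vector
  \<open>chi L\<close> that \<open>nonflat_eigenvector\<close> attaches to it vanishes nowhere, so it is parallel to \<open>chi M\<close> by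
  \<open>supported_on_part\<close>.\<close>

lemma two_part_structure:
  assumes x: "chi M \<in> Eig" and M: "M \<noteq> {}" "M \<noteq> UNIV" and big: "3 < card N" and N: "N = M \<or> N = - M"
  shows "\<exists>u d. 1 < d \<and> d dvd card N \<and> root_system N d u"
proof -
  have cM: "card M \<noteq> 3"
    using N big by (auto simp: Compl_eq_Diff_UNIV card_Diff_subset card_pt)
  have N': "N \<noteq> {}" "N \<noteq> UNIV" using M N by auto
  have "\<exists>p\<in>N. \<exists>q\<in>N. p \<noteq> q"
  proof (rule ccontr)
    assume "\<not> ?thesis"
    then have "card N \<le> 1" by (simp add: card_le_Suc0_iff_eq)
    then show False using big by simp
  qed
  then obtain p0 q0 where pq: "p0 \<in> N" "q0 \<in> N" "p0 \<noteq> q0" by blast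
  then obtain v where v: "v \<in> Eig" "v p0 \<noteq> v q0" using exists_separating by blast
  have chiN: "chi M p0 = chi M q0" using pq N by (auto simp: chi_def)
  have orth: "(\<Sum>p\<in>UNIV. v p * chi M p) = 0"
  proof (rule ccontr)
    assume "\<not> ?thesis"
    then obtain c where "\<And>p. chi M p = c * cnj (v p)" "c \<noteq> 0" using Eig_parallel_cnj[OF v(1) x] by blast
    then show False using chiN v(2) by simp
  qed
  have off: "v p = 0" if "p \<notin> N" for p
    using supported_on_part[OF x M cM v(1) orth] N pq v(2) that by fastforce
  have nonflat: "\<not> (\<exists>r. \<forall>p. v p * cnj (v p) = r)"
  proof
    assume "\<exists>r. \<forall>p. v p * cnj (v p) = r"
    then obtain r where r: "\<And>p. v p * cnj (v p) = r" by blast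
    obtain q where "q \<notin> N" using N' by blast
    then have "r = 0" using r[of q] off[of q] by simp
    then show False using r Eig_nonzero[OF v(1)] by simp
  qed
  obtain L where L: "L \<noteq> {}" "L \<noteq> UNIV" "chi L \<in> Eig"
    "(\<forall>p. v p \<noteq> 0 \<longleftrightarrow> p \<in> L) \<and> (\<exists>r. \<forall>p\<in>L. v p * cnj (v p) = r) \<or> (\<exists>c. \<forall>p. v p = c * chi L p)"
    using nonflat_eigenvector[OF v(1) nonflat] by blast
  have "\<not> (\<exists>c. \<forall>p. v p = c * chi L p)"
  proof
    assume "\<exists>c. \<forall>p. v p = c * chi L p"
    then obtain c where c: "\<And>p. v p = c * chi L p" by blast
    obtain q where "q \<notin> N" using N' by blast
    then have "c = 0" using c[of q] off[of q] chi_nonzero[OF L(1,2)] by simp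
    then show False using c Eig_nonzero[OF v(1)] by simp
  qed
  then obtain r where supp: "\<And>p. v p \<noteq> 0 \<longleftrightarrow> p \<in> L" and r: "\<And>p. p \<in> L \<Longrightarrow> v p * cnj (v p) = r"
    using L(4) by blast
  have "(\<Sum>p\<in>UNIV. chi L p * chi M p) \<noteq> 0"
  proof
    assume "(\<Sum>p\<in>UNIV. chi L p * chi M p) = 0"
    from supported_on_part[OF x M cM L(3) this] show False
      using chi_nonzero[OF L(1,2)] M by blast
  qed
  then obtain c where c: "\<And>p. chi M p = c * cnj (chi L p)" "c \<noteq> 0"
    using Eig_parallel_cnj[OF L(3) x] by blast
  have "L = N"
  proof -
    have LN: "L \<subseteq> N" using off supp by blast
    obtain l where l: "l \<in> L" using L(1) by blast
    have "p \<in> L" if "p \<in> N" for p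
    proof -
      have "chi M p = chi M l" using that l LN N by (auto simp: chi_def)
      then have "chi L p = chi L l" using c by simp
      then show ?thesis using l by (auto simp: chi_def split: if_splits)
    qed
    then show ?thesis using LN by blast
  qed
  then show ?thesis
    using flat_root_system_scaled[OF v(1), of N r p0] supp r pq(1) by blast
qed

text \<open>As in \<open>root_system_count\<close>, with the product of two geometric sums.\<close>

lemma mixed_root_count:
  assumes u: "root_system UNIV d u" and v: "root_system UNIV e v" and ab: "a ^ d = 1" "b ^ e = 1"
    and mixed: "\<And>i j. 0 < i \<Longrightarrow> i < d \<Longrightarrow> 0 < j \<Longrightarrow> j < e \<Longrightarrow> (\<Sum>p\<in>UNIV. u p ^ i * v p ^ j) = 0"
  shows "d * e * card {p. u p = a \<and> v p = b} = 6"
proof -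
  have de: "0 < d" "0 < e" using u v by (auto simp: root_system_def)
  then have ab0: "a \<noteq> 0" "b \<noteq> 0" using ab by (auto simp: power_0_left)
  have "(\<Sum>p\<in>UNIV. (\<Sum>i<d. (u p / a) ^ i) * (\<Sum>j<e. (v p / b) ^ j)) =
     (\<Sum>p\<in>UNIV. if u p = a \<and> v p = b then of_nat (d * e) else 0)"
  proof (intro sum.cong refl)
    fix p
    have "(u p / a) ^ d = 1" "(v p / b) ^ e = 1"
      using u v ab by (simp_all add: root_system_def power_divide)
    then show "(\<Sum>i<d. (u p / a) ^ i) * (\<Sum>j<e. (v p / b) ^ j) = (if u p = a \<and> v p = b then of_nat (d * e) else 0)"
      using geometric_sum_root[of "u p / a" d] geometric_sum_root[of "v p / b" e] ab0 by simp
  qed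
  also have "\<dots> = of_nat (d * e * card {p. u p = a \<and> v p = b})"
    by (simp add: sum.If_cases mult_ac)
  finally have "of_nat (d * e * card {p. u p = a \<and> v p = b}) =
      (\<Sum>p\<in>UNIV. (\<Sum>i<d. (u p / a) ^ i) * (\<Sum>j<e. (v p / b) ^ j))" by simp
  also have "\<dots> = (\<Sum>p\<in>UNIV. \<Sum>i<d. \<Sum>j<e. u p ^ i * v p ^ j / (a ^ i * b ^ j))"
    by (simp add: sum_product power_divide)
  also have "\<dots> = (\<Sum>i<d. \<Sum>p\<in>UNIV. \<Sum>j<e. u p ^ i * v p ^ j / (a ^ i * b ^ j))"
    by (rule sum.swap)
  also have "\<dots> = (\<Sum>i<d. \<Sum>j<e. \<Sum>p\<in>UNIV. u p ^ i * v p ^ j / (a ^ i * b ^ j))"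
    by (intro sum.cong refl sum.swap)
  also have "\<dots> = (\<Sum>i<d. \<Sum>j<e. if i = 0 then if j = 0 then 6 else 0 else 0)"
  proof (intro sum.cong refl)
    fix i j assume "i \<in> {..<d}" "j \<in> {..<e}"
    then have ij: "i < d" "j < e" by auto
    have "(\<Sum>p\<in>UNIV. u p ^ i * v p ^ j / (a ^ i * b ^ j)) = (\<Sum>p\<in>UNIV. u p ^ i * v p ^ j) / (a ^ i * b ^ j)"
      by (simp add: sum_divide_distrib)
    also have "(\<Sum>p\<in>UNIV. u p ^ i * v p ^ j) = (if i = 0 then if j = 0 then 6 else 0 else 0)"
      using mixed[of i j] root_system_sum[OF u, of i] root_system_sum[OF v, of j] ij by (auto simp: card_pt)
    finally show "(\<Sum>p\<in>UNIV. u p ^ i * v p ^ j / (a ^ i * b ^ j)) = (if i = 0 then if j = 0 then 6 else 0 else 0)"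
      by simp
  qed
  also have "\<dots> = (\<Sum>i<d. if i = 0 then 6 else 0)" using de by (intro sum.cong refl) auto
  also have "\<dots> = of_nat 6" using de by simp
  finally show ?thesis by (simp only: of_nat_eq_iff)
qed

end

section \<open>Products that cannot be exchanged\<close>

definition moves :: "(pt \<Rightarrow> pt \<Rightarrow> bool) \<Rightarrow> table \<Rightarrow> pt \<Rightarrow> bool"
  where "moves R t p = R p (look t p)"

definition move_count :: "table \<Rightarrow> (pt \<Rightarrow> pt \<Rightarrow> bool) \<Rightarrow> nat"
  where "move_count t R = length (filter (moves R t) pts)"

text \<open>For each relation \<open>R\<close> of a list, the number of points \<open>p\<close> that are related by \<open>R\<close> to their
  image.\<close>

definition profile :: "(pt \<Rightarrow> pt \<Rightarrow> bool) list \<Rightarrow> table \<Rightarrow> nat list"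
  where "profile Rs t = map (move_count t) Rs"

definition has_profile :: "(pt \<Rightarrow> pt \<Rightarrow> bool) list \<Rightarrow> nat list \<Rightarrow> table \<Rightarrow> bool"
  where "has_profile Rs ns t = (profile Rs t = ns)"

definition table_mult :: "table \<Rightarrow> table \<Rightarrow> table"
  where "table_mult s t = Tab (look s (look t P1)) (look s (look t P2)) (look s (look t P3))
    (look s (look t P4)) (look s (look t P5)) (look s (look t P6))"

definition differs :: "table \<Rightarrow> table \<Rightarrow> table \<Rightarrow> bool"
  where "differs r s t = (table_mult s t \<noteq> r)"

definition no_right_factor :: "table \<Rightarrow> table list \<Rightarrow> table \<Rightarrow> bool"
  where "no_right_factor r ts s = list_all (differs r s) ts"

definition no_factorization :: "table \<Rightarrow> table list \<Rightarrow> table list \<Rightarrow> bool"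
  where "no_factorization r ss ts = list_all (no_right_factor r ts) ss"

text \<open>No \<open>x'\<close> with the profile of \<open>x\<close> and \<open>y'\<close> with the profile of \<open>y\<close> satisfy
  \<open>y' * x' = x * y\<close>.\<close>

definition incompatible :: "(pt \<Rightarrow> pt \<Rightarrow> bool) list \<Rightarrow> table \<Rightarrow> table \<Rightarrow> bool"
  where "incompatible Rs x y = no_factorization (table_mult x y)
    (filter (has_profile Rs (profile Rs y)) tabs) (filter (has_profile Rs (profile Rs x)) tabs)"

definition rel_fixed :: "pt \<Rightarrow> pt \<Rightarrow> bool"
  where "rel_fixed p q = (p = q)"

primrec third_index :: "pt \<Rightarrow> nat" where
  "third_index P1 = 0" | "third_index P2 = 0" | "third_index P3 = 0"
| "third_index P4 = 1" | "third_index P5 = 1" | "third_index P6 = 1"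

definition rel3_in :: "pt \<Rightarrow> pt \<Rightarrow> bool"
  where "rel3_in p q = (third_index p = 0 \<and> third_index q = 0)"

definition rel3_fixed :: "pt \<Rightarrow> pt \<Rightarrow> bool"
  where "rel3_fixed p q = (third_index p = 0 \<and> p = q)"

text \<open>In cycle notation, with \<open>P1\<close>, \<open>\<dots>\<close>, \<open>P6\<close> written as 1, \<open>\<dots>\<close>, 6, the permutations are \<open>(2 4 3 5)\<close> and \<open>(1 4 6)\<close>;
  the distinguished part is \<open>{1, 2, 3}\<close>.\<close>

lemma incompatible3:
  "incompatible [rel_fixed, rel3_in, rel3_fixed] (Tab P1 P4 P5 P3 P2 P6) (Tab P4 P2 P3 P6 P5 P1)"
  by code_simp

primrec index4 :: "pt \<Rightarrow> nat" where
  "index4 P1 = 0" | "index4 P2 = 0" | "index4 P3 = 1"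
| "index4 P4 = 2" | "index4 P5 = 1" | "index4 P6 = 2"

definition rel4_in :: "pt \<Rightarrow> pt \<Rightarrow> bool"
  where "rel4_in p q = (index4 p \<noteq> 0 \<and> index4 q \<noteq> 0)"

definition rel4_same :: "pt \<Rightarrow> pt \<Rightarrow> bool"
  where "rel4_same p q = (index4 p \<noteq> 0 \<and> index4 p = index4 q)"

text \<open>The permutations are \<open>(2 3 4)\<close> and \<open>(3 6)\<close>; the set \<open>{3, 4, 5, 6}\<close> is divided into
  \<open>{3, 5}\<close> and \<open>{4, 6}\<close>.\<close>

lemma incompatible4:
  "incompatible [rel_fixed, rel4_in, rel4_same] (Tab P1 P3 P4 P2 P5 P6) (Tab P1 P2 P6 P4 P5 P3)"
  by code_simp

primrec index5 :: "pt \<Rightarrow> nat" where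
  "index5 P1 = 0" | "index5 P2 = 1" | "index5 P3 = 2"
| "index5 P4 = 3" | "index5 P5 = 4" | "index5 P6 = 5"

definition rel5 :: "nat \<Rightarrow> pt \<Rightarrow> pt \<Rightarrow> bool"
  where "rel5 e p q = (index5 p \<noteq> 0 \<and> index5 q \<noteq> 0 \<and> (index5 p + e) mod 5 = index5 q mod 5)"

text \<open>The permutations are \<open>(5 6)\<close> and \<open>(3 4 5)\<close>; the points 2, \<open>\<dots>\<close>, 6 form a cyclic group
  of order 5, in which \<open>rel5 e\<close> describes the translation by \<open>e\<close>.\<close>

lemma incompatible5:
  "incompatible [rel_fixed, rel5 1, rel5 2] (Tab P1 P2 P3 P4 P6 P5) (Tab P1 P2 P4 P5 P3 P6)"
  by code_simp

primrec index2 :: "pt \<Rightarrow> nat" where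
  "index2 P1 = 0" | "index2 P2 = 1" | "index2 P3 = 0"
| "index2 P4 = 1" | "index2 P5 = 0" | "index2 P6 = 1"

primrec index3 :: "pt \<Rightarrow> nat" where
  "index3 P1 = 0" | "index3 P2 = 1" | "index3 P3 = 2"
| "index3 P4 = 0" | "index3 P5 = 1" | "index3 P6 = 2"

definition rel6_parity :: "pt \<Rightarrow> pt \<Rightarrow> bool"
  where "rel6_parity p q = (index2 p = index2 q)"

definition rel6_third :: "pt \<Rightarrow> pt \<Rightarrow> bool"
  where "rel6_third p q = (index3 p = index3 q)"

text \<open>The permutations are \<open>(2 4 6)\<close> and \<open>(1 4)\<close>; the points carry the structure of a product of
  cyclic groups of orders 2 and 3.\<close>

lemma incompatible6:
  "incompatible [rel_fixed, rel6_parity, rel6_third] (Tab P1 P4 P3 P6 P5 P2) (Tab P4 P2 P3 P1 P5 P6)"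
  by code_simp

section \<open>Movement counts that are constant on blocks\<close>

text \<open>This transports a configuration of eigenvectors to a standard position, where the computations
  were made.\<close>

lemma exists_colour_preserving_perm:
  fixes c c' :: "'a::finite \<Rightarrow> 'c"
  assumes "\<And>p. card {q. c q = c' p} = card {q. c' q = c' p}"
  shows "\<exists>t :: 'a perm. \<forall>p. c (t $ p) = c' p"
proof -
  have "\<exists>h. bij_betw h {q. c' q = c' p} {q. c q = c' p}" for p
    using assms[of p] by (intro finite_same_card_bij) auto
  then have "\<exists>h. \<forall>k\<in>range c'. bij_betw (h k) {q. c' q = k} {q. c q = k}"
    by (intro bchoice) auto
  then obtain h where h: "\<And>p. bij_betw (h (c' p)) {q. c' q = c' p} {q. c q = c' p}" by auto
  define f where "f p = h (c' p) p" for p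
  have c: "c (f p) = c' p" for p
    using bij_betwE[OF h[of p]] by (auto simp: f_def)
  have "inj f"
  proof (rule injI)
    fix p q assume eq: "f p = f q"
    then have "c' p = c' q" using c by metis
    then show "p = q" using eq bij_betw_imp_inj_on[OF h[of q]] by (auto simp: f_def inj_on_def)
  qed
  then have "bij f" by (simp add: bij_def finite_UNIV_inj_surj)
  then have "apply (Perm.Perm f) = f" by (subst Perm.Perm_inverse) auto
  then show ?thesis using c by (intro exI[of _ "Perm.Perm f"]) simp
qed

lemma move_count_tab: "move_count (tab g) R = card {p. R p (g $ p)}"
proof -
  have "distinct pts" by (simp add: pts_def)
  then show ?thesis
    by (simp add: move_count_def moves_def[abs_def] distinct_length_filter set_pts Int_def)
qed

lemma table_mult_tab: "table_mult (tab g) (tab h) = tab (g * h)"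
  by (simp add: table_mult_def tab_def[of "g * h"] apply_times)

context commuting_partition
begin

definition same_block :: "pt perm \<Rightarrow> pt perm \<Rightarrow> bool"
  where "same_block g h \<longleftrightarrow> (\<exists>X\<in>P. g \<in> X \<and> h \<in> X)"

lemma block_constD: "block_const F \<Longrightarrow> same_block g h \<Longrightarrow> F g = F h"
  by (auto simp: block_const_def same_block_def)

lemma same_block_exchange: "\<exists>x' y'. same_block x x' \<and> same_block y y' \<and> x * y = y' * x'"
proof -
  have "x \<in> \<Union>P" "y \<in> \<Union>P" using part by (simp_all add: partition_on_def)
  then obtain X Y where XY: "X \<in> P" "Y \<in> P" "x \<in> X" "y \<in> Y" by blast
  then show ?thesis using exchange[OF XY] unfolding same_block_def by blast
qed

text \<open>The permutation \<open>t\<close> carries the standard relations \<open>R\<close> to relations \<open>R'\<close> whose movement counts are constant on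
  the blocks. Conjugating \<open>x\<close> and \<open>y\<close> with \<open>t\<close> and exchanging the factors of their product yields factors with the
  profiles of \<open>x\<close> and \<open>y\<close>.\<close>

lemma incompatible_contradiction:
  assumes inc: "incompatible Rs (tab x) (tab y)"
    and R: "\<And>R. R \<in> set Rs \<Longrightarrow> \<exists>R'. (\<forall>p q. R p q \<longleftrightarrow> R' (t $ p) (t $ q)) \<and>
      (\<forall>g h. same_block g h \<longrightarrow> card {p. R' p (g $ p)} = card {p. R' p (h $ p)})"
  shows False
proof -
  define rel where "rel g = inverse t * g * t" for g
  have counts: "move_count (tab (rel g)) R = move_count (tab (rel h)) R" if R_in: "R \<in> set Rs" and gh: "same_block g h" for R g h
  proof -
    obtain R' where R': "\<And>p q. R p q \<longleftrightarrow> R' (t $ p) (t $ q)"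
      and eq: "card {p. R' p (g $ p)} = card {p. R' p (h $ p)}" using R[OF R_in] gh by blast
    have "card {p. R p (rel k $ p)} = card {p. R' p (k $ p)}" for k
      by (rule bij_betw_same_card[of "apply t"], rule bij_betwI[where g = "apply (inverse t)"])
         (auto simp: R' rel_def apply_times)
    then show ?thesis by (simp add: move_count_tab eq)
  qed
  obtain x' y' where x': "same_block (t * x * inverse t) x'" and y': "same_block (t * y * inverse t) y'"
    and eq: "(t * x * inverse t) * (t * y * inverse t) = y' * x'"
    using same_block_exchange by blast
  have rel_back: "rel (t * g * inverse t) = g" for g by (simp add: rel_def mult.assoc)
  have "profile Rs (tab (rel x')) = profile Rs (tab x)" "profile Rs (tab (rel y')) = profile Rs (tab y)"
    using counts[OF _ x'] counts[OF _ y'] by (simp_all add: profile_def rel_back)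
  then have "tab (rel x') \<in> set (filter (has_profile Rs (profile Rs (tab x))) tabs)"
      "tab (rel y') \<in> set (filter (has_profile Rs (profile Rs (tab y))) tabs)"
    using tab_in_tabs by (simp_all add: has_profile_def)
  then have "table_mult (tab (rel y')) (tab (rel x')) \<noteq> table_mult (tab x) (tab y)"
    using inc unfolding incompatible_def no_factorization_def no_right_factor_def differs_def list_all_iff by blast
  moreover have "rel y' * rel x' = rel (y' * x')" by (simp add: rel_def mult.assoc)
  moreover have "rel (y' * x') = x * y" unfolding eq[symmetric] by (simp add: rel_def mult.assoc)
  ultimately show False by (simp add: table_mult_tab)
qed

lemma same_block_fixed:
  assumes "same_block g h"
  shows "card {p. p = g $ p} = card {p. p = h $ p}"
proof -
  have "(of_nat (card {p. g $ p = p}) :: complex) = of_nat (card {p. h $ p = p})"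
    using block_constD[OF block_const_fixed_points assms] .
  then show ?thesis by (simp add: eq_commute)
qed

text \<open>Up to a constant this number is the coefficient function of \<open>chi N\<close>.\<close>

lemma same_block_overlap:
  assumes N: "chi N \<in> Eig \<or> N = UNIV" and gh: "same_block g h"
  shows "card {p \<in> N. g $ p \<in> N} = card {p \<in> N. h $ p \<in> N}"
proof (cases "N = UNIV")
  case False
  have coef: "mcoef (chi N) g = of_nat (card {p \<in> N. g $ p \<in> N}) - of_nat (card N) * of_nat (card N) / 6" for g
  proof -
    define a :: complex where "a = of_nat (card N) / 6"
    have "mcoef (chi N) g = (\<Sum>p\<in>UNIV. (if p \<in> {p \<in> N. g $ p \<in> N} then 1 else 0)
       - (if p \<in> N then a else 0) - (if g $ p \<in> N then a else 0) + a * a)"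
      unfolding mcoef_def
      by (intro sum.cong refl) (auto simp: chi_def a_def algebra_simps)
    also have "\<dots> = of_nat (card {p \<in> N. g $ p \<in> N}) - of_nat (card N) * a
       - (\<Sum>p\<in>UNIV. if g $ p \<in> N then a else 0) + 6 * (a * a)"
      by (simp only: sum.distrib sum_subtractf sum_indicator_pt) (simp add: card_pt)
    also have "(\<Sum>p\<in>UNIV. if g $ p \<in> N then a else 0) = of_nat (card N) * a"
      using sum_apply[of "\<lambda>p. if p \<in> N then a else 0" g] by (simp add: sum_indicator_pt)
    finally show ?thesis by (simp add: a_def)
  qed
  then have "(of_nat (card {p \<in> N. g $ p \<in> N}) :: complex) = of_nat (card {p \<in> N. h $ p \<in> N})"
    using block_constD[OF block_const_mcoef gh] N False by (metis diff_add_cancel)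
  then show ?thesis by simp
qed simp

text \<open>The condition on \<open>p\<close> is detected by the geometric sum of \<open>u (g p) * cnj (u p) / z\<close>. Its terms, summed over \<open>p\<close>, are
  multiples of the coefficient functions of the powers of \<open>u\<close>; the term with exponent 0 is the number in
  \<open>same_block_overlap\<close>.\<close>

lemma same_block_ratio:
  assumes N: "chi N \<in> Eig \<or> N = UNIV" and u: "root_system N d u" and z: "z ^ d = 1" and gh: "same_block g h"
  shows "card {p \<in> N. g $ p \<in> N \<and> u (g $ p) = z * u p} = card {p \<in> N. h $ p \<in> N \<and> u (h $ p) = z * u p}"
proof -
  have d: "0 < d" using u by (simp add: root_system_def)
  then have z0: "z \<noteq> 0" using z by (auto simp: power_0_left)
  define T where "T g k = (if k = 0 then of_nat (card {p \<in> N. g $ p \<in> N}) else mcoef (\<lambda>p. u p ^ k) g)" for g k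
  have T: "T g k = T h k" if "k < d" for k
  proof (cases "k = 0")
    case True
    then show ?thesis using same_block_overlap[OF N gh] by (simp add: T_def)
  next
    case False
    then have "(\<lambda>p. u p ^ k) \<in> Eig" using u that by (simp add: root_system_def)
    then show ?thesis using block_constD[OF block_const_mcoef gh] False by (simp add: T_def)
  qed
  have count: "(\<Sum>k<d. T g k / z ^ k) = of_nat (d * card {p \<in> N. g $ p \<in> N \<and> u (g $ p) = z * u p})" for g
  proof -
    define A where "A = {p \<in> N. g $ p \<in> N}"
    have Tk: "T g k = (\<Sum>p\<in>A. (u (g $ p) * cnj (u p)) ^ k)" for k
    proof (cases "k = 0")
      case False
      then have "mcoef (\<lambda>p. u p ^ k) g = (\<Sum>p\<in>A. (u (g $ p) * cnj (u p)) ^ k)"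
        unfolding mcoef_def A_def using u
        by (intro sum.mono_neutral_cong_right) (auto simp: root_system_def power_mult_distrib)
      then show ?thesis using False by (simp add: T_def)
    qed (simp add: T_def A_def)
    have inner: "(\<Sum>k<d. (u (g $ p) * cnj (u p) / z) ^ k) = (if u (g $ p) = z * u p then of_nat d else 0)" if p: "p \<in> A" for p
    proof -
      have r: "u p ^ d = 1" "u (g $ p) ^ d = 1" using p u by (auto simp: A_def root_system_def)
      have "cmod (u p) ^ d = 1" using r(1) by (metis norm_one norm_power)
      then have "cmod (u p) = 1" using d using power_eq_imp_eq_base[of "cmod (u p)" d 1] by simp
      then have up: "u p * cnj (u p) = 1" by (simp add: complex_norm_square[symmetric])
      then have "(cnj (u p)) ^ d = 1" using r(1) by (metis complex_cnj_one complex_cnj_power)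
      then have "(u (g $ p) * cnj (u p) / z) ^ d = 1"
        using r z by (simp add: power_mult_distrib power_divide)
      moreover have "u (g $ p) * cnj (u p) / z = 1 \<longleftrightarrow> u (g $ p) = z * u p"
      proof
        assume "u (g $ p) * cnj (u p) / z = 1"
        then have "u (g $ p) * cnj (u p) = z" using z0 by (simp add: field_simps)
        then have "u (g $ p) * (u p * cnj (u p)) = z * u p" by (metis mult.assoc mult.commute)
        then show "u (g $ p) = z * u p" by (simp add: up)
      next
        assume "u (g $ p) = z * u p"
        then show "u (g $ p) * cnj (u p) / z = 1" using z0 up by (simp add: mult.assoc)
      qed
      ultimately show ?thesis using geometric_sum_root[of "u (g $ p) * cnj (u p) / z" d] by simp
    qed
    have "(\<Sum>k<d. T g k / z ^ k) = (\<Sum>p\<in>A. \<Sum>k<d. (u (g $ p) * cnj (u p) / z) ^ k)"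
      unfolding Tk by (subst sum.swap) (simp add: sum_divide_distrib power_divide)
    also have "\<dots> = (\<Sum>p\<in>A. if u (g $ p) = z * u p then of_nat d else 0)"
      by (intro sum.cong refl inner)
    also have "\<dots> = of_nat (d * card {p \<in> A. u (g $ p) = z * u p})"
      by (simp add: sum.inter_filter[symmetric] mult.commute)
    also have "{p \<in> A. u (g $ p) = z * u p} = {p \<in> N. g $ p \<in> N \<and> u (g $ p) = z * u p}"
      by (auto simp: A_def)
    finally show ?thesis .
  qed
  have "(\<Sum>k<d. T g k / z ^ k) = (\<Sum>k<d. T h k / z ^ k)" using T by (intro sum.cong refl) simp
  then have "(of_nat (d * card {p \<in> N. g $ p \<in> N \<and> u (g $ p) = z * u p}) :: complex)
     = of_nat (d * card {p \<in> N. h $ p \<in> N \<and> u (h $ p) = z * u p})"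
    unfolding count .
  then show ?thesis using d by (simp only: of_nat_eq_iff mult_cancel1) simp
qed

lemma root_system_inj:
  assumes "root_system N (card N) u" "p \<in> N" "q \<in> N" "u p = u q"
  shows "p = q"
proof -
  have "card N * card {r \<in> N. u r = u p} = card N"
    using root_system_count[OF assms(1), of "u p"] assms(1,2) by (simp add: root_system_def)
  moreover have "card N \<noteq> 0" using assms(2) by auto
  ultimately have "card {r \<in> N. u r = u p} = 1" by simp
  then show ?thesis using card_le_Suc0_iff_eq[of "{r \<in> N. u r = u p}"] assms by auto
qed

section \<open>Excluding the four configurations\<close>

text \<open>The values of \<open>u\<close> on \<open>M\<close> are different, so the movement counts include the number of fixed
  points in \<open>M\<close>.\<close>

lemma no_structure3:
  assumes M: "card M = 3" "chi M \<in> Eig" and u: "root_system M 3 u"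
  shows False
proof -
  have "card {q. (q \<in> M) = (third_index p = 0)} = card {q. (third_index q = 0) = (third_index p = 0)}" for p
  proof -
    have "third_index q = 0 \<longleftrightarrow> q \<in> {P1, P2, P3}" for q
      by (cases q) simp_all
    moreover have "third_index q \<noteq> 0 \<longleftrightarrow> q \<in> {P4, P5, P6}" for q
      by (cases q) simp_all
    ultimately have "{q. third_index q = 0} = {P1, P2, P3}" "{q. third_index q \<noteq> 0} = {P4, P5, P6}"
      by (auto simp del: insert_iff)
    moreover have "card (- M) = 3" using M(1) by (simp add: Compl_eq_Diff_UNIV card_Diff_subset card_pt)
    moreover have "{q. q \<notin> M} = - M" by auto
    ultimately show ?thesis using M(1) by (cases "third_index p = 0") simp_all
  qed
  from exists_colour_preserving_perm[of "\<lambda>q. q \<in> M" "\<lambda>q. third_index q = 0", OF this]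
  obtain t :: "pt perm" where t: "\<And>p. t $ p \<in> M \<longleftrightarrow> third_index p = 0" by auto
  obtain x where x: "tab x = Tab P1 P4 P5 P3 P2 P6" using distinct_entriesD[of "Tab P1 P4 P5 P3 P2 P6"] by auto
  obtain y where y: "tab y = Tab P4 P2 P3 P6 P5 P1" using distinct_entriesD[of "Tab P4 P2 P3 P6 P5 P1"] by auto
  show False
  proof (rule incompatible_contradiction)
    show "incompatible [rel_fixed, rel3_in, rel3_fixed] (tab x) (tab y)"
      unfolding x y by (rule incompatible3)
    fix R assume "R \<in> set [rel_fixed, rel3_in, rel3_fixed]"
    then consider "R = rel_fixed" | "R = rel3_in" | "R = rel3_fixed" by auto
    then show "\<exists>R'. (\<forall>p q. R p q \<longleftrightarrow> R' (t $ p) (t $ q)) \<and>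
      (\<forall>g h. same_block g h \<longrightarrow> card {p. R' p (g $ p)} = card {p. R' p (h $ p)})"
    proof cases
      case 1
      then show ?thesis
        using same_block_fixed by (intro exI[of _ "(=)"]) (auto simp: rel_fixed_def apply_inj)
    next
      case 2
      then show ?thesis
        using same_block_overlap[of M] M(2)
        by (intro exI[of _ "\<lambda>p q. p \<in> M \<and> q \<in> M"]) (auto simp: rel3_in_def t)
    next
      case 3
      have "{p. p \<in> M \<and> p = g $ p} = {p \<in> M. g $ p \<in> M \<and> u (g $ p) = 1 * u p}" for g
        using root_system_inj[of M u] u M(1) by (auto simp: M(1))
      then show ?thesis
        using same_block_ratio[of M 3 u 1] M(2) u 3
        by (intro exI[of _ "\<lambda>p q. p \<in> M \<and> p = q"]) (auto simp: rel3_fixed_def t apply_inj)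
    qed
  qed
qed

lemma no_structure4:
  assumes N: "card N = 4" "chi N \<in> Eig" and u: "root_system N 2 u"
  shows False
proof -
  define c' :: "pt \<Rightarrow> complex" where "c' p = (if index4 p = 0 then 0 else if index4 p = 1 then 1 else -1)" for p
  have off: "u p = 0 \<longleftrightarrow> p \<notin> N" for p using u by (auto simp: root_system_def)
  have count: "card {p. u p = z} = 2" if "z ^ 2 = 1" for z
  proof -
    have "z \<noteq> 0" using that by auto
    then have "{p. u p = z} = {p \<in> N. u p = z}" using off by auto
    then show ?thesis using root_system_count[OF u that] N(1) by simp
  qed
  have "{q. u q = 0} = - N" using off by auto
  then have count0: "card {q. u q = 0} = 2"
    using N(1) by (simp add: Compl_eq_Diff_UNIV card_Diff_subset card_pt)
  have "card {q. u q = c' p} = card {q. c' q = c' p}" for p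
  proof -
    have "c' q = 0 \<longleftrightarrow> q \<in> {P1, P2}" for q by (cases q) (simp_all add: c'_def)
    moreover have "c' q = 1 \<longleftrightarrow> q \<in> {P3, P5}" for q by (cases q) (simp_all add: c'_def)
    moreover have "c' q = -1 \<longleftrightarrow> q \<in> {P4, P6}" for q by (cases q) (simp_all add: c'_def)
    ultimately have sets: "{q. c' q = 0} = {P1, P2}" "{q. c' q = 1} = {P3, P5}" "{q. c' q = -1} = {P4, P6}"
      by blast+
    consider "c' p = 0" | "c' p = 1" | "c' p = -1" by (cases p) (simp_all add: c'_def)
    then show ?thesis
    proof cases
      case 1
      show ?thesis unfolding 1 sets count0 by simp
    next
      case 2
      have "card {q. u q = 1} = 2" by (rule count) simp
      then show ?thesis unfolding 2 sets by simp
    next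
      case 3
      have "card {q. u q = -1} = 2" by (rule count) simp
      then show ?thesis unfolding 3 sets by simp
    qed
  qed
  from exists_colour_preserving_perm[OF this]
  obtain t :: "pt perm" where t: "\<And>p. u (t $ p) = c' p" by auto
  have tN: "t $ p \<in> N \<longleftrightarrow> index4 p \<noteq> 0" for p using off[of "t $ p"] by (auto simp: t c'_def split: if_splits)
  obtain x where x: "tab x = Tab P1 P3 P4 P2 P5 P6" using distinct_entriesD[of "Tab P1 P3 P4 P2 P5 P6"] by auto
  obtain y where y: "tab y = Tab P1 P2 P6 P4 P5 P3" using distinct_entriesD[of "Tab P1 P2 P6 P4 P5 P3"] by auto
  show False
  proof (rule incompatible_contradiction)
    show "incompatible [rel_fixed, rel4_in, rel4_same] (tab x) (tab y)"
      unfolding x y by (rule incompatible4)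
    fix R assume "R \<in> set [rel_fixed, rel4_in, rel4_same]"
    then consider "R = rel_fixed" | "R = rel4_in" | "R = rel4_same" by auto
    then show "\<exists>R'. (\<forall>p q. R p q \<longleftrightarrow> R' (t $ p) (t $ q)) \<and>
      (\<forall>g h. same_block g h \<longrightarrow> card {p. R' p (g $ p)} = card {p. R' p (h $ p)})"
    proof cases
      case 1
      then show ?thesis
        using same_block_fixed by (intro exI[of _ "(=)"]) (auto simp: rel_fixed_def apply_inj)
    next
      case 2
      then show ?thesis
        using same_block_overlap[of N] N(2)
        by (intro exI[of _ "\<lambda>p q. p \<in> N \<and> q \<in> N"]) (auto simp: rel4_in_def tN)
    next
      case 3
      have idx: "index4 p = 0 \<or> index4 p = 1 \<or> index4 p = 2" for p by (cases p) auto
      have "rel4_same p q \<longleftrightarrow> t $ p \<in> N \<and> t $ q \<in> N \<and> u (t $ q) = 1 * u (t $ p)" for p q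
        using idx[of p] idx[of q] by (auto simp: rel4_same_def tN t c'_def)
      then show ?thesis
        using same_block_ratio[of N 2 u 1] N(2) u 3
        by (intro exI[of _ "\<lambda>p q. p \<in> N \<and> q \<in> N \<and> u q = 1 * u p"]) simp
    qed
  qed
qed

lemma prime_root_power_eq:
  fixes z :: complex
  assumes "prime n" "z ^ n = 1" "z \<noteq> 1"
  shows "z ^ a = z ^ b \<longleftrightarrow> a mod n = b mod n"
proof -
  have n: "0 < n" using assms(1) by (simp add: prime_gt_0_nat)
  then have z0: "z \<noteq> 0" using assms(2) by (auto simp: power_0_left)
  have one: "z ^ k = 1 \<longleftrightarrow> n dvd k" for k
  proof
    assume k: "z ^ k = 1"
    show "n dvd k"
    proof (rule ccontr)
      assume nk: "\<not> n dvd k"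
      then have "k \<noteq> 0" by (metis dvd_0_right)
      then obtain x y where xy: "k * x = n * y + gcd k n" using bezout_nat by blast
      have "gcd k n = 1" using nk prime_imp_coprime[OF assms(1) nk] by (metis coprime_iff_gcd_eq_1 gcd.commute)
      then have "z ^ (k * x) = z ^ (n * y) * z" using xy by simp
      then show False using k assms(2,3) by (simp add: power_mult)
    qed
  qed (use assms(2) in \<open>auto simp: power_mult\<close>)
  have main: "z ^ a = z ^ b \<longleftrightarrow> a mod n = b mod n" if "a \<le> b" for a b
  proof -
    have "z ^ b = z ^ a * z ^ (b - a)" using that by (simp flip: power_add)
    then have "z ^ a = z ^ b \<longleftrightarrow> z ^ (b - a) = 1" using z0 by auto
    also have "\<dots> \<longleftrightarrow> a mod n = b mod n"
      unfolding one using mod_eq_dvd_iff_nat[OF that, of n] by auto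
    finally show ?thesis .
  qed
  show ?thesis using main[of a b] main[of b a] by (cases "a \<le> b") auto
qed

lemma root_system_nontrivial_value:
  assumes u: "root_system N d u" and d: "1 < d" "d \<le> card N"
  shows "\<exists>p\<in>N. u p \<noteq> 1"
proof (rule ccontr)
  assume "\<not> ?thesis"
  then have "{p \<in> N. u p = 1} = N" by auto
  then have "d * card N = card N" using root_system_count[OF u, of 1] by simp
  then show False using d by auto
qed

lemma no_structure5:
  assumes N: "card N = 5" "chi N \<in> Eig" and u: "root_system N 5 u"
  shows False
proof -
  obtain p1 where p1: "p1 \<in> N" "u p1 \<noteq> 1" using root_system_nontrivial_value[OF u] N(1) by auto
  define z where "z = u p1"
  have z: "z ^ 5 = 1" "z \<noteq> 1" using p1 u by (auto simp: z_def root_system_def)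
  have zpow: "z ^ a = z ^ b \<longleftrightarrow> a mod 5 = b mod 5" for a b
    by (rule prime_root_power_eq[OF _ z]) simp
  have z0: "z \<noteq> 0" using z by auto
  define c' where "c' p = (if index5 p = 0 then 0 else z ^ index5 p)" for p
  have c'eq: "c' q = c' p \<longleftrightarrow> q = p" for p q
    using z0 by (cases p; cases q) (simp_all add: c'_def zpow del: power_Suc power_one_right power_Suc0_right)
  have off: "u p = 0 \<longleftrightarrow> p \<notin> N" for p using u by (auto simp: root_system_def)
  have count: "card {p. u p = w} = 1" if "w ^ 5 = 1" for w
  proof -
    have "w \<noteq> 0" using that by auto
    then have "{p. u p = w} = {p \<in> N. u p = w}" using off by auto
    then show ?thesis using root_system_count[OF u that] N(1) by simp
  qed
  have "{q. u q = 0} = - N" using off by auto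
  then have count0: "card {q. u q = 0} = 1"
    using N(1) by (simp add: Compl_eq_Diff_UNIV card_Diff_subset card_pt)
  have "card {q. u q = c' p} = card {q. c' q = c' p}" for p
  proof -
    have "(z ^ k) ^ 5 = 1" for k using z(1) by (metis power_commutes power_mult power_one mult.commute)
    then have "card {q. u q = c' p} = 1" by (cases "index5 p = 0") (simp_all add: c'_def count count0)
    then show ?thesis by (simp add: c'eq)
  qed
  from exists_colour_preserving_perm[OF this]
  obtain t :: "pt perm" where t: "\<And>p. u (t $ p) = c' p" by auto
  have tN: "t $ p \<in> N \<longleftrightarrow> index5 p \<noteq> 0" for p using off[of "t $ p"] z0 by (auto simp: t c'_def split: if_splits)
  have rel5: "rel5 e p q \<longleftrightarrow> t $ p \<in> N \<and> t $ q \<in> N \<and> u (t $ q) = z ^ e * u (t $ p)" for e p q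
    using zpow[of "index5 q" "e + index5 p"]
    by (auto simp: rel5_def tN t c'_def power_add add.commute)
  have zz: "(z ^ e) ^ 5 = 1" for e using z(1) by (metis power_commutes power_mult power_one mult.commute)
  obtain x where x: "tab x = Tab P1 P2 P3 P4 P6 P5" using distinct_entriesD[of "Tab P1 P2 P3 P4 P6 P5"] by auto
  obtain y where y: "tab y = Tab P1 P2 P4 P5 P3 P6" using distinct_entriesD[of "Tab P1 P2 P4 P5 P3 P6"] by auto
  show False
  proof (rule incompatible_contradiction)
    show "incompatible [rel_fixed, rel5 1, rel5 2] (tab x) (tab y)"
      unfolding x y by (rule incompatible5)
    fix R assume "R \<in> set [rel_fixed, rel5 1, rel5 2]"
    then consider "R = rel_fixed" | e where "R = rel5 e" by auto
    then show "\<exists>R'. (\<forall>p q. R p q \<longleftrightarrow> R' (t $ p) (t $ q)) \<and>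
      (\<forall>g h. same_block g h \<longrightarrow> card {p. R' p (g $ p)} = card {p. R' p (h $ p)})"
    proof cases
      case 1
      then show ?thesis
        using same_block_fixed by (intro exI[of _ "(=)"]) (auto simp: rel_fixed_def apply_inj)
    next
      case 2
      then show ?thesis
        using same_block_ratio[of N 5 u "z ^ e"] N(2) u zz
        by (intro exI[of _ "\<lambda>p q. p \<in> N \<and> q \<in> N \<and> u q = z ^ e * u p"]) (simp add: rel5)
    qed
  qed
qed

text \<open>The vectors \<open>e\<close> and \<open>w\<close> together identify the six points with pairs of a square root and a cube root of unity: every pair
  occurs once because the mixed power sums vanish. A mixed sum that does not vanish would make a power of
  \<open>w\<close> proportional to \<open>e\<close>, and its cube shows that \<open>e\<close> would be constant.\<close>

lemma no_structure6:
  assumes e: "root_system UNIV 2 e" and w: "root_system UNIV 3 w"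
  shows False
proof -
  obtain p1 where p1: "w p1 \<noteq> 1" using root_system_nontrivial_value[OF w] by (auto simp: card_pt)
  define z where "z = w p1"
  have z: "z ^ 3 = 1" "z \<noteq> 1" using p1 w by (auto simp: z_def root_system_def)
  have zpow: "z ^ a = z ^ b \<longleftrightarrow> a mod 3 = b mod 3" for a b
    by (rule prime_root_power_eq[OF _ z]) simp
  have e2: "e p * e p = 1" for p using e by (simp add: root_system_def power2_eq_square)
  have e_cases: "e p = 1 \<or> e p = -1" for p using e2[of p] by (simp add: square_eq_1_iff)
  have eE: "e \<in> Eig" using e by (auto simp: root_system_def dest: spec[of _ 1])
  have mixed: "(\<Sum>p\<in>UNIV. e p ^ i * w p ^ j) = 0" if "0 < i" "i < 2" "0 < j" "j < 3" for i j
  proof (rule ccontr)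
    assume nz: "(\<Sum>p\<in>UNIV. e p ^ i * w p ^ j) \<noteq> 0"
    have i: "i = 1" using that by simp
    have "(\<lambda>p. w p ^ j) \<in> Eig" using w that by (simp add: root_system_def)
    then obtain c where c: "\<And>p. w p ^ j = c * cnj (e p)"
      using Eig_parallel_cnj[OF eE, of "\<lambda>p. w p ^ j"] nz i by auto
    have "c ^ 3 * e p = 1" for p
    proof -
      have "(w p ^ j) ^ 3 = 1" using w by (simp add: root_system_def flip: power_mult) (metis mult.commute power_mult power_one)
      moreover have "(c * cnj (e p)) ^ 3 = c ^ 3 * e p" using e_cases[of p] by (auto simp: power_mult_distrib)
      ultimately show ?thesis using c by metis
    qed
    then have ep: "e p = 1 / c ^ 3" for p by (metis mult.commute mult_eq_0_iff nonzero_mult_div_cancel_right zero_neq_one)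
    have "vsum e = 6 / c ^ 3" by (simp add: ep card_pt)
    then have "c = 0" using EigD(2)[OF eE] by simp
    then show False using \<open>\<And>p. c ^ 3 * e p = 1\<close> by simp
  qed
  have count: "card {p. e p = a \<and> w p = b} = 1" if "a ^ 2 = 1" "b ^ 3 = 1" for a b
    using mixed_root_count[OF e w that mixed] by simp
  define c' where "c' p = ((if index2 p = 0 then 1 else -1) :: complex, z ^ index3 p)" for p
  have c'eq: "c' q = c' p \<longleftrightarrow> q = p" for p q
    by (cases p; cases q) (simp_all add: c'_def zpow del: power_Suc power_0 power_one_right power_Suc0_right)
  have "card {q. (e q, w q) = c' p} = card {q. c' q = c' p}" for p
  proof -
    have "(z ^ k) ^ 3 = 1" for k using z(1) by (metis power_commutes power_mult power_one mult.commute)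
    then show ?thesis
      using count[of "fst (c' p)" "snd (c' p)"] by (simp add: c'eq) (simp add: c'_def)
  qed
  from exists_colour_preserving_perm[OF this]
  obtain t :: "pt perm" where t: "\<And>p. (e (t $ p), w (t $ p)) = c' p" by auto
  have te: "e (t $ p) = (if index2 p = 0 then 1 else -1)" and tw: "w (t $ p) = z ^ index3 p" for p
    using t[of p] by (simp_all add: c'_def)
  obtain x where x: "tab x = Tab P1 P4 P3 P6 P5 P2" using distinct_entriesD[of "Tab P1 P4 P3 P6 P5 P2"] by auto
  obtain y where y: "tab y = Tab P4 P2 P3 P1 P5 P6" using distinct_entriesD[of "Tab P4 P2 P3 P1 P5 P6"] by auto
  show False
  proof (rule incompatible_contradiction)
    show "incompatible [rel_fixed, rel6_parity, rel6_third] (tab x) (tab y)"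
      unfolding x y by (rule incompatible6)
    fix R assume "R \<in> set [rel_fixed, rel6_parity, rel6_third]"
    then consider "R = rel_fixed" | "R = rel6_parity" | "R = rel6_third" by auto
    then show "\<exists>R'. (\<forall>p q. R p q \<longleftrightarrow> R' (t $ p) (t $ q)) \<and>
      (\<forall>g h. same_block g h \<longrightarrow> card {p. R' p (g $ p)} = card {p. R' p (h $ p)})"
    proof cases
      case 1
      then show ?thesis
        using same_block_fixed by (intro exI[of _ "(=)"]) (auto simp: rel_fixed_def apply_inj)
    next
      case 2
      have idx: "index2 p = 0 \<or> index2 p = 1" for p by (cases p) auto
      have "rel6_parity p q \<longleftrightarrow> e (t $ q) = 1 * e (t $ p)" for p q
        using idx[of p] idx[of q] by (auto simp: rel6_parity_def te)
      then show ?thesis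
        using same_block_ratio[of UNIV 2 e 1] e 2
        by (intro exI[of _ "\<lambda>p q. e q = 1 * e p"]) simp
    next
      case 3
      have idx: "index3 p mod 3 = index3 p" for p by (cases p) auto
      have "rel6_third p q \<longleftrightarrow> w (t $ q) = 1 * w (t $ p)" for p q
        by (auto simp: rel6_third_def tw zpow idx)
      then show ?thesis
        using same_block_ratio[of UNIV 3 w 1] w 3
        by (intro exI[of _ "\<lambda>p q. w q = 1 * w p"]) simp
    qed
  qed
qed

end

context commuting_partition
begin

lemma flat_eigenvector_root_system:
  assumes flat: "\<And>v. v \<in> Eig \<Longrightarrow> \<exists>r. \<forall>p. v p * cnj (v p) = r" and v: "v \<in> Eig"
  shows "\<exists>d\<in>{2, 3, 6}. root_system UNIV d (\<lambda>p. v p / v P1)"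
proof -
  obtain r where r: "\<And>p. v p * cnj (v p) = r" using flat[OF v] by blast
  have "r \<noteq> 0" using r Eig_nonzero[OF v] by auto
  then have nz: "v p \<noteq> 0" for p using r[of p] by auto
  obtain d where d: "1 < d" "d dvd 6" "root_system UNIV d (\<lambda>p. v p / v P1)"
    using flat_root_system_scaled[OF v, of UNIV r P1] nz r by (auto simp: card_pt)
  have "d \<le> 6" using d(2) by (rule dvd_imp_le) simp
  then have "d = 2 \<or> d = 3 \<or> d = 4 \<or> d = 5 \<or> d = 6" using d(1) by auto
  then have "d \<in> {2, 3, 6}" using d(2) by auto
  then show ?thesis using d(3) by blast
qed

text \<open>Since \<open>v\<close> separates two points that \<open>u\<close> does not separate, no powers of the two with exponents below \<open>n\<close> are proportional, even after conjugation. Hence all mixed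
  power sums vanish, and each pair of values occurs \<open>6 / (n * n)\<close> times, which is not an integer.\<close>

lemma no_equal_prime_orders:
  assumes u: "root_system UNIV n u" and v: "root_system UNIV n v" and n: "n = 2 \<or> n = 3"
    and pq: "u p = u q" "v p \<noteq> v q"
  shows False
proof -
  have mixed: "(\<Sum>r\<in>UNIV. u r ^ i * v r ^ j) = 0" if "0 < i" "i < n" "0 < j" "j < n" for i j
  proof (rule ccontr)
    assume nz: "(\<Sum>r\<in>UNIV. u r ^ i * v r ^ j) \<noteq> 0"
    have "(\<lambda>r. u r ^ i) \<in> Eig" "(\<lambda>r. v r ^ j) \<in> Eig"
      using u v that by (simp_all add: root_system_def)
    then obtain c where c: "\<And>r. v r ^ j = c * cnj (u r ^ i)"
      using Eig_parallel_cnj[of "\<lambda>r. u r ^ i" "\<lambda>r. v r ^ j"] nz by blast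
    have eq: "v p ^ j = v q ^ j" using c[of p] c[of q] pq(1) by simp
    have "j = 1 \<or> (n = 3 \<and> j = 2)" using that n by auto
    then have "v p = v q"
    proof
      assume j: "n = 3 \<and> j = 2"
      have "v r = (v r ^ 2) ^ 2" for r
      proof -
        have "v r ^ 3 = 1" using v j by (simp add: root_system_def)
        then have "v r ^ 3 * v r = v r" by simp
        then show ?thesis by (simp add: power2_eq_square power3_eq_cube mult_ac)
      qed
      then show ?thesis using eq j by metis
    qed (use eq in simp)
    then show False using pq(2) by simp
  qed
  have "n * n * card {r. u r = 1 \<and> v r = 1} = 6"
    by (rule mixed_root_count[OF u v _ _ mixed]) simp_all
  then have "2 * 2 * card {r. u r = 1 \<and> v r = 1} = 6 \<or> 3 * 3 * card {r. u r = 1 \<and> v r = 1} = 6"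
    using n by blast
  then show False by presburger
qed

text \<open>Each member of \<open>Eig\<close>, scaled to 1 at \<open>P1\<close>, is a root system of order 2, 3 or 6 on all six points. Order 6 yields the
  configuration of \<open>no_structure6\<close> through its square and its cube. A system \<open>u\<close> of order 2 or 3 does not separate all
  points; a second system which separates two points with equal \<open>u\<close> has the other order.\<close>

lemma not_all_flat:
  assumes flat: "\<And>v. v \<in> Eig \<Longrightarrow> \<exists>r. \<forall>p. v p * cnj (v p) = r"
  shows False
proof -
  have second: "\<exists>v. (\<exists>d\<in>{2, 3, 6}. root_system UNIV d v) \<and> v p \<noteq> v q" if pq: "p \<noteq> q" for p q
  proof -
    obtain v where v: "v \<in> Eig" "v p \<noteq> v q" using exists_separating[OF pq] by blast
    obtain d where d: "d \<in> {2, 3, 6}" "root_system UNIV d (\<lambda>p. v p / v P1)"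
      using flat_eigenvector_root_system[OF flat v(1)] by blast
    have "v P1 \<noteq> 0" using d by (auto simp: root_system_def power_0_left)
    then show ?thesis using d v(2) by (intro exI[of _ "\<lambda>p. v p / v P1"]) auto
  qed
  have six: False if u: "root_system UNIV 6 u" for u
  proof (rule no_structure6)
    show "root_system UNIV 2 (\<lambda>p. u p ^ 3)" by (rule root_system_power) (use u in simp_all)
    show "root_system UNIV 3 (\<lambda>p. u p ^ 2)" by (rule root_system_power) (use u in simp_all)
  qed
  obtain u d where d: "d \<in> {2, 3, 6}" and u: "root_system UNIV d u" using second[of P1 P2] by blast
  have "d \<noteq> 6" using six u by blast
  then have d23: "d = 2 \<or> d = 3" using d by auto
  have "\<exists>q. q \<noteq> P1 \<and> u q = u P1"
  proof (rule ccontr)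
    assume "\<not> ?thesis"
    then have "{q \<in> UNIV. u q = u P1} = {P1}" by auto
    moreover have "d * card {q \<in> UNIV. u q = u P1} = card (UNIV :: pt set)"
      by (rule root_system_count[OF u]) (use u in \<open>simp add: root_system_def\<close>)
    ultimately show False using d23 by (auto simp: card_pt)
  qed
  then obtain q where q: "q \<noteq> P1" "u q = u P1" by blast
  obtain v e where e: "e \<in> {2, 3, 6}" and v: "root_system UNIV e v" and vq: "v q \<noteq> v P1"
    using second[OF q(1)] by blast
  have "e \<noteq> 6" using six v by blast
  then consider "e = d" | "e = 2" "d = 3" | "e = 3" "d = 2" using e d23 by auto
  then show False
  proof cases
    case 1
    then show False using no_equal_prime_orders[OF u _ d23 q(2) vq] v by simp
  next
    case 2
    then show False using no_structure6 u v by blast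
  next
    case 3
    then show False using no_structure6 u v by blast
  qed
qed

lemma chi_Compl: "chi (- M) p = - chi M p"
proof -
  have "card (- M) = 6 - card M" "card M \<le> 6"
    using card_mono[of "UNIV :: pt set" M] by (simp_all add: Compl_eq_Diff_UNIV card_Diff_subset card_pt)
  then show ?thesis by (auto simp: chi_def of_nat_diff field_simps)
qed

text \<open>A member of \<open>Eig\<close> whose modulus is not constant yields a set \<open>M\<close> with \<open>chi M \<in> Eig\<close>. Sets of three points lead to
  \<open>no_structure3\<close>; in all other cases \<open>M\<close> or its complement has four or five points and carries a root system.\<close>

theorem no_commuting_partition: False
proof (rule not_all_flat)
  fix v assume v: "v \<in> Eig"
  show "\<exists>r. \<forall>p. v p * cnj (v p) = r"
  proof (rule ccontr)
    assume nonflat: "\<not> ?thesis"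
    obtain M where M: "M \<noteq> {}" "M \<noteq> UNIV" "chi M \<in> Eig"
      and alt: "(\<forall>p. v p \<noteq> 0 \<longleftrightarrow> p \<in> M) \<and> (\<exists>r. \<forall>p\<in>M. v p * cnj (v p) = r) \<or> (\<exists>c. \<forall>p. v p = c * chi M p)"
      using nonflat_eigenvector[OF v nonflat] by blast
    show False
    proof (cases "card M = 3")
      case True
      have "\<not> (\<exists>c. \<forall>p. v p = c * chi M p)"
      proof
        assume "\<exists>c. \<forall>p. v p = c * chi M p"
        then obtain c where "\<And>p. v p = c * chi M p" by blast
        then have "v p * cnj (v p) = c * cnj c / 4" for p by (simp add: chi_def True)
        then show False using nonflat by blast
      qed
      then obtain r where supp: "\<And>p. v p \<noteq> 0 \<longleftrightarrow> p \<in> M" and r: "\<And>p. p \<in> M \<Longrightarrow> v p * cnj (v p) = r"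
        using alt by blast
      obtain p0 where p0: "p0 \<in> M" using M(1) by blast
      obtain d where d: "1 < d" "d dvd 3" "root_system M d (\<lambda>p. v p / v p0)"
        using flat_root_system_scaled[OF v supp r p0] True by auto
      have "d \<le> 3" using d(2) by (rule dvd_imp_le) simp
      then have "d = 2 \<or> d = 3" using d(1) by auto
      then have "d = 3" using d(2) by auto
      then show False using no_structure3[OF True M(3)] d(3) by blast
    next
      case False
      have c6: "card (- M) = 6 - card M" by (simp add: Compl_eq_Diff_UNIV card_Diff_subset card_pt)
      have cM: "0 < card M" "card M < 6" using card_proper_pt[OF M(1,2)] by auto
      obtain N where N: "N = M \<or> N = - M" "3 < card N" "card N < 6"
      proof (cases "3 < card M")
        case True
        then show ?thesis using that[of M] cM by simp
      next
        case False
        then show ?thesis using that[of "- M"] c6 cM \<open>card M \<noteq> 3\<close> by simp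
      qed
      have "chi (- M) = cscale (-1) (chi M)" by (simp add: fun_eq_iff cscale_def chi_Compl)
      then have chiN: "chi N \<in> Eig" using N(1) M(3) Eig_scale[OF M(3), of "-1"] by auto
      obtain u d where d: "1 < d" "d dvd card N" and u: "root_system N d u"
        using two_part_structure[OF M(3,1,2) N(2,1)] by blast
      have dle: "d \<le> card N" using d(2) N(2) by (intro dvd_imp_le) auto
      consider "card N = 4" | "card N = 5" using N by linarith
      then show False
      proof cases
        case 1
        have "d = 2 \<or> d = 3 \<or> d = 4" using d(1) dle 1 by auto
        then have "d = 2 \<or> d = 4" using d(2) 1 by auto
        then have "\<exists>a. root_system N 2 a"
          \<comment> \<open>For order 4 take the square.\<close>
          using u root_system_power[of N 2 2 u] by auto
        then show False using no_structure4[OF 1 chiN] by blast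
      next
        case 2
        have "d = 2 \<or> d = 3 \<or> d = 4 \<or> d = 5" using d(1) dle 2 by auto
        then have "d = 5" using d(2) 2 by auto
        then show False using no_structure5[OF 2 chiN] u by blast
      qed
    qed
  qed
qed

end

section \<open>Schur rings over the symmetric group\<close>

primrec pt_num :: "pt \<Rightarrow> nat" where
  "pt_num P1 = 1" | "pt_num P2 = 2" | "pt_num P3 = 3"
| "pt_num P4 = 4" | "pt_num P5 = 5" | "pt_num P6 = 6"

lemma bij_pt_num: "bij_betw pt_num UNIV {1..6}"
proof -
  have "inj pt_num"
  proof (rule injI)
    fix p q assume "pt_num p = pt_num q"
    then show "p = q" by (cases p; cases q) simp_all
  qed
  moreover have "range pt_num = {1..6}"
    by (simp add: UNIV_pt atLeastAtMost_def) (auto simp: eval_nat_numeral)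
  ultimately show ?thesis by (simp add: bij_betw_def)
qed

text \<open>The isomorphism from \<open>pt perm\<close> onto the group of permutations of \<open>{1..6}\<close>.\<close>

definition num_perm :: "pt perm \<Rightarrow> nat \<Rightarrow> nat"
  where "num_perm g n = (if n \<in> {1..6} then pt_num (g $ (inv_into UNIV pt_num n)) else n)"

lemma num_perm_pt_num [simp]: "num_perm g (pt_num p) = pt_num (g $ p)"
proof -
  have "pt_num p \<in> {1..6}" by (cases p) simp_all
  moreover have "inv_into UNIV pt_num (pt_num p) = p"
    using bij_pt_num by (simp add: bij_betw_def inv_into_f_f)
  ultimately show ?thesis by (simp add: num_perm_def)
qed

lemma num_perm_outside: "n \<notin> {1..6} \<Longrightarrow> num_perm g n = n"
  by (simp only: num_perm_def if_False)

lemma num_perm_eqI: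
  assumes "\<And>p. f (pt_num p) = g (pt_num p)" "\<And>n. n \<notin> {1..6} \<Longrightarrow> f n = g n"
  shows "f = (g :: nat \<Rightarrow> nat)"
proof
  fix n
  show "f n = g n"
  proof (cases "n \<in> {1..6}")
    case True
    then have "n \<in> range pt_num" using bij_pt_num by (simp only: bij_betw_def)
    then obtain p where "n = pt_num p" by blast
    then show ?thesis using assms(1) by simp
  qed (use assms(2) in simp)
qed

lemma num_perm_mult: "num_perm (g * h) = num_perm g \<circ> num_perm h"
  by (rule num_perm_eqI) (simp_all only: o_apply num_perm_pt_num num_perm_outside apply_times simp_thms)

lemma num_perm_1: "num_perm 1 = id"
  by (rule num_perm_eqI) (simp_all only: id_apply num_perm_pt_num num_perm_outside apply_one simp_thms)

lemma bij_num_perm: "bij_betw num_perm UNIV {p. p permutes {1..6}}"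
proof (rule bij_betw_imageI)
  have inj: "pt_num p = pt_num q \<longleftrightarrow> p = q" for p q
    using bij_pt_num by (auto simp: bij_betw_def inj_def)
  show "inj num_perm"
  proof (rule injI)
    fix g h assume "num_perm g = num_perm h"
    then have "pt_num (g $ p) = pt_num (h $ p)" for p by (metis num_perm_pt_num)
    then show "g = h" by (intro perm_eqI) (simp add: inj)
  qed
  show "range num_perm = {p. p permutes {1..6}}"
  proof (intro equalityI subsetI)
    fix f assume "f \<in> range num_perm"
    then obtain g where g: "f = num_perm g" by blast
    have "num_perm g \<circ> num_perm (inverse g) = id" "num_perm (inverse g) \<circ> num_perm g = id"
      by (simp_all add: num_perm_1 flip: num_perm_mult)
    then have "bij (num_perm g)" using o_bij by blast
    then show "f \<in> {p. p permutes {1..6}}"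
      unfolding g by (auto simp: permutes_def num_perm_def bij_iff)
  next
    fix f assume "f \<in> {p. p permutes {1..6::nat}}"
    then have f: "f permutes {1..6}" by simp
    define k where "k p = inv_into UNIV pt_num (f (pt_num p))" for p
    have k: "pt_num (k p) = f (pt_num p)" for p
    proof -
      have "pt_num p \<in> {1..6}" by (cases p) simp_all
      then have "f (pt_num p) \<in> range pt_num"
        using permutes_in_image[OF f] bij_pt_num by (simp add: bij_betw_def)
      then show ?thesis
        using bij_pt_num by (simp add: k_def bij_betw_def f_inv_into_f)
    qed
    have "inj k"
    proof (rule injI)
      fix p q assume "k p = k q"
      then have "f (pt_num p) = f (pt_num q)" using k by metis
      then have "pt_num p = pt_num q" by (rule injD[OF permutes_inj[OF f]])
      then show "p = q" by (simp only: inj)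
    qed
    then have "bij k" by (simp add: bij_def finite_UNIV_inj_surj)
    then have "apply (Perm.Perm k) = k" by (subst Perm.Perm_inverse) auto
    then have kf: "num_perm (Perm.Perm k) (pt_num p) = f (pt_num p)" for p by (simp add: k)
    have "num_perm (Perm.Perm k) = f"
      by (rule num_perm_eqI) (simp_all only: kf num_perm_outside permutes_not_in[OF f] simp_thms)
    then show "f \<in> range num_perm" by blast
  qed
qed

lemma set_sum_apply: "finite X \<Longrightarrow> set_sum X x = ind X x"
  by (simp add: set_sum_def sum_fun_apply basis_elem_def ind_def)

theorem corollary1p3:
  shows "\<not> (\<exists>A. schur_ring (sym_group 6) A \<and>
               (\<forall>a\<in>A. \<forall>b\<in>A. a \<otimes>\<^bsub>group_algebra (sym_group 6)\<^esub> b = b \<otimes>\<^bsub>group_algebra (sym_group 6)\<^esub> a) \<and>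
               cdim A = 76)"
proof
  let ?G = "sym_group 6"
  assume "\<exists>A. schur_ring ?G A \<and> (\<forall>a\<in>A. \<forall>b\<in>A. a \<otimes>\<^bsub>group_algebra ?G\<^esub> b = b \<otimes>\<^bsub>group_algebra ?G\<^esub> a) \<and> cdim A = 76"
  then obtain A Q where grp: "group ?G" and fin: "finite (carrier ?G)"
    and Q: "schur_partition ?G Q" and A: "A = cspan (set_sum ` Q)"
    and comm: "\<forall>a\<in>A. \<forall>b\<in>A. a \<otimes>\<^bsub>group_algebra ?G\<^esub> b = b \<otimes>\<^bsub>group_algebra ?G\<^esub> a"
    and dim: "cdim A = 76"
    unfolding schur_ring_def by blast
  interpret G: group ?G by (rule grp)
  have carrier: "carrier ?G = range num_perm"
    using bij_num_perm by (simp add: sym_group_def bij_betw_def)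
  have inj: "num_perm g = num_perm h \<longleftrightarrow> g = h" for g h
    using bij_num_perm by (auto simp: bij_betw_def inj_def)
  have mult: "num_perm g \<otimes>\<^bsub>?G\<^esub> num_perm h = num_perm (g * h)" for g h
    by (simp add: sym_group_mult num_perm_mult)
  have inv: "inv\<^bsub>?G\<^esub> (num_perm g) = num_perm (inverse g)" for g
  proof (rule G.inv_equality)
    show "num_perm (inverse g) \<otimes>\<^bsub>?G\<^esub> num_perm g = \<one>\<^bsub>?G\<^esub>"
      by (simp add: mult num_perm_1 sym_group_one)
  qed (simp_all add: carrier)
  have card_Q: "card Q = 76" using cdim_schur_ring[OF fin Q] dim by (simp add: A)
  have part: "\<Union>Q = range num_perm" "disjoint Q" "{} \<notin> Q"
    using Q by (auto simp: schur_partition_def partition_on_def carrier)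
  have sub: "X \<subseteq> range num_perm" if "X \<in> Q" for X using that part(1) by blast
  define pull where "pull X = num_perm -` X" for X
  have image_pull: "num_perm ` pull X = X" if "X \<in> Q" for X
    using sub[OF that] by (auto simp: pull_def)
  have sum_conv: "(set_sum X \<otimes>\<^bsub>group_algebra ?G\<^esub> set_sum Y) (num_perm g) = conv (ind (pull X)) (ind (pull Y)) g"
    if X: "X \<in> Q" and Y: "Y \<in> Q" for X Y g
  proof -
    have finX: "finite X" "finite Y" using sub[OF X] sub[OF Y] finite_subset fin carrier by metis+
    have "(set_sum X \<otimes>\<^bsub>group_algebra ?G\<^esub> set_sum Y) (num_perm g) =
       (\<Sum>x\<in>range num_perm. \<Sum>y\<in>range num_perm. if x \<otimes>\<^bsub>?G\<^esub> y = num_perm g then ind X x * ind Y y else 0)"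
      by (simp only: group_algebra_mult_apply carrier set_sum_apply[OF finX(1)] set_sum_apply[OF finX(2)])
    also have "\<dots> = (\<Sum>h\<in>UNIV. \<Sum>k\<in>UNIV. if h * k = g then ind X (num_perm h) * ind Y (num_perm k) else 0)"
    proof -
      have "inj num_perm" by (simp add: inj_def inj)
      then show ?thesis by (simp add: sum.reindex mult inj)
    qed
    also have "\<dots> = (\<Sum>h\<in>UNIV. \<Sum>k\<in>UNIV. if k = inverse h * g then ind X (num_perm h) * ind Y (num_perm k) else 0)"
    proof -
      have "h * k = g \<longleftrightarrow> k = inverse h * g" for h k :: "pt perm" by (metis perm_mult_inverse)
      then show ?thesis by simp
    qed
    also have "\<dots> = conv (ind (pull X)) (ind (pull Y)) g"
      by (simp add: conv_def ind_def pull_def)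
    finally show ?thesis .
  qed
  interpret commuting_partition "pull ` Q"
  proof
    show "partition_on UNIV (pull ` Q)"
    proof (rule partition_onI)
      show "\<Union>(pull ` Q) = UNIV"
      proof -
        have "g \<in> \<Union>(pull ` Q)" for g
        proof -
          have "num_perm g \<in> \<Union>Q" using part(1) by blast
          then show ?thesis by (auto simp: pull_def)
        qed
        then show ?thesis by blast
      qed
      show "disjnt S T" if "S \<in> pull ` Q" "T \<in> pull ` Q" "S \<noteq> T" for S T
        using that part(2) by (auto simp: pull_def disjnt_def disjoint_def)
      show "{} \<notin> pull ` Q"
      proof
        assume "{} \<in> pull ` Q"
        then obtain X where "X \<in> Q" "pull X = {}" by auto
        then show False using image_pull[of X] part(3) by simp
      qed
    qed
    have "inj_on pull Q" using image_pull by (metis inj_onI)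
    then show "card (pull ` Q) = 76" by (simp add: card_image card_Q)
    show "inverse ` S \<in> pull ` Q" if S: "S \<in> pull ` Q" for S
    proof -
      obtain X where X: "X \<in> Q" "S = pull X" using S by blast
      have inv_block: "set_inv\<^bsub>?G\<^esub> X \<in> Q" using Q X(1) by (auto simp: schur_partition_def)
      have "set_inv\<^bsub>?G\<^esub> X = (\<lambda>h. inv\<^bsub>?G\<^esub> h) ` (num_perm ` pull X)"
        unfolding image_pull[OF X(1)] by (auto simp: SET_INV_def)
      also have "\<dots> = num_perm ` (inverse ` S)" by (simp add: image_image inv X(2))
      finally have "set_inv\<^bsub>?G\<^esub> X = num_perm ` (inverse ` S)" .
      then have "pull (set_inv\<^bsub>?G\<^esub> X) = inverse ` S" by (auto simp: pull_def inj)
      then show ?thesis using inv_block by (metis imageI)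
    qed
    show "conv (ind S) (ind T) = conv (ind T) (ind S)" if ST: "S \<in> pull ` Q" "T \<in> pull ` Q" for S T
    proof
      fix g
      obtain X Y where XY: "X \<in> Q" "Y \<in> Q" "S = pull X" "T = pull Y" using ST by blast
      have "set_sum X \<in> A" "set_sum Y \<in> A" using XY by (auto simp: A intro: cfun.span_base)
      then have "set_sum X \<otimes>\<^bsub>group_algebra ?G\<^esub> set_sum Y = set_sum Y \<otimes>\<^bsub>group_algebra ?G\<^esub> set_sum X"
        using comm by blast
      then show "conv (ind S) (ind T) g = conv (ind T) (ind S) g"
        using sum_conv[OF XY(1,2), of g] sum_conv[OF XY(2,1), of g] by (simp add: XY)
    qed
  qed
  show False by (rule no_commuting_partition)
qed

end
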